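(* Let $\Omega$ be a biased graph with a balancing vertex $u$ such that $F(\Omega)$ is 3-connected and nongraphic. If every vertex $v\in V(\Omega)\setminus\{u\}$ is committed, then every biased graph $\Omega'$ with $F(\Omega')=F(\Omega)$ is obtained as a roll-up of $\Omega$.
   Context: A biased graph $\Omega=(G,\mathcal B)$ consists of a finite graph $G$ (loops and parallel edges allowed) and a collection $\mathcal B$ of cycles of $G$ (a loop is a cycle of length one), called balanced, such that no theta subgraph contains exactly two balanced cycles; other cycles are unbalanced. The frame matroid $F(\Omega)$ is the matroid on $E(G)$ whose circuits are the edge sets of: balanced cycles; two unbalanced cycles sharing exactly one vertex and no edge; two vertex-disjoint unbalanced cycles plus a path joining them meeting each only at an endpoint; theta subgraphs with all three cycles unbalanced. A vertex $u$ is balancing if every cycle of $G-u$ is balanced. $\delta(x)^+$ denotes the set of all edges (links and loops) incident with $x$. A vertex $x$ is committed if $E(G)\setminus\delta(x)^+$ is a hyperplane of $F(\Omega)$ whose restriction is connected and nongraphic. Roll-ups: let $\Omega_0$ be a biased graph with set $U$ of unbalanced loops such that $u$ is a balancing vertex of $\Omega_0\setminus U$, and let $\Sigma_1,\dots,\Sigma_k$ be the unbalancing classes of the links at $u$ in $\Omega_0\setminus U$ (classes of the relation: $e\sim f$ iff $e=f$ or some balanced cycle contains both). Let $\Omega$ be obtained by replacing each loop of $U$ at a vertex $x\neq u$ by an $x$-$u$ link, declaring a cycle balanced iff it meets each of $\Sigma_0:=U,\Sigma_1,\dots,\Sigma_k$ in an even number of edges. For $i\in\{0,\dots,k\}$,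 $\Omega_i$ is obtained from $\Omega$ by replacing each link $e\in\Sigma_i$ with endpoints $u,v$ by an unbalanced loop at $v$. Any member of $\{\Omega,\Omega_0,\dots,\Omega_k\}$ is a roll-up of any other (up to renaming of vertices).
   Formalization: The conclusion is stated for Ω' with its isolated vertices removed, since adding an isolated vertex to Ω leaves F(Ω) unchanged but gives a biased graph that is not a roll-up of Ω. *)

theory Defs
  imports Main
begin

section \<open>Finite graphs with loops and parallel edges\<close>

text \<open>A loop at \<open>v\<close> has \<open>ends e = {v}\<close>; a link has two distinct ends. The value of \<open>ends\<close> outside
  \<open>edges\<close> is irrelevant.\<close>

record ('v, 'e) mgraph =
  verts :: "'v set"
  edges :: "'e set"
  ends :: "'e \<Rightarrow> 'v set"

definition graph :: "('v, 'e, 'z) mgraph_scheme \<Rightarrow> bool" where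
  "graph G \<longleftrightarrow> finite (verts G) \<and> finite (edges G) \<and>
     (\<forall>e\<in>edges G. ends G e \<subseteq> verts G \<and> (card (ends G e) = 1 \<or> card (ends G e) = 2))"

definition is_loop :: "('v, 'e, 'z) mgraph_scheme \<Rightarrow> 'e \<Rightarrow> bool" where
  "is_loop G e \<longleftrightarrow> e \<in> edges G \<and> card (ends G e) = 1"

definition is_link :: "('v, 'e, 'z) mgraph_scheme \<Rightarrow> 'e \<Rightarrow> bool" where
  "is_link G e \<longleftrightarrow> e \<in> edges G \<and> card (ends G e) = 2"

text \<open>The set \<open>\<delta>(x)\<^sup>+\<close> of all links and loops incident with \<open>x\<close>.\<close>

definition star :: "('v, 'e, 'z) mgraph_scheme \<Rightarrow> 'v \<Rightarrow> 'e set" where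
  "star G x = {e \<in> edges G. x \<in> ends G e}"

definition delete_vertex :: "('v, 'e, 'z) mgraph_scheme \<Rightarrow> 'v \<Rightarrow> ('v, 'e) mgraph" where
  "delete_vertex G x = \<lparr>verts = verts G - {x}, edges = edges G - star G x, ends = ends G\<rparr>"

text \<open>Subgraphs without isolated vertices are represented by their edge sets.\<close>

definition vset :: "('v, 'e, 'z) mgraph_scheme \<Rightarrow> 'e set \<Rightarrow> 'v set" where
  "vset G X = (\<Union>e\<in>X. ends G e)"

text \<open>A loop contributes two to the degree of its vertex.\<close>

definition deg :: "('v, 'e, 'z) mgraph_scheme \<Rightarrow> 'e set \<Rightarrow> 'v \<Rightarrow> nat" where
  "deg G X v = card {e \<in> X. v \<in> ends G e} + card {e \<in> X. ends G e = {v}}"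

definition conn :: "('v, 'e, 'z) mgraph_scheme \<Rightarrow> 'e set \<Rightarrow> bool" where
  "conn G X \<longleftrightarrow>
     (\<forall>x\<in>vset G X. \<forall>y\<in>vset G X. (x, y) \<in> {(a, b). \<exists>e\<in>X. ends G e = {a, b}}\<^sup>*)"

definition cycle :: "('v, 'e, 'z) mgraph_scheme \<Rightarrow> 'e set \<Rightarrow> bool" where
  "cycle G C \<longleftrightarrow> C \<subseteq> edges G \<and> C \<noteq> {} \<and> conn G C \<and> (\<forall>v\<in>vset G C. deg G C v = 2)"

definition is_path :: "('v, 'e, 'z) mgraph_scheme \<Rightarrow> 'v \<Rightarrow> 'v \<Rightarrow> 'e set \<Rightarrow> bool" where
  "is_path G x y P \<longleftrightarrow> P \<subseteq> edges G \<and> x \<noteq> y \<and> conn G P \<and> deg G P x = 1 \<and> deg G P y = 1 \<and>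
     (\<forall>v\<in>vset G P - {x, y}. deg G P v = 2)"

definition theta :: "('v, 'e, 'z) mgraph_scheme \<Rightarrow> 'e set \<Rightarrow> bool" where
  "theta G T \<longleftrightarrow> (\<exists>x y P1 P2 P3. T = P1 \<union> P2 \<union> P3 \<and>
     is_path G x y P1 \<and> is_path G x y P2 \<and> is_path G x y P3 \<and>
     P1 \<inter> P2 = {} \<and> P1 \<inter> P3 = {} \<and> P2 \<inter> P3 = {} \<and>
     vset G P1 \<inter> vset G P2 = {x, y} \<and> vset G P1 \<inter> vset G P3 = {x, y} \<and>
     vset G P2 \<inter> vset G P3 = {x, y})"


section \<open>Matroids, presented by their circuits\<close>

text \<open>The notions of this section are only meant for pairs that satisfy the circuit axioms, as those
  of frame matroids and cycle matroids do (Zaslavsky, Whitney), and for finite ground sets.\<close>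

record 'e matroid =
  ground :: "'e set"
  circuits :: "'e set set"

definition indep :: "'e matroid \<Rightarrow> 'e set \<Rightarrow> bool" where
  "indep M I \<longleftrightarrow> I \<subseteq> ground M \<and> \<not> (\<exists>C\<in>circuits M. C \<subseteq> I)"

definition matroid_rank :: "'e matroid \<Rightarrow> 'e set \<Rightarrow> nat" where
  "matroid_rank M X = Max {card I | I. I \<subseteq> X \<and> indep M I}"

definition flat :: "'e matroid \<Rightarrow> 'e set \<Rightarrow> bool" where
  "flat M X \<longleftrightarrow> X \<subseteq> ground M \<and> (\<forall>e\<in>ground M - X. matroid_rank M (insert e X) > matroid_rank M X)"

definition hyperplane :: "'e matroid \<Rightarrow> 'e set \<Rightarrow> bool" where
  "hyperplane M H \<longleftrightarrow> flat M H \<and> matroid_rank M H + 1 = matroid_rank M (ground M)"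

definition restriction :: "'e matroid \<Rightarrow> 'e set \<Rightarrow> 'e matroid" where
  "restriction M X = \<lparr>ground = ground M \<inter> X, circuits = {C \<in> circuits M. C \<subseteq> X}\<rparr>"

definition matroid_connected :: "'e matroid \<Rightarrow> bool" where
  "matroid_connected M \<longleftrightarrow>
     (\<forall>e\<in>ground M. \<forall>f\<in>ground M. e \<noteq> f \<longrightarrow> (\<exists>C\<in>circuits M. e \<in> C \<and> f \<in> C))"

definition k_separation :: "'e matroid \<Rightarrow> nat \<Rightarrow> 'e set \<Rightarrow> bool" where
  "k_separation M k X \<longleftrightarrow> X \<subseteq> ground M \<and> card X \<ge> k \<and> card (ground M - X) \<ge> k \<and>
     matroid_rank M X + matroid_rank M (ground M - X) < matroid_rank M (ground M) + k"

text \<open>Tutte connectivity.\<close>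

definition n_connected :: "nat \<Rightarrow> 'e matroid \<Rightarrow> bool" where
  "n_connected n M \<longleftrightarrow> \<not> (\<exists>k X. 1 \<le> k \<and> k < n \<and> k_separation M k X)"

definition cycle_matroid :: "('v, 'e, 'z) mgraph_scheme \<Rightarrow> 'e matroid" where
  "cycle_matroid G = \<lparr>ground = edges G, circuits = {C. cycle G C}\<rparr>"

text \<open>Graphs being finite, taking the vertices in \<open>nat\<close> is no restriction; edges can be relabelled
  by the elements of the matroid, so equality replaces isomorphism.\<close>

definition graphic :: "'e matroid \<Rightarrow> bool" where
  "graphic M \<longleftrightarrow> (\<exists>H :: (nat, 'e) mgraph. graph H \<and> cycle_matroid H = M)"


section \<open>Biased graphs and frame matroids\<close>

record ('v, 'e) bgraph = "('v, 'e) mgraph" +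
  balanced :: "'e set set"

definition biased_graph :: "('v, 'e) bgraph \<Rightarrow> bool" where
  "biased_graph \<Omega> \<longleftrightarrow> graph \<Omega> \<and> (\<forall>C\<in>balanced \<Omega>. cycle \<Omega> C) \<and>
     (\<forall>T. theta \<Omega> T \<longrightarrow> card {C \<in> balanced \<Omega>. C \<subseteq> T} \<noteq> 2)"

definition unbalanced_cycle :: "('v, 'e) bgraph \<Rightarrow> 'e set \<Rightarrow> bool" where
  "unbalanced_cycle \<Omega> C \<longleftrightarrow> cycle \<Omega> C \<and> C \<notin> balanced \<Omega>"

definition tight_handcuff :: "('v, 'e) bgraph \<Rightarrow> 'e set \<Rightarrow> bool" where
  "tight_handcuff \<Omega> X \<longleftrightarrow> (\<exists>C1 C2 v. X = C1 \<union> C2 \<and>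
     unbalanced_cycle \<Omega> C1 \<and> unbalanced_cycle \<Omega> C2 \<and>
     C1 \<inter> C2 = {} \<and> vset \<Omega> C1 \<inter> vset \<Omega> C2 = {v})"

definition loose_handcuff :: "('v, 'e) bgraph \<Rightarrow> 'e set \<Rightarrow> bool" where
  "loose_handcuff \<Omega> X \<longleftrightarrow> (\<exists>C1 C2 P x y. X = C1 \<union> C2 \<union> P \<and>
     unbalanced_cycle \<Omega> C1 \<and> unbalanced_cycle \<Omega> C2 \<and> is_path \<Omega> x y P \<and>
     vset \<Omega> C1 \<inter> vset \<Omega> C2 = {} \<and>
     vset \<Omega> P \<inter> vset \<Omega> C1 = {x} \<and> vset \<Omega> P \<inter> vset \<Omega> C2 = {y})"

definition unbalanced_theta :: "('v, 'e) bgraph \<Rightarrow> 'e set \<Rightarrow> bool" where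
  "unbalanced_theta \<Omega> T \<longleftrightarrow>
     theta \<Omega> T \<and> (\<forall>C. cycle \<Omega> C \<and> C \<subseteq> T \<longrightarrow> unbalanced_cycle \<Omega> C)"

definition frame_matroid :: "('v, 'e) bgraph \<Rightarrow> 'e matroid" where
  "frame_matroid \<Omega> = \<lparr>ground = edges \<Omega>,
     circuits = balanced \<Omega> \<union> {X. tight_handcuff \<Omega> X} \<union> {X. loose_handcuff \<Omega> X} \<union>
       {X. unbalanced_theta \<Omega> X}\<rparr>"

definition balancing :: "('v, 'e) bgraph \<Rightarrow> 'v \<Rightarrow> bool" where
  "balancing \<Omega> u \<longleftrightarrow> u \<in> verts \<Omega> \<and> (\<forall>C. cycle (delete_vertex \<Omega> u) C \<longrightarrow> C \<in> balanced \<Omega>)"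

definition committed :: "('v, 'e) bgraph \<Rightarrow> 'v \<Rightarrow> bool" where
  "committed \<Omega> x \<longleftrightarrow>
     hyperplane (frame_matroid \<Omega>) (edges \<Omega> - star \<Omega> x) \<and>
     matroid_connected (restriction (frame_matroid \<Omega>) (edges \<Omega> - star \<Omega> x)) \<and>
     \<not> graphic (restriction (frame_matroid \<Omega>) (edges \<Omega> - star \<Omega> x))"


section \<open>Roll-ups\<close>

definition delete_edges :: "('v, 'e) bgraph \<Rightarrow> 'e set \<Rightarrow> ('v, 'e) bgraph" where
  "delete_edges \<Omega> X = \<Omega>\<lparr>edges := edges \<Omega> - X, balanced := {C \<in> balanced \<Omega>. C \<inter> X = {}}\<rparr>"

definition unbalanced_loops :: "('v, 'e) bgraph \<Rightarrow> 'e set" where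
  "unbalanced_loops \<Omega> = {e. is_loop \<Omega> e \<and> {e} \<notin> balanced \<Omega>}"

definition links_at :: "('v, 'e) bgraph \<Rightarrow> 'v \<Rightarrow> 'e set" where
  "links_at \<Omega> u = {e \<in> star \<Omega> u. is_link \<Omega> e}"

definition unbalancing_rel :: "('v, 'e) bgraph \<Rightarrow> 'v \<Rightarrow> ('e \<times> 'e) set" where
  "unbalancing_rel \<Omega> u = {(e, f). e \<in> links_at \<Omega> u \<and> f \<in> links_at \<Omega> u \<and>
     (e = f \<or> (\<exists>C\<in>balanced \<Omega>. e \<in> C \<and> f \<in> C))}"

definition unbalancing_classes :: "('v, 'e) bgraph \<Rightarrow> 'v \<Rightarrow> 'e set set" where
  "unbalancing_classes \<Omega> u = links_at \<Omega> u // unbalancing_rel \<Omega> u"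

text \<open>The sets \<open>\<Sigma>\<^sub>0 = U, \<Sigma>\<^sub>1, \<dots>, \<Sigma>\<^sub>k\<close>.\<close>

definition roll_classes :: "('v, 'e) bgraph \<Rightarrow> 'v \<Rightarrow> 'e set set" where
  "roll_classes \<Omega>0 u = insert (unbalanced_loops \<Omega>0)
     (unbalancing_classes (delete_edges \<Omega>0 (unbalanced_loops \<Omega>0)) u)"

text \<open>A loop of \<open>U\<close> at \<open>u\<close> itself stays a loop, and stays unbalanced because it meets \<open>\<Sigma>\<^sub>0\<close> once.\<close>

definition unroll :: "('v, 'e) bgraph \<Rightarrow> 'v \<Rightarrow> ('v, 'e) bgraph" where
  "unroll \<Omega>0 u =
     (let G = \<Omega>0\<lparr>ends := \<lambda>e. if e \<in> unbalanced_loops \<Omega>0 then insert u (ends \<Omega>0 e) else ends \<Omega>0 e\<rparr>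
      in G\<lparr>balanced := {C. cycle G C \<and> (\<forall>S\<in>roll_classes \<Omega>0 u. even (card (C \<inter> S)))}\<rparr>)"

text \<open>\<open>S\<close> will be one of the sets \<open>\<Sigma>\<^sub>i\<close>, whose links are all incident with \<open>u\<close>. The cycles of the
  resulting graph are the new loops and the old cycles that avoid the replaced links.\<close>

definition roll :: "('v, 'e) bgraph \<Rightarrow> 'v \<Rightarrow> 'e set \<Rightarrow> ('v, 'e) bgraph" where
  "roll \<Omega> u S = (let L = {e \<in> S. is_link \<Omega> e} in
     \<Omega>\<lparr>ends := \<lambda>e. if e \<in> L then ends \<Omega> e - {u} else ends \<Omega> e,
       balanced := {C \<in> balanced \<Omega>. C \<inter> L = {}}\<rparr>)"

text \<open>The set \<open>{\<Omega>, \<Omega>\<^sub>0, \<dots>, \<Omega>\<^sub>k}\<close> determined by \<open>\<Omega>\<^sub>0\<close> and \<open>u\<close>.\<close>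

definition roll_family :: "('v, 'e) bgraph \<Rightarrow> 'v \<Rightarrow> ('v, 'e) bgraph set" where
  "roll_family \<Omega>0 u = insert (unroll \<Omega>0 u) (roll (unroll \<Omega>0 u) u ` roll_classes \<Omega>0 u)"

text \<open>Edges keep their names, since the biased graphs compared represent a matroid on the same set.\<close>

definition vertex_renaming :: "('v, 'e) bgraph \<Rightarrow> ('w, 'e) bgraph \<Rightarrow> bool" where
  "vertex_renaming \<Psi> \<Omega> \<longleftrightarrow> edges \<Psi> = edges \<Omega> \<and> balanced \<Psi> = balanced \<Omega> \<and>
     (\<exists>f. bij_betw f (verts \<Psi>) (verts \<Omega>) \<and> (\<forall>e\<in>edges \<Psi>. ends \<Omega> e = f ` ends \<Psi> e))"

definition is_roll_up_of :: "('w, 'e) bgraph \<Rightarrow> ('v, 'e) bgraph \<Rightarrow> bool" where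
  "is_roll_up_of \<Omega>' \<Omega> \<longleftrightarrow> (\<exists>\<Omega>0 u. biased_graph \<Omega>0 \<and>
     balancing (delete_edges \<Omega>0 (unbalanced_loops \<Omega>0)) u \<and>
     \<Omega> \<in> roll_family \<Omega>0 u \<and> (\<exists>\<Psi>\<in>roll_family \<Omega>0 u. vertex_renaming \<Psi> \<Omega>'))"

text \<open>The frame matroid does not see isolated vertices, so it determines a biased graph only up to
  these.\<close>

definition without_isolated :: "('v, 'e) bgraph \<Rightarrow> ('v, 'e) bgraph" where
  "without_isolated \<Omega> = \<Omega>\<lparr>verts := vset \<Omega> (edges \<Omega>)\<rparr>"

end

(* In a biased graph whose frame matroid is connected and nongraphic, the rank is the number of
   non-isolated vertices.  A connected nongraphic hyperplane then spans all vertices but one, hence is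
   the complement of a vertex star in every representation.  So for each committed v there is a vertex
   f v of \<Omega>' with the same star, and since both graphs have equally many vertices, exactly one
   vertex of \<Omega>' remains, which corresponds to u.  The only freedom left is the set R of links uv of
   \<Omega> that are loops at f v in \<Omega>'.  A balanced cycle through two links at u keeps both or turns both
   into loops, for otherwise it would have a vertex of degree one in \<Omega>' without ceasing to be a
   circuit.  Two links in R are joined by a path of \<Omega> - u (connected by 3-connectedness); in \<Omega>' this
   is a handcuff, so in \<Omega> the resulting cycle is balanced.  Hence R is empty or an unbalancing class.
   That \<Omega> itself belongs to its roll-up family is the fact that a cycle through u is balanced iff its
   two links at u are equivalent, which follows from the theta property. *)

theory Submission
  imports Defs
begin

section \<open>Paths, cycles and thetas as edge sets\<close>

text \<open>A set is balanced in a representation exactly when it is a cycle there and a circuit of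
  the matroid (\<open>balanced_iff_circuit\<close>). Both graphs have the same circuits, so it
  suffices to compare \<open>ends\<close>; the balanced cycles follow. Nongraphicness is used
  through the unbalanced cycle it supplies: a set whose cycles are all balanced restricts to a cycle
  matroid. Such a cycle has as many edges as vertices, which is what lifts the rank of a connected
  set from the number of its vertices minus one to the full number. In the definition of roll-ups
  \<open>\<Omega>\<close> serves as its own \<open>\<Omega>0\<close>. Since \<open>u\<close> is
  balancing, every unbalanced loop already sits at \<open>u\<close>, so unrolling moves no edge, and
  the work lies in showing that the parity rule returns the given bias. One theta is not enough for
  this: two cycles through the same two links at \<open>u\<close> may cross many times. One is
  therefore transformed into the other by exchanging one ear at a time.\<close>

lemma vset_simps [simp]:
  "vset G {} = {}" "vset G (insert e X) = ends G e \<union> vset G X"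
  "vset G (X \<union> Y) = vset G X \<union> vset G Y"
  by (auto simp: vset_def)

lemma vset_mono: "X \<subseteq> Y \<Longrightarrow> vset G X \<subseteq> vset G Y"
  by (auto simp: vset_def)

lemma deg_empty [simp]: "deg G {} v = 0"
  by (simp add: deg_def)

lemma deg_mono: "finite Y \<Longrightarrow> X \<subseteq> Y \<Longrightarrow> deg G X v \<le> deg G Y v"
  unfolding deg_def by (intro add_mono card_mono) auto

lemma deg_insert:
  assumes "finite X" "e \<notin> X"
  shows "deg G (insert e X) v =
    deg G X v + (if v \<in> ends G e then 1 else 0) + (if ends G e = {v} then 1 else 0)"
proof -
  have "{x \<in> insert e X. Q x} = (if Q e then insert e {x \<in> X. Q x} else {x \<in> X. Q x})" for Q
    by auto
  with assms show ?thesis by (simp add: deg_def)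
qed

lemma deg_Un_disjoint:
  assumes "finite X" "finite Y" "X \<inter> Y = {}"
  shows "deg G (X \<union> Y) v = deg G X v + deg G Y v"
proof -
  have "{x \<in> X \<union> Y. Q x} = {x \<in> X. Q x} \<union> {x \<in> Y. Q x}" for Q by auto
  moreover have "card ({x \<in> X. Q x} \<union> {x \<in> Y. Q x}) = card {x \<in> X. Q x} + card {x \<in> Y. Q x}" for Q
    using assms by (intro card_Un_disjoint) auto
  ultimately show ?thesis by (simp add: deg_def)
qed

lemma deg_notin: "v \<notin> vset G X \<Longrightarrow> deg G X v = 0"
proof -
  assume "v \<notin> vset G X"
  then have "{e \<in> X. v \<in> ends G e} = {}" "{e \<in> X. ends G e = {v}} = {}"
    by (auto simp: vset_def)
  then show ?thesis by (simp only: deg_def card.empty)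
qed

lemma deg_cong_star:
  "{e \<in> X. v \<in> ends G e} = {e \<in> Y. v \<in> ends G e} \<Longrightarrow> deg G X v = deg G Y v"
proof -
  assume *: "{e \<in> X. v \<in> ends G e} = {e \<in> Y. v \<in> ends G e}"
  then have "{e \<in> X. ends G e = {v}} = {e \<in> Y. ends G e = {v}}" by blast
  with * show ?thesis by (simp add: deg_def)
qed

lemma deg_pos: "finite X \<Longrightarrow> v \<in> vset G X \<Longrightarrow> 0 < deg G X v"
  by (auto simp: deg_def vset_def card_gt_0_iff)

text \<open>An edge of \<open>Y\<close> at \<open>v\<close> outside \<open>X\<close> would make the
  degree of \<open>X\<close> at \<open>v\<close> fall short of that of \<open>Y\<close>.\<close>

lemma star_subset_of_deg_le:
  assumes "finite Y" "X \<subseteq> Y" "deg G Y v \<le> deg G X v"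
  shows "{e \<in> Y. v \<in> ends G e} \<subseteq> X"
proof (rule ccontr)
  assume "\<not> ?thesis"
  then obtain e where e: "e \<in> Y" "v \<in> ends G e" "e \<notin> X" by blast
  have "finite X" using assms finite_subset by blast
  then have "deg G X v < deg G (insert e X) v" using e by (simp add: deg_insert)
  also have "\<dots> \<le> deg G Y v" using assms e by (intro deg_mono) auto
  finally show False using assms by simp
qed

text \<open>Names the relation that \<open>conn\<close> writes out in full, so that its closure can
  be manipulated.\<close>

definition adj :: "('v, 'e, 'z) mgraph_scheme \<Rightarrow> 'e set \<Rightarrow> ('v \<times> 'v) set" where
  "adj G X = {(a, b). \<exists>e\<in>X. ends G e = {a, b}}"

lemma conn_adj: "conn G X \<longleftrightarrow> (\<forall>x\<in>vset G X. \<forall>y\<in>vset G X. (x, y) \<in> (adj G X)\<^sup>*)"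
  by (simp add: conn_def adj_def)

lemma adj_mono: "X \<subseteq> Y \<Longrightarrow> (adj G X)\<^sup>* \<subseteq> (adj G Y)\<^sup>*"
  by (rule rtrancl_mono) (auto simp: adj_def)

lemma adj_rtrancl_sym: "(x, y) \<in> (adj G X)\<^sup>* \<Longrightarrow> (y, x) \<in> (adj G X)\<^sup>*"
proof -
  have "sym (adj G X)" by (auto simp: sym_def adj_def insert_commute)
  then show "(x, y) \<in> (adj G X)\<^sup>* \<Longrightarrow> (y, x) \<in> (adj G X)\<^sup>*"
    by (rule symD[OF sym_rtrancl])
qed

lemma connI_from:
  assumes "\<And>y. y \<in> vset G X \<Longrightarrow> (x, y) \<in> (adj G X)\<^sup>*"
  shows "conn G X"
  unfolding conn_adj using rtrancl_trans[OF adj_rtrancl_sym[OF assms] assms] by blast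

lemma conn_Un:
  assumes "conn G X" "conn G Y" "z \<in> vset G X" "z \<in> vset G Y"
  shows "conn G (X \<union> Y)"
proof (rule connI_from)
  fix y assume "y \<in> vset G (X \<union> Y)"
  then have "(z, y) \<in> (adj G X)\<^sup>* \<or> (z, y) \<in> (adj G Y)\<^sup>*"
    using assms unfolding conn_adj vset_simps(3) by blast
  then show "(z, y) \<in> (adj G (X \<union> Y))\<^sup>*"
    using subsetD[OF adj_mono[of X "X \<union> Y" G]] subsetD[OF adj_mono[of Y "X \<union> Y" G]] by blast
qed

text \<open>Reachability from a vertex of \<open>Y\<close> never leaves \<open>Y\<close>, because
  closedness puts every edge used on the way into \<open>Y\<close>. The minimality of cycles is
  derived from this.\<close>

lemma conn_closed_subset:
  assumes "conn G X" "Y \<subseteq> X" "Y \<noteq> {}" and ne: "\<And>e. e \<in> X \<Longrightarrow> ends G e \<noteq> {}"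
    and closed: "\<And>v. v \<in> vset G Y \<Longrightarrow> {e \<in> X. v \<in> ends G e} \<subseteq> Y"
  shows "Y = X"
proof -
  have closed': "e \<in> Y" if "v \<in> vset G Y" "e \<in> X" "v \<in> ends G e" for v e
    using closed[OF that(1)] that(2,3) by blast
  obtain e0 where "e0 \<in> Y" using assms(3) by blast
  moreover obtain x where "x \<in> ends G e0" using ne \<open>e0 \<in> Y\<close> assms(2) by blast
  ultimately have x: "x \<in> vset G Y" unfolding vset_def by blast
  then have xX: "x \<in> vset G X" using vset_mono[OF assms(2), of G] by blast
  have reach: "y \<in> vset G Y" if "(x, y) \<in> (adj G X)\<^sup>*" for y
    using that
  proof induction
    case base show ?case by (rule x)
  next
    case (step y z)
    then obtain e where e: "e \<in> X" "ends G e = {y, z}" unfolding adj_def by blast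
    then have "e \<in> Y" using closed'[OF step.IH] by blast
    then show ?case using e unfolding vset_def by blast
  qed
  have "e \<in> Y" if "e \<in> X" for e
  proof -
    obtain v where v: "v \<in> ends G e" using ne \<open>e \<in> X\<close> by blast
    then have "v \<in> vset G X" using that unfolding vset_def by blast
    then have "v \<in> vset G Y" using reach xX assms(1) unfolding conn_adj by blast
    then show ?thesis using closed' v that by blast
  qed
  then show ?thesis using assms(2) by blast
qed

text \<open>Unlike \<^const>\<open>is_path\<close>, this includes the trivial path from \<open>x\<close> to \<open>x\<close> with edge set \<open>{}\<close>,
  so the vertex set of \<open>P\<close> is \<open>insert x (vset G P)\<close>.\<close>

inductive gpath :: "('v, 'e, 'z) mgraph_scheme \<Rightarrow> 'v \<Rightarrow> 'v \<Rightarrow> 'e set \<Rightarrow> bool" for G x where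
  refl: "gpath G x x {}"
| step: "gpath G x y P \<Longrightarrow> e \<in> edges G \<Longrightarrow> ends G e = {y, z} \<Longrightarrow> z \<notin> insert x (vset G P) \<Longrightarrow>
    gpath G x z (insert e P)"

lemma gpath_edges: "gpath G x y P \<Longrightarrow> P \<subseteq> edges G"
  by (induction rule: gpath.induct) auto

lemma gpath_finite: "gpath G x y P \<Longrightarrow> finite P"
  by (induction rule: gpath.induct) auto

lemma gpath_end: "gpath G x y P \<Longrightarrow> y \<in> insert x (vset G P)"
  by (induction rule: gpath.induct) auto

lemma gpath_start: "gpath G x y P \<Longrightarrow> P \<noteq> {} \<Longrightarrow> x \<in> vset G P"
  by (induction rule: gpath.induct) (auto elim: gpath.cases)

lemma gpath_trivial: "gpath G x x P \<Longrightarrow> P = {}"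
  by (erule gpath.cases) auto

lemma gpath_neq:
  assumes "gpath G x y P" "x \<noteq> y"
  shows "P \<noteq> {}" "x \<in> vset G P" "y \<in> vset G P"
proof -
  show "P \<noteq> {}" using assms by (auto elim: gpath.cases)
  then show "x \<in> vset G P" using gpath_start assms by metis
  show "y \<in> vset G P" using gpath_end assms by fastforce
qed

text \<open>With vertex sets written as \<open>insert x (vset G P)\<close>, this moves the base
  point to the other end, as is needed whenever a path is reversed.\<close>

lemma gpath_insert_end: "gpath G x y P \<Longrightarrow> insert x (vset G P) = insert y (vset G P)"
  by (cases "x = y") (auto dest: gpath_neq)

lemma gpath_edge: "e \<in> edges G \<Longrightarrow> ends G e = {x, y} \<Longrightarrow> x \<noteq> y \<Longrightarrow> gpath G x y {e}"
  using gpath.step[OF gpath.refl, of e G x y] by simp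

text \<open>Putting the end corrections on the left gives one equation for ends, inner vertices,
  vertices off the path, and also the trivial path, whose only vertex counts as an end
  twice.\<close>

lemma gpath_deg:
  "gpath G x y P \<Longrightarrow> deg G P v + (if v = x then 1 else 0) + (if v = y then 1 else 0) =
     (if v \<in> insert x (vset G P) then 2 else 0)"
proof (induction rule: gpath.induct)
  case refl then show ?case by simp
next
  case (step y P e z)
  have "e \<notin> P" using step.hyps by (auto simp: vset_def)
  moreover have "y \<noteq> z" using gpath_end[OF step.hyps(1)] step.hyps by auto
  moreover have "y \<in> insert x (vset G P)" using gpath_end step.hyps by metis
  ultimately show ?case using step gpath_finite[OF step.hyps(1)]
    by (auto simp: deg_insert doubleton_eq_iff split: if_splits)
qed

lemma gpath_card: "gpath G x y P \<Longrightarrow> card (insert x (vset G P)) = card P + 1 \<and> finite (vset G P)"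
proof (induction rule: gpath.induct)
  case refl then show ?case by simp
next
  case (step y P e z)
  have "e \<notin> P" using step.hyps by (auto simp: vset_def)
  moreover have "insert x (vset G (insert e P)) = insert z (insert x (vset G P))"
    using gpath_end[OF step.hyps(1)] step.hyps by auto
  ultimately show ?case using step gpath_finite[OF step.hyps(1)] by simp
qed

lemma gpath_conn: "gpath G x y P \<Longrightarrow> conn G P"
proof -
  assume "gpath G x y P"
  then have "\<forall>v \<in> insert x (vset G P). (x, v) \<in> (adj G P)\<^sup>*"
  proof (induction rule: gpath.induct)
    case refl then show ?case by simp
  next
    case (step y P e z)
    have *: "\<And>v. v \<in> insert x (vset G P) \<Longrightarrow> (x, v) \<in> (adj G (insert e P))\<^sup>*"
      using step.IH adj_mono[of P "insert e P" G] by blast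
    have y: "y \<in> insert x (vset G P)" using gpath_end step.hyps by metis
    have "(y, z) \<in> adj G (insert e P)" using step.hyps by (auto simp: adj_def)
    then have "(x, z) \<in> (adj G (insert e P))\<^sup>*" using *[OF y] by simp
    then show ?case using * y step.hyps by auto
  qed
  then show ?thesis by (intro connI_from) auto
qed

text \<open>Steps extend a path at its far end, so the induction runs over the second path; hence
  \<open>Q\<close> comes in the first premise.\<close>

lemma gpath_join:
  assumes "gpath G y z Q" "gpath G x y P"
    "insert x (vset G P) \<inter> insert y (vset G Q) \<subseteq> {y}"
  shows "gpath G x z (P \<union> Q)"
  using assms
proof (induction rule: gpath.induct)
  case refl then show ?case by simp
next
  case (step w Q e z)
  have "gpath G x w (P \<union> Q)" using step by auto
  moreover have "z \<notin> insert x (vset G (P \<union> Q))" using step by auto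
  ultimately have "gpath G x z (insert e (P \<union> Q))" using step.hyps gpath.step by metis
  then show ?case by simp
qed

lemma gpath_Cons:
  assumes "e \<in> edges G" "ends G e = {u, x}" "gpath G x y P" "u \<notin> insert x (vset G P)"
  shows "gpath G u y (insert e P)"
proof -
  have "u \<noteq> x" using assms(4) by blast
  have "insert u (vset G {e}) \<inter> insert x (vset G P) \<subseteq> {x}" using assms(2,4) by auto
  then have "gpath G u y ({e} \<union> P)"
    by (rule gpath_join[OF assms(3) gpath_edge[OF assms(1,2) \<open>u \<noteq> x\<close>]])
  then show ?thesis by simp
qed

lemma gpath_rev: "gpath G x y P \<Longrightarrow> gpath G y x P"
proof (induction rule: gpath.induct)
  case refl show ?case by (rule gpath.refl)
next
  case (step y P e z)
  have yz: "y \<noteq> z" using gpath_end[OF step.hyps(1)] step.hyps by auto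
  then have "gpath G z y {e}" using step.hyps by (intro gpath_edge) auto
  moreover have "insert z (vset G {e}) \<inter> insert y (vset G P) \<subseteq> {y}"
    using step.hyps gpath_insert_end[OF step.hyps(1)] by auto
  ultimately show ?case using gpath_join[OF step.IH] by fastforce
qed

lemma gpath_split:
  assumes "gpath G x y P" "z \<in> insert x (vset G P)"
  obtains P1 P2 where "P = P1 \<union> P2" "P1 \<inter> P2 = {}" "gpath G x z P1" "gpath G z y P2"
    "insert x (vset G P1) \<inter> insert z (vset G P2) = {z}"
  using assms
proof (induction arbitrary: thesis rule: gpath.induct)
  case refl
  then show ?case using gpath.refl[of G x] by (intro refl(1)[of "{}" "{}"]) auto
next
  case (step y P e w)
  have ew: "e \<notin> P" using step.hyps by (auto simp: vset_def)
  have P: "gpath G x w (insert e P)" by (rule gpath.step[OF step.hyps])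
  show ?case
  proof (cases "z \<in> insert x (vset G P)")
    case True
    obtain P1 P2 where *: "P = P1 \<union> P2" "P1 \<inter> P2 = {}" "gpath G x z P1" "gpath G z y P2"
      and i: "insert x (vset G P1) \<inter> insert z (vset G P2) = {z}"
      using step.IH[OF _ True] by blast
    have w: "w \<notin> insert x (vset G P1)" "w \<notin> insert z (vset G P2)"
      using step.hyps(4) True unfolding *(1) by auto
    have y: "y \<in> insert z (vset G P2)" by (rule gpath_end[OF *(4)])
    have 1: "gpath G z w (insert e P2)" by (rule gpath.step[OF *(4) step.hyps(2,3) w(2)])
    have 2: "insert x (vset G P1) \<inter> insert z (vset G (insert e P2)) = {z}"
      using i w y step.hyps(3) by auto
    show ?thesis
      by (rule step.prems(1)[of P1 "insert e P2"]) (use * ew 1 2 in auto)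
  next
    case False
    then have "z = w" using step.prems(2) step.hyps(3) gpath_end[OF step.hyps(1)] by auto
    show ?thesis unfolding \<open>z = w\<close>
      by (rule step.prems(1)[of "insert e P" "{}"])
        (use P gpath.refl[of G w] gpath_end[OF P] \<open>z = w\<close> in simp_all)
  qed
qed

lemma gpath_is_path: "gpath G x y P \<Longrightarrow> x \<noteq> y \<Longrightarrow> is_path G x y P"
  unfolding is_path_def
proof (intro conjI ballI)
  assume P: "gpath G x y P" and n: "x \<noteq> y"
  show "P \<subseteq> edges G" using P by (rule gpath_edges)
  show "x \<noteq> y" by fact
  show "conn G P" using P by (rule gpath_conn)
  show "deg G P x = 1" using gpath_deg[OF P, of x] n by simp
  show "deg G P y = 1" using gpath_deg[OF P, of y] gpath_end[OF P] n by simp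
  show "deg G P v = 2" if "v \<in> vset G P - {x, y}" for v
    using gpath_deg[OF P, of v] that by simp
qed

lemma cycle_of_gpaths:
  assumes P: "gpath G x y P" and Q: "gpath G x y Q" and n: "x \<noteq> y" and d: "P \<inter> Q = {}"
    and v: "vset G P \<inter> vset G Q = {x, y}"
  shows "cycle G (P \<union> Q)"
  unfolding cycle_def
proof (intro conjI ballI)
  show "P \<union> Q \<subseteq> edges G" using gpath_edges[OF P] gpath_edges[OF Q] by (rule Un_least)
  show "P \<union> Q \<noteq> {}" using gpath_neq(1)[OF P n] by blast
  show "conn G (P \<union> Q)"
    by (rule conn_Un[OF gpath_conn[OF P] gpath_conn[OF Q] gpath_neq(2)[OF P n] gpath_neq(2)[OF Q n]])
  fix w assume "w \<in> vset G (P \<union> Q)"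
  then consider "w = x" | "w = y" | "w \<notin> {x, y}" "w \<in> vset G P" "w \<notin> vset G Q"
    | "w \<notin> {x, y}" "w \<in> vset G Q" "w \<notin> vset G P" using v unfolding vset_simps by blast
  moreover note gpath_deg[OF P, of w] gpath_deg[OF Q, of w] gpath_neq(2,3)[OF P n]
    gpath_neq(2,3)[OF Q n] n
    deg_Un_disjoint[OF gpath_finite[OF P] gpath_finite[OF Q] d, of G w]
  ultimately show "deg G (P \<union> Q) w = 2" by cases simp_all
qed

lemma theta_of_gpaths:
  assumes "gpath G x y P1" "gpath G x y P2" "gpath G x y P3" "x \<noteq> y"
    "P1 \<inter> P2 = {}" "P1 \<inter> P3 = {}" "P2 \<inter> P3 = {}"
    "vset G P1 \<inter> vset G P2 = {x, y}" "vset G P1 \<inter> vset G P3 = {x, y}"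
    "vset G P2 \<inter> vset G P3 = {x, y}"
  shows "theta G (P1 \<union> P2 \<union> P3)"
  unfolding theta_def
  by (rule exI[of _ x], rule exI[of _ y], rule exI[of _ P1], rule exI[of _ P2], rule exI[of _ P3])
    (simp only: assms gpath_is_path not_False_eq_True)

text \<open>An inner vertex has exactly two edges of \<open>P\<close>. A subset that never has
  degree one there keeps both or neither, and this choice propagates from one end to the
  other.\<close>

lemma gpath_all_or_nothing:
  assumes "gpath G x y P" "Q \<subseteq> P" "\<And>v. v \<in> vset G P - {x, y} \<Longrightarrow> deg G Q v \<noteq> 1"
  shows "Q = {} \<or> Q = P"
  using assms
proof (induction arbitrary: Q rule: gpath.induct)
  case refl then show ?case by simp
next
  case (step y P e z)
  have ew: "e \<notin> P" using step.hyps by (auto simp: vset_def)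
  have yz: "y \<noteq> z" using gpath_end[OF step.hyps(1)] step.hyps by auto
  note fin = gpath_finite[OF step.hyps(1)]
  \<comment> \<open>\<open>e\<close> touches the shorter path only at \<open>y\<close>, so removing
    it leaves the degrees at the inner vertices of that path unchanged. The degree at
    \<open>y\<close> later decides whether \<open>e\<close> joins in.\<close>
  have IH: "Q - {e} = {} \<or> Q - {e} = P"
  proof (rule step.IH)
    show "Q - {e} \<subseteq> P" using step.prems by auto
    fix v assume v: "v \<in> vset G P - {x, y}"
    then have "v \<noteq> z" using step.hyps by auto
    then have "deg G (Q - {e}) v = deg G Q v"
      using v step.hyps by (intro deg_cong_star) auto
    then show "deg G (Q - {e}) v \<noteq> 1" using step.prems(2)[of v] v \<open>v \<noteq> z\<close> by auto
  qed
  show ?case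
  proof (cases "x = y")
    case True
    then have "P = {}" using gpath_trivial step.hyps by metis
    then show ?thesis using step.prems by auto
  next
    case False
    then have yP: "y \<in> vset G P" using gpath_neq step.hyps by metis
    then have ny: "deg G Q y \<noteq> 1" using step.prems(2)[of y] False yz by auto
    have d: "deg G P y = 1" using gpath_deg[OF step.hyps(1), of y] False yP by auto
    have de: "deg G {e} y = 1" using deg_insert[of "{}" e G y] step.hyps yz by auto
    from IH show ?thesis
    proof
      assume "Q - {e} = {}"
      then have "Q = {} \<or> Q = {e}" by auto
      then show ?thesis using ny de by auto
    next
      assume "Q - {e} = P"
      then have "Q = P \<or> Q = insert e P" by auto
      then show ?thesis using ny d by auto
    qed
  qed
qed

text \<open>\<open>D\<close> takes each of the three paths entirely or not at all, and its degree at
  the branch vertex \<open>x\<close> is the number of paths taken, so exactly two are taken.\<close>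

lemma theta_cycles:
  assumes P: "gpath G x y P1" "gpath G x y P2" "gpath G x y P3" "x \<noteq> y"
    "P1 \<inter> P2 = {}" "P1 \<inter> P3 = {}" "P2 \<inter> P3 = {}"
    "vset G P1 \<inter> vset G P2 = {x, y}" "vset G P1 \<inter> vset G P3 = {x, y}"
    "vset G P2 \<inter> vset G P3 = {x, y}"
    and D: "cycle G D" "D \<subseteq> P1 \<union> P2 \<union> P3"
  shows "D \<in> {P1 \<union> P2, P1 \<union> P3, P2 \<union> P3}"
proof -
  \<comment> \<open>Away from the branch vertices no other path contributes an edge, so the part of
    \<open>D\<close> in \<open>A\<close> inherits degree 0 or 2 from \<open>D\<close>.\<close>
  have aon: "D \<inter> A = {} \<or> D \<inter> A = A"
    if A: "gpath G x y A" and T: "D \<subseteq> A \<union> B" and AB: "vset G A \<inter> vset G B \<subseteq> {x, y}" for A B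
  proof (rule gpath_all_or_nothing[OF A])
    fix v assume v: "v \<in> vset G A - {x, y}"
    then have "v \<notin> vset G B" using AB by blast
    then have "deg G (D \<inter> A) v = deg G D v"
      using T by (intro deg_cong_star) (auto simp: vset_def)
    moreover have "deg G D v \<noteq> 1"
      using D(1) deg_notin[of v G D] by (cases "v \<in> vset G D") (auto simp: cycle_def)
    ultimately show "deg G (D \<inter> A) v \<noteq> 1" by simp
  qed auto
  have 1: "D \<inter> P1 = {} \<or> D \<inter> P1 = P1"
    by (rule aon[OF P(1), of "P2 \<union> P3"]) (use D(2) assms(8-10) in \<open>simp_all add: Un_ac Int_Un_distrib\<close>)
  have 21: "D \<inter> P2 = {} \<or> D \<inter> P2 = P2"
    by (rule aon[OF P(2), of "P1 \<union> P3"])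
      (use D(2) assms(8-10) in \<open>simp_all add: Un_ac Int_Un_distrib Int_commute\<close>)
  have 3: "D \<inter> P3 = {} \<or> D \<inter> P3 = P3"
    by (rule aon[OF P(3), of "P1 \<union> P2"])
      (use D(2) assms(8-10) in \<open>simp_all add: Un_ac Int_Un_distrib Int_commute\<close>)
  note fin = gpath_finite[OF P(1)] gpath_finite[OF P(2)] gpath_finite[OF P(3)]
  have d: "deg G P1 x = 1" "deg G P2 x = 1" "deg G P3 x = 1"
    using gpath_deg[OF P(1), of x] gpath_deg[OF P(2), of x] gpath_deg[OF P(3), of x] P(4) by auto
  note xP = gpath_neq(2)[OF P(1) P(4)] gpath_neq(2)[OF P(2) P(4)] gpath_neq(2)[OF P(3) P(4)]
  have ne: "D \<noteq> {}" using D by (auto simp: cycle_def)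
  have 2: "deg G D x = 2" if "P1 \<subseteq> D \<or> P2 \<subseteq> D \<or> P3 \<subseteq> D"
  proof -
    have "x \<in> vset G D" using that xP vset_mono[of _ D G] by blast
    then show ?thesis using D by (auto simp: cycle_def)
  qed
  have U: "D = (D \<inter> P1) \<union> (D \<inter> P2) \<union> (D \<inter> P3)" using D(2) by blast
  obtain Q1 Q2 Q3 where Q: "D = Q1 \<union> Q2 \<union> Q3" "Q1 = {} \<or> Q1 = P1" "Q2 = {} \<or> Q2 = P2"
    "Q3 = {} \<or> Q3 = P3"
    by (rule that[OF U 1 21 3])
  have "D = {} \<or> D = P1 \<or> D = P2 \<or> D = P3 \<or> D = P1 \<union> P2 \<or> D = P1 \<union> P3
    \<or> D = P2 \<union> P3 \<or> D = P1 \<union> P2 \<union> P3"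
    unfolding Q(1) using Q(2-4) by (elim disjE) simp_all
  then consider "D = {}" | "D = P1" | "D = P2" | "D = P3" | "D = P1 \<union> P2" | "D = P1 \<union> P3"
    | "D = P2 \<union> P3" | "D = P1 \<union> P2 \<union> P3"
    by argo
  then show ?thesis
  proof cases
    case 8
    have "deg G D x = 3"
      using fin P(5-7) d unfolding 8 by (simp add: deg_Un_disjoint Int_Un_distrib2)
    then show ?thesis using 2 8 by simp
  qed (use ne d 2 in simp_all)
qed

section \<open>Ears and decompositions of cycles\<close>

text \<open>A cycle inside would have to be the whole path, but a nontrivial path has degree one at
  its ends.\<close>

lemma gpath_no_cycle:
  assumes "gpath G x y P" "D \<subseteq> P"
  shows "\<not> cycle G D"
proof
  assume "cycle G D"
  then have ne: "D \<noteq> {}" and c: "\<forall>v\<in>vset G D. deg G D v = 2" by (simp_all add: cycle_def)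
  have deg2: "deg G D v \<noteq> 1" for v
    using c deg_notin[of v G D] by (cases "v \<in> vset G D") simp_all
  have "D = {} \<or> D = P" using assms deg2 by (rule gpath_all_or_nothing)
  then have DP: "D = P" using ne by simp
  then have "x \<noteq> y" using ne gpath_trivial[of G x P] assms(1) by blast
  then show False using gpath_deg[OF assms(1), of x] deg2[of x] DP by simp
qed

context
  fixes G :: "('v, 'e, 'z) mgraph_scheme"
  assumes G: "graph G"
begin

lemma graph_finite: "X \<subseteq> edges G \<Longrightarrow> finite X"
  using finite_subset[of X "edges G"] G by (simp add: graph_def)

lemma graph_finite_vset: "X \<subseteq> edges G \<Longrightarrow> finite (vset G X)"
proof -
  assume X: "X \<subseteq> edges G"
  have "ends G e \<subseteq> verts G" if "e \<in> edges G" for e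
    using G that by (simp add: graph_def)
  with X have "vset G X \<subseteq> verts G" unfolding vset_def by blast
  then show ?thesis using finite_subset[of _ "verts G"] G by (simp add: graph_def)
qed

lemma graph_ends_nonempty: "e \<in> edges G \<Longrightarrow> ends G e \<noteq> {}"
proof
  assume "e \<in> edges G" "ends G e = {}"
  moreover from G have "\<forall>e\<in>edges G. card (ends G e) = 1 \<or> card (ends G e) = 2"
    by (simp add: graph_def)
  ultimately show False by (auto dest: bspec[of _ _ e])
qed

lemma graph_ends_at:
  assumes "e \<in> edges G" "y \<in> ends G e"
  obtains z where "ends G e = {y, z}"
proof -
  have "card (ends G e) = 1 \<or> card (ends G e) = 2" using G assms(1) by (simp add: graph_def)
  then show ?thesis
  proof
    assume "card (ends G e) = 1"
    then show ?thesis using assms that[of y] by (auto simp: card_1_singleton_iff)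
  next
    assume "card (ends G e) = 2"
    then obtain a b where "ends G e = {a, b}" by (auto simp: card_2_iff)
    then show ?thesis using assms that[of a] that[of b] by auto
  qed
qed

text \<open>The cycle has degree exactly two, so \<open>D\<close> already owns every edge of
  \<open>C\<close> at its vertices, and connectedness of \<open>C\<close> leaves nothing
  over.\<close>

lemma deg_2_subset_cycle:
  assumes "cycle G C" "D \<subseteq> C" "D \<noteq> {}" "\<And>v. v \<in> vset G D \<Longrightarrow> 2 \<le> deg G D v"
  shows "D = C"
proof (rule conn_closed_subset)
  show "conn G C" using assms(1) by (simp add: cycle_def)
  have CE: "C \<subseteq> edges G" using assms(1) by (simp add: cycle_def)
  show "ends G e \<noteq> {}" if "e \<in> C" for e using graph_ends_nonempty CE that by blast
  fix v assume v: "v \<in> vset G D"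
  then have "v \<in> vset G C" using vset_mono[OF assms(2), of G] by blast
  then have "deg G C v = 2" using assms(1) by (simp add: cycle_def)
  then show "{e \<in> C. v \<in> ends G e} \<subseteq> D"
    using assms(4)[OF v] by (intro star_subset_of_deg_le[OF graph_finite[OF CE] assms(2)]) simp
qed (fact assms)+

lemma cycle_subset_cycle: "cycle G C \<Longrightarrow> cycle G D \<Longrightarrow> D \<subseteq> C \<Longrightarrow> D = C"
  by (rule deg_2_subset_cycle) (simp_all add: cycle_def)

lemma cycle_finite: "cycle G C \<Longrightarrow> finite C"
  by (simp add: cycle_def graph_finite)

lemma loop_cycle:
  assumes "e \<in> edges G" "ends G e = {a}"
  shows "cycle G {e}"
  unfolding cycle_def
proof (intro conjI ballI)
  show "conn G {e}" using assms by (intro connI_from[of _ _ a]) auto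
  show "deg G {e} v = 2" if "v \<in> vset G {e}" for v
    using that assms deg_insert[of "{}" e G v] by auto
qed (use assms in auto)

lemma cycle_with_loop: "cycle G C \<Longrightarrow> e \<in> C \<Longrightarrow> ends G e = {a} \<Longrightarrow> C = {e}"
  using cycle_subset_cycle[of C "{e}"] loop_cycle[of e a] by (auto simp: cycle_def)

text \<open>A longest path in \<open>S\<close> from \<open>a\<close> that avoids \<open>A\<close> otherwise is stuck: every further edge \<open>h\<close> at its
  end leads back to \<open>A\<close> or to the path.\<close>

lemma stuck_gpath:
  assumes S: "S \<subseteq> edges G" and a: "a \<in> A" "a \<in> vset G S"
    and d: "\<And>v. v \<in> vset G S - A \<Longrightarrow> 2 \<le> deg G S v"
  obtains y P h z where "gpath G a y P" "P \<subseteq> S" "insert a (vset G P) \<inter> A = {a}"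
    "h \<in> S - P" "ends G h = {y, z}" "z \<in> A \<union> vset G P"
proof -
  define Q where "Q n \<longleftrightarrow> (\<exists>y P. gpath G a y P \<and> P \<subseteq> S \<and> insert a (vset G P) \<inter> A = {a} \<and> card P = n)" for n
  have Q0: "Q 0" unfolding Q_def using a gpath.refl[of G a] by (intro exI[of _ a] exI[of _ "{}"]) auto
  have "n \<le> card S" if "Q n" for n
    using that card_mono[OF graph_finite[OF S]] unfolding Q_def by blast
  then have "Collect Q \<subseteq> {..card S}" by blast
  then have fin: "finite (Collect Q)" by (rule finite_subset) simp
  define n where "n = Max (Collect Q)"
  have n: "Q n" "\<And>m. Q m \<Longrightarrow> m \<le> n"
    using Max_in[OF fin] Max_ge[OF fin] Q0 unfolding n_def by auto
  then obtain y P where P: "gpath G a y P" "P \<subseteq> S" "insert a (vset G P) \<inter> A = {a}" "card P = n"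
    unfolding Q_def by blast
  \<comment> \<open>At the end \<open>y\<close> of a nontrivial path, \<open>P\<close> has degree
    one while \<open>S\<close> has degree at least two. For the trivial path, \<open>a\<close> lies
    on an edge of \<open>S\<close> by assumption.\<close>
  have "\<exists>h\<in>S - P. y \<in> ends G h"
  proof (cases "y = a")
    case True
    then have "P = {}" using P(1) gpath_trivial by metis
    then show ?thesis using a True by (auto simp: vset_def)
  next
    case False
    then have y: "y \<in> vset G P" using gpath_neq[OF P(1)] by simp
    then have "y \<in> vset G S - A" using P(2,3) False vset_mono[OF P(2), of G] by auto
    then have "2 \<le> deg G S y" by (rule d)
    moreover have "deg G P y = 1" using gpath_deg[OF P(1), of y] y False by simp
    ultimately have "deg G P y \<noteq> deg G S y" by simp
    show ?thesis
    proof (rule ccontr)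
      assume "\<not> ?thesis"
      then have "{e \<in> P. y \<in> ends G e} = {e \<in> S. y \<in> ends G e}" using P(2) by auto
      then have "deg G P y = deg G S y" by (rule deg_cong_star)
      then show False using \<open>deg G P y \<noteq> deg G S y\<close> by simp
    qed
  qed
  then obtain h where h: "h \<in> S - P" "y \<in> ends G h" by blast
  then obtain z where z: "ends G h = {y, z}" using graph_ends_at S by blast
  have "z \<in> A \<union> vset G P"
  proof (rule ccontr)
    assume "\<not> ?thesis"
    then have zn: "z \<notin> insert a (vset G P)" "z \<notin> A" using a by auto
    have g: "gpath G a z (insert h P)" using h S by (intro gpath.step[OF P(1) _ z zn(1)]) auto
    have "insert a (vset G (insert h P)) \<inter> A = {a}"
      using z zn P(3) gpath_end[OF P(1)] by auto
    moreover have "card (insert h P) = Suc n" using h P gpath_finite[OF P(1)] by simp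
    ultimately have "Q (Suc n)" unfolding Q_def
      using g h P(2) by (intro exI[of _ z] exI[of _ "insert h P"]) auto
    then show False using n(2) by fastforce
  qed
  then show ?thesis using that[OF P(1-3) h(1) z] by simp
qed

lemma close_cycle:
  assumes P: "gpath G z y P" and h: "h \<in> edges G" "h \<notin> P" "ends G h = {y, z}"
  shows "cycle G (insert h P)"
proof (cases "y = z")
  case True
  then have "P = {}" using P gpath_trivial by metis
  then show ?thesis using loop_cycle[of h y] h True by simp
next
  case False
  have "gpath G z y {h}" using False h by (intro gpath_edge) auto
  from cycle_of_gpaths[OF P this] show ?thesis
    using False h gpath_neq(2,3)[OF P] by auto
qed

text \<open>The edge on which a longest path gets stuck returns either to another vertex of
  \<open>A\<close>, giving an ear, or to a vertex \<open>z\<close> of the path, splitting it into a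
  handle \<open>P\<close> and the cycle \<open>D\<close>. For \<open>z = a\<close> the handle is
  empty and the cycle hangs directly at \<open>a\<close>. The sets \<open>A\<close> used later are a
  single vertex, the two ends of an edge, and the vertices of a cycle.\<close>

lemma ear_or_lollipop:
  assumes S: "S \<subseteq> edges G" and a: "a \<in> A" "a \<in> vset G S"
    and d: "\<And>v. v \<in> vset G S - A \<Longrightarrow> 2 \<le> deg G S v"
  shows "(\<exists>z Q. z \<in> A \<and> z \<noteq> a \<and> gpath G a z Q \<and> Q \<subseteq> S \<and> vset G Q \<inter> A = {a, z}) \<or>
    (\<exists>z P D. gpath G a z P \<and> cycle G D \<and> P \<subseteq> S \<and> D \<subseteq> S \<and> P \<inter> D = {} \<and>
      insert a (vset G P) \<inter> A = {a} \<and> vset G D \<inter> A \<subseteq> {a} \<and>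
      vset G D \<inter> insert a (vset G P) = {z})"
proof -
  obtain y P h z where P: "gpath G a y P" "P \<subseteq> S" "insert a (vset G P) \<inter> A = {a}"
    and h: "h \<in> S - P" "ends G h = {y, z}" "z \<in> A \<union> vset G P"
    by (rule stuck_gpath[OF S a d])
  have hE: "h \<in> edges G" using h S by blast
  show ?thesis
  proof (cases "z \<in> insert a (vset G P)")
    case False
    have "gpath G a z (insert h P)" by (rule gpath.step[OF P(1) hE h(2) False])
    moreover have "vset G (insert h P) \<inter> A = {a, z}"
      using False h P(3) gpath_end[OF P(1)] gpath_insert_end[OF P(1)] by auto
    ultimately show ?thesis using False h P
      by (intro disjI1 exI[of _ z] exI[of _ "insert h P"]) auto
  next
    case True
    obtain P1 P2 where s: "P = P1 \<union> P2" "P1 \<inter> P2 = {}" "gpath G a z P1" "gpath G z y P2"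
      "insert a (vset G P1) \<inter> insert z (vset G P2) = {z}"
      by (rule gpath_split[OF P(1) True])
    have c: "cycle G (insert h P2)" using close_cycle[OF s(4) hE _ h(2)] h(1) s(1) by auto
    have v: "vset G (insert h P2) = insert z (vset G P2)"
      using h(2) gpath_end[OF s(4)] by auto
    have "vset G (insert h P2) \<inter> insert a (vset G P1) = {z}" unfolding v using s(5) by (simp add: Int_commute)
    moreover have "vset G (insert h P2) \<inter> A \<subseteq> {a}"
      unfolding v using True P(3) unfolding s(1) by auto
    moreover have "insert a (vset G P1) \<inter> A = {a}" using P(3) a unfolding s(1) by auto
    moreover have "P1 \<subseteq> S" "insert h P2 \<subseteq> S" using P(2) h(1) s(1) by auto
    moreover have "P1 \<inter> insert h P2 = {}" using s(1,2) h(1) by auto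
    ultimately show ?thesis using s(3) c
      by (intro disjI2 exI[of _ z] exI[of _ P1] exI[of _ "insert h P2"]) simp
  qed
qed

text \<open>With \<open>A = {a}\<close> there is no second vertex for an ear to reach, so the
  lollipop alternative supplies the cycle.\<close>

lemma min_degree_2_cycle:
  assumes X: "X \<subseteq> edges G" "X \<noteq> {}" "\<And>v. v \<in> vset G X \<Longrightarrow> 2 \<le> deg G X v"
  obtains D where "cycle G D" "D \<subseteq> X"
proof -
  obtain e where e: "e \<in> X" "e \<in> edges G" using X by blast
  then obtain a where a: "a \<in> vset G X"
    using graph_ends_nonempty[of e] by (auto simp: vset_def)
  have "\<exists>D. cycle G D \<and> D \<subseteq> X"
  proof (rule disjE[OF ear_or_lollipop[OF X(1) insertI1 a, of "{}"]])
    show "2 \<le> deg G X v" if "v \<in> vset G X - {a}" for v using that X(3) by blast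
  qed (elim exE conjE, blast)+
  then show ?thesis using that by blast
qed

text \<open>With \<open>A = {a, b}\<close>, a lollipop would contain a proper subcycle of
  \<open>C\<close>, so there is an ear from \<open>a\<close> to \<open>b\<close>; together with
  \<open>e\<close> it closes to a cycle and hence uses up all of \<open>C\<close>.\<close>

lemma cycle_minus_edge:
  assumes C: "cycle G C" and e: "e \<in> C" "ends G e = {a, b}" "a \<noteq> b"
  shows "gpath G a b (C - {e})"
proof -
  have CE: "C \<subseteq> edges G" using C by (simp add: cycle_def)
  then have eE: "e \<in> edges G" using e by blast
  let ?S = "C - {e}"
  have SE: "?S \<subseteq> edges G" using CE by blast
  have degs: "deg G C v = deg G ?S v + (if v \<in> {a, b} then 1 else 0)" for v
    using deg_insert[of ?S e G v] graph_finite[OF SE] e by (auto simp: insert_absorb)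
  have d2: "deg G C v = 2" if "v \<in> vset G C" for v using C that by (simp add: cycle_def)
  have ab: "a \<in> vset G C" "b \<in> vset G C" using e unfolding vset_def by blast+
  have aS: "a \<in> vset G ?S"
  proof (rule ccontr)
    assume "a \<notin> vset G ?S"
    then show False using degs[of a] d2[OF ab(1)] deg_notin[of a G ?S] by simp
  qed
  have dS: "2 \<le> deg G ?S v" if "v \<in> vset G ?S - {a, b}" for v
  proof -
    have "v \<in> vset G C" using that vset_mono[of ?S C G] by blast
    then show ?thesis using degs[of v] d2[of v] that by simp
  qed
  have "(\<exists>z Q. z \<in> {a, b} \<and> z \<noteq> a \<and> gpath G a z Q \<and> Q \<subseteq> ?S) \<or> (\<exists>D. cycle G D \<and> D \<subseteq> ?S)"
    by (rule disjE[OF ear_or_lollipop[OF SE insertI1 aS, of "{b}"]], erule dS) (elim exE conjE, blast)+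
  then consider z Q where "z \<in> {a, b}" "z \<noteq> a" "gpath G a z Q" "Q \<subseteq> ?S"
    | D where "cycle G D" "D \<subseteq> ?S"
    by blast
  then show ?thesis
  proof cases
    case 1
    then have Q: "gpath G a b Q" by auto
    have "ends G e = {b, a}" using e by auto
    then have "cycle G (insert e Q)" using 1(4) by (intro close_cycle[OF Q eE]) auto
    then have "insert e Q = C" using cycle_subset_cycle[OF C] 1(4) e(1) by auto
    moreover have "e \<notin> Q" using 1(4) by auto
    ultimately have "Q = C - {e}" by auto
    then show ?thesis using Q by simp
  next
    case 2
    then have "D = C" using cycle_subset_cycle[OF C] by blast
    then show ?thesis using 2 e by blast
  qed
qed

lemma cycle_has_link:
  assumes C: "cycle G C" and a: "a \<in> vset G C" and z: "z \<in> vset G C" "a \<noteq> z"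
  obtains e b where "e \<in> C" "ends G e = {a, b}" "a \<noteq> b"
proof -
  have CE: "C \<subseteq> edges G" using C by (simp add: cycle_def)
  obtain e where e: "e \<in> C" "a \<in> ends G e" using a by (auto simp: vset_def)
  obtain b where b: "ends G e = {a, b}" by (rule graph_ends_at[of e a]) (use e CE in auto)
  have "a \<noteq> b"
  proof
    assume "a = b"
    then have "C = {e}" using cycle_with_loop[OF C e(1)] b by auto
    then show False using z b \<open>a = b\<close> by auto
  qed
  then show ?thesis using that e b by blast
qed

text \<open>Deleting a link at \<open>a\<close> leaves a path back to \<open>a\<close>; splitting
  that path at \<open>z\<close> and returning the link to the first piece gives both arcs.\<close>

lemma cycle_split:
  assumes C: "cycle G C" and a: "a \<in> vset G C" "z \<in> vset G C" "a \<noteq> z"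
  obtains P1 P2 where "C = P1 \<union> P2" "P1 \<inter> P2 = {}" "gpath G a z P1" "gpath G a z P2"
    "vset G P1 \<inter> vset G P2 = {a, z}"
proof -
  obtain e b where e: "e \<in> C" "ends G e = {a, b}" "a \<noteq> b" by (rule cycle_has_link[OF C a])
  have eE: "e \<in> edges G" using e C by (auto simp: cycle_def)
  have "ends G e = {b, a}" using e by auto
  then have P: "gpath G b a (C - {e})" using cycle_minus_edge[OF C e(1)] e(3) by auto
  have Ce: "C = insert e (C - {e})" using e by auto
  have "vset G C = {a, b} \<union> vset G (C - {e})" by (subst Ce) (simp only: vset_simps e(2))
  then have "z \<in> insert b (vset G (C - {e}))" using a gpath_insert_end[OF P] by auto
  then obtain Q1 Q2 where s: "C - {e} = Q1 \<union> Q2" "Q1 \<inter> Q2 = {}" "gpath G b z Q1" "gpath G z a Q2"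
      "insert b (vset G Q1) \<inter> insert z (vset G Q2) = {z}"
    by (rule gpath_split[OF P])
  have aQ: "a \<in> vset G Q2" "z \<in> vset G Q2" using gpath_neq(2,3)[OF s(4)] a by auto
  have zQ: "z \<in> insert b (vset G Q1)" by (rule gpath_end[OF s(3)])
  have ea: "gpath G a b {e}" using gpath_edge[OF eE e(2,3)] .
  have aQ1: "a \<notin> insert b (vset G Q1)" using s(5) aQ a(3) by auto
  have "gpath G a z ({e} \<union> Q1)"
    by (rule gpath_join[OF s(3) ea]) (use e aQ1 in auto)
  moreover have "gpath G a z Q2" by (rule gpath_rev[OF s(4)])
  moreover have "vset G ({e} \<union> Q1) = insert a (insert b (vset G Q1))" using e by auto
  then have "vset G ({e} \<union> Q1) \<inter> vset G Q2 = {a, z}" using s(5) aQ zQ by auto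
  moreover have "C = ({e} \<union> Q1) \<union> Q2" "({e} \<union> Q1) \<inter> Q2 = {}" using s(1,2) e by auto
  ultimately show ?thesis using that[of "{e} \<union> Q1" Q2] by simp
qed

text \<open>Deleting a link leaves a path, which has one vertex more than edges; a cycle without
  links is a single loop.\<close>

lemma cycle_card:
  assumes C: "cycle G C"
  shows "card C = card (vset G C)"
proof -
  have CE: "C \<subseteq> edges G" "C \<noteq> {}" using C by (auto simp: cycle_def)
  then obtain e where e: "e \<in> C" by blast
  then obtain a where "a \<in> ends G e" using graph_ends_nonempty CE by blast
  then obtain b where b: "ends G e = {a, b}" using graph_ends_at[of e a] e CE by blast
  show ?thesis
  proof (cases "a = b")
    case True
    then have "C = {e}" using cycle_with_loop[OF C e] b by auto
    then show ?thesis using True b by simp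
  next
    case False
    have P: "gpath G a b (C - {e})" by (rule cycle_minus_edge[OF C e b False])
    have Ce: "C = insert e (C - {e})" using e by auto
    have "vset G C = {a, b} \<union> vset G (C - {e})" by (subst Ce) (simp only: vset_simps b)
    then have "vset G C = insert a (vset G (C - {e}))" using gpath_end[OF P] by auto
    then have "card (vset G C) = card (C - {e}) + 1" using gpath_card[OF P] by simp
    then show ?thesis using card_Suc_Diff1[OF cycle_finite[OF C] e] by simp
  qed
qed

lemma gpath_of_adj:
  assumes "(v, w) \<in> (adj G X)\<^sup>*" "X \<subseteq> edges G"
  obtains P where "P \<subseteq> X" "gpath G v w P"
proof -
  from assms(1) have "\<exists>P. P \<subseteq> X \<and> gpath G v w P"
  proof induction
    case base
    show ?case using gpath.refl[of G v] by (intro exI[of _ "{}"]) simp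
  next
    case (step y z)
    then obtain P where P: "P \<subseteq> X" "gpath G v y P" by blast
    obtain e where e: "e \<in> X" "ends G e = {y, z}" using step by (auto simp: adj_def)
    show ?case
    \<comment> \<open>When the walk returns to a vertex of the path, the path is cut back to that
      vertex.\<close>
    proof (cases "z \<in> insert v (vset G P)")
      case True
      obtain P1 P2 where "P = P1 \<union> P2" "gpath G v z P1" by (rule gpath_split[OF P(2) True])
      then show ?thesis using P by (intro exI[of _ P1]) auto
    next
      case False
      then have "gpath G v z (insert e P)" using gpath.step[OF P(2) _ e(2) False] e assms(2) by blast
      then show ?thesis using P e by (intro exI[of _ "insert e P"]) auto
    qed
  qed
  then show ?thesis using that by blast
qed

end

text \<open>The induction keeps track of the stretch since the most recent visit to
  \<open>A\<close>: a new vertex in \<open>A\<close> restarts it as the trivial path, any other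
  vertex extends it.\<close>

lemma gpath_last_hit:
  assumes "gpath G v s Q" "v \<in> A"
  obtains a Q' where "a \<in> A" "Q' \<subseteq> Q" "gpath G a s Q'" "insert a (vset G Q') \<inter> A = {a}"
    "a \<in> insert v (vset G Q)"
proof -
  from assms have "\<exists>a Q'. a \<in> A \<and> Q' \<subseteq> Q \<and> gpath G a s Q' \<and> insert a (vset G Q') \<inter> A = {a} \<and>
    a \<in> insert v (vset G Q)"
  proof (induction rule: gpath.induct)
    case refl
    show ?case using gpath.refl[of G v] refl by (intro exI[of _ v] exI[of _ "{}"]) simp
  next
    case (step y P e z)
    show ?case
    proof (cases "z \<in> A")
      case True
      then show ?thesis using gpath.refl[of G z] step.hyps(3)
        by (intro exI[of _ z] exI[of _ "{}"]) simp
    next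
      case False
      obtain a Q' where Q': "a \<in> A" "Q' \<subseteq> P" "gpath G a y Q'" "insert a (vset G Q') \<inter> A = {a}"
        "a \<in> insert v (vset G P)"
        using step.IH[OF step.prems] by blast
      have "vset G Q' \<subseteq> vset G P" by (rule vset_mono[OF Q'(2)])
      then have "z \<notin> insert a (vset G Q')" using step.hyps(4) Q'(5) by auto
      from gpath.step[OF Q'(3) step.hyps(2,3) this] have "gpath G a z (insert e Q')" .
      moreover have "insert a (vset G (insert e Q')) \<inter> A = {a}"
        using Q'(4) gpath_end[OF Q'(3)] False step.hyps(3) by auto
      ultimately show ?thesis using Q' by (intro exI[of _ a] exI[of _ "insert e Q'"]) auto
    qed
  qed
  then show ?thesis using that by blast
qed

section \<open>Rank of the frame matroid\<close>

lemma ground_frame_matroid [simp]: "ground (frame_matroid \<Omega>) = edges \<Omega>"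
  by (simp add: frame_matroid_def)

lemma circuits_frame_matroid:
  "X \<in> circuits (frame_matroid \<Omega>) \<longleftrightarrow> X \<in> balanced \<Omega> \<or> tight_handcuff \<Omega> X \<or>
     loose_handcuff \<Omega> X \<or> unbalanced_theta \<Omega> X"
  by (auto simp: frame_matroid_def)

lemma is_path_ends:
  assumes "is_path G x y P"
  shows "x \<in> vset G P" "y \<in> vset G P"
  using assms deg_notin[of x G P] deg_notin[of y G P] by (auto simp: is_path_def)

lemma is_path_deg_ge:
  assumes "is_path G x y P" "v \<in> vset G P"
  shows "deg G P v = (if v \<in> {x, y} then 1 else 2)"
  using assms by (auto simp: is_path_def)

context
  fixes \<Omega> :: "('v, 'e) bgraph"
  assumes B: "biased_graph \<Omega>"
begin

lemma biased_graph_graph: "graph \<Omega>"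
  using B by (simp add: biased_graph_def)

lemma balanced_cycle: "C \<in> balanced \<Omega> \<Longrightarrow> cycle \<Omega> C"
  using B by (simp add: biased_graph_def)

lemma cycle_vset_ne: "cycle \<Omega> C \<Longrightarrow> vset \<Omega> C \<noteq> {}"
proof -
  assume "cycle \<Omega> C"
  then obtain e where "e \<in> C" "e \<in> edges \<Omega>" unfolding cycle_def by blast
  then show ?thesis using graph_ends_nonempty[OF biased_graph_graph, of e] by (auto simp: vset_def)
qed

lemma deg_two_paths_ge:
  assumes "is_path \<Omega> x y P1" "is_path \<Omega> x y P2" "P1 \<inter> P2 = {}" "v \<in> vset \<Omega> (P1 \<union> P2)"
  shows "2 \<le> deg \<Omega> (P1 \<union> P2) v"
proof -
  have fin: "finite P1" "finite P2"
    using assms graph_finite[OF biased_graph_graph] by (auto simp: is_path_def)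
  note e = is_path_ends[OF assms(1)] is_path_ends[OF assms(2)]
  show ?thesis
  proof (cases "v \<in> {x, y}")
    case True
    then have "deg \<Omega> P1 v = 1" "deg \<Omega> P2 v = 1" using assms by (auto simp: is_path_def)
    then show ?thesis using deg_Un_disjoint[OF fin assms(3), of \<Omega> v] by simp
  next
    case False
    from assms(4) have "v \<in> vset \<Omega> P1 \<or> v \<in> vset \<Omega> P2" by simp
    then have "deg \<Omega> P1 v = 2 \<or> deg \<Omega> P2 v = 2"
      using is_path_deg_ge[OF assms(1), of v] is_path_deg_ge[OF assms(2), of v] False by auto
    then show ?thesis using deg_Un_disjoint[OF fin assms(3), of \<Omega> v] by auto
  qed
qed

text \<open>These properties are common to all four kinds of circuits. Minimum degree two excludes
  pendant edges, and connectedness keeps a circuit within one component; both are used repeatedly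
  below.\<close>

lemma circuit_properties:
  assumes "X \<in> circuits (frame_matroid \<Omega>)"
  shows "X \<subseteq> edges \<Omega> \<and> X \<noteq> {} \<and> conn \<Omega> X \<and> (\<forall>v\<in>vset \<Omega> X. 2 \<le> deg \<Omega> X v)"
proof -
  have cyc: "2 \<le> deg \<Omega> Y v" if "cycle \<Omega> C" "C \<subseteq> Y" "Y \<subseteq> edges \<Omega>" "v \<in> vset \<Omega> C" for C Y v
  proof -
    have "deg \<Omega> C v = 2" using that by (simp add: cycle_def)
    then show ?thesis
      using deg_mono[OF graph_finite[OF biased_graph_graph that(3)] that(2), of \<Omega> v] by simp
  qed
  consider "X \<in> balanced \<Omega>" | "tight_handcuff \<Omega> X" | "loose_handcuff \<Omega> X" | "unbalanced_theta \<Omega> X"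
    using assms unfolding circuits_frame_matroid by argo
  then show ?thesis
  proof cases
    case 1
    then have "cycle \<Omega> X" by (rule balanced_cycle)
    then show ?thesis by (simp add: cycle_def)
  next
    case 2
    then obtain C1 C2 v where X: "X = C1 \<union> C2" "cycle \<Omega> C1" "cycle \<Omega> C2"
      "vset \<Omega> C1 \<inter> vset \<Omega> C2 = {v}"
      unfolding tight_handcuff_def unbalanced_cycle_def by (elim exE conjE) (rule that; assumption)
    have E: "X \<subseteq> edges \<Omega>" "X \<noteq> {}" using X by (auto simp: cycle_def)
    have v: "v \<in> vset \<Omega> C1" "v \<in> vset \<Omega> C2" using X(4) by blast+
    have "conn \<Omega> X" unfolding X(1) using conn_Un[OF _ _ v] X by (simp add: cycle_def)
    moreover have "2 \<le> deg \<Omega> X w" if "w \<in> vset \<Omega> X" for w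
      using that cyc[OF X(2) _ E(1), of w] cyc[OF X(3) _ E(1), of w] X(1) by auto
    ultimately show ?thesis using E by simp
  next
    case 3
    then obtain C1 C2 P x y where X: "X = C1 \<union> C2 \<union> P" "cycle \<Omega> C1" "cycle \<Omega> C2"
      "is_path \<Omega> x y P" "vset \<Omega> P \<inter> vset \<Omega> C1 = {x}" "vset \<Omega> P \<inter> vset \<Omega> C2 = {y}"
      unfolding loose_handcuff_def unbalanced_cycle_def by (elim exE conjE) (rule that; assumption)
    have PE: "P \<subseteq> edges \<Omega>" "conn \<Omega> P" using X(4) by (simp_all add: is_path_def)
    have E: "X \<subseteq> edges \<Omega>" "X \<noteq> {}" using X PE by (auto simp: cycle_def)
    have x: "x \<in> vset \<Omega> C1" "x \<in> vset \<Omega> P" using X(5) by blast+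
    have y: "y \<in> vset \<Omega> (C1 \<union> P)" "y \<in> vset \<Omega> C2" using X(6) by auto
    have "conn \<Omega> (C1 \<union> P)" using conn_Un[OF _ _ x] X(2) PE by (simp add: cycle_def)
    then have "conn \<Omega> (C1 \<union> P \<union> C2)" using conn_Un[OF _ _ y] X(3) by (simp add: cycle_def)
    then have "conn \<Omega> X" unfolding X(1) by (simp add: Un_ac)
    moreover have "2 \<le> deg \<Omega> X w" if "w \<in> vset \<Omega> X" for w
    proof (cases "w \<in> vset \<Omega> C1 \<union> vset \<Omega> C2")
      case True
      then show ?thesis using cyc[OF X(2) _ E(1), of w] cyc[OF X(3) _ E(1), of w] X(1) by auto
    next
      case False
      then have w: "w \<in> vset \<Omega> P" "w \<notin> {x, y}" using that X(1) x y by auto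
      then have "deg \<Omega> P w = 2" using is_path_deg_ge[OF X(4)] by simp
      then show ?thesis using X(1)
        deg_mono[OF graph_finite[OF biased_graph_graph E(1)], of P \<Omega> w] by auto
    qed
    ultimately show ?thesis using E by simp
  next
    case 4
    then obtain x y P1 P2 P3 where X: "X = P1 \<union> P2 \<union> P3" "is_path \<Omega> x y P1"
      "is_path \<Omega> x y P2" "is_path \<Omega> x y P3" "P1 \<inter> P2 = {}" "P1 \<inter> P3 = {}" "P2 \<inter> P3 = {}"
      unfolding unbalanced_theta_def theta_def by (elim exE conjE) (rule that; assumption)
    have E: "X \<subseteq> edges \<Omega>" using X by (auto simp: is_path_def)
    have conn: "conn \<Omega> P1" "conn \<Omega> P2" "conn \<Omega> P3" using X by (auto simp: is_path_def)
    note x = is_path_ends(1)[OF X(2)] is_path_ends(1)[OF X(3)] is_path_ends(1)[OF X(4)]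
    have "X \<noteq> {}" using x X(1) by (auto simp: vset_def)
    moreover have "conn \<Omega> (P1 \<union> P2)" by (rule conn_Un[OF conn(1,2) x(1,2)])
    then have "conn \<Omega> X" unfolding X(1) by (rule conn_Un[OF _ conn(3) _ x(3)]) (use x in simp)
    moreover have "2 \<le> deg \<Omega> X w" if "w \<in> vset \<Omega> X" for w
    proof -
      have "w \<in> vset \<Omega> (P1 \<union> P2) \<or> w \<in> vset \<Omega> (P1 \<union> P3)" using that X(1) by auto
      then have "2 \<le> deg \<Omega> (P1 \<union> P2) w \<or> 2 \<le> deg \<Omega> (P1 \<union> P3) w"
        using deg_two_paths_ge[OF X(2,3,5)] deg_two_paths_ge[OF X(2,4,6)] by blast
      moreover have "deg \<Omega> (P1 \<union> P2) w \<le> deg \<Omega> X w" "deg \<Omega> (P1 \<union> P3) w \<le> deg \<Omega> X w"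
        unfolding X(1)
        by (intro deg_mono; use graph_finite[OF biased_graph_graph E] X(1) in auto)+
      ultimately show ?thesis by linarith
    qed
    ultimately show ?thesis using E by simp
  qed
qed

lemmas circuit_edges = circuit_properties[THEN conjunct1]
lemmas circuit_nonempty = circuit_properties[THEN conjunct2, THEN conjunct1]
lemmas circuit_conn = circuit_properties[THEN conjunct2, THEN conjunct2, THEN conjunct1]
lemmas circuit_deg = circuit_properties[THEN conjunct2, THEN conjunct2, THEN conjunct2, rule_format]

text \<open>Minimum degree two forces \<open>X\<close> to fill the cycle. A handcuff filling
  \<open>C\<close> would have both its cycles equal to \<open>C\<close>, and in a theta filling
  \<open>C\<close> two paths would already exhaust it, leaving no edge for the third. Only a
  balanced cycle remains.\<close>

lemma circuit_subset_cycle: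
  assumes C: "cycle \<Omega> C" and X: "X \<in> circuits (frame_matroid \<Omega>)" "X \<subseteq> C"
  shows "X = C" "C \<in> balanced \<Omega>"
proof -
  show XC: "X = C"
    using circuit_deg[OF X(1)]
    by (intro deg_2_subset_cycle[OF biased_graph_graph C X(2) circuit_nonempty[OF X(1)]])
  note eq = cycle_subset_cycle[OF biased_graph_graph C]
  consider "X \<in> balanced \<Omega>" | "tight_handcuff \<Omega> X" | "loose_handcuff \<Omega> X" | "unbalanced_theta \<Omega> X"
    using X(1) unfolding circuits_frame_matroid by argo
  then show "C \<in> balanced \<Omega>"
  proof cases
    case 1
    then show ?thesis using XC by simp
  next
    case 2
    then obtain C1 C2 where Y: "X = C1 \<union> C2" "cycle \<Omega> C1" "cycle \<Omega> C2" "C1 \<inter> C2 = {}"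
      unfolding tight_handcuff_def unbalanced_cycle_def by (elim exE conjE) (rule that; assumption)
    then have "C1 = C" "C2 = C" using eq XC by auto
    then show ?thesis using Y(2,4) by (simp add: cycle_def)
  next
    case 3
    then obtain C1 C2 P where Y: "X = C1 \<union> C2 \<union> P" "cycle \<Omega> C1" "cycle \<Omega> C2"
      "vset \<Omega> C1 \<inter> vset \<Omega> C2 = {}"
      unfolding loose_handcuff_def unbalanced_cycle_def by (elim exE conjE) (rule that; assumption)
    then have "C1 = C" "C2 = C" using eq XC by auto
    then show ?thesis using Y(2,4) cycle_vset_ne by simp
  next
    case 4
    then obtain x y P1 P2 P3 where Y: "X = P1 \<union> P2 \<union> P3" "is_path \<Omega> x y P1"
      "is_path \<Omega> x y P2" "is_path \<Omega> x y P3" "P1 \<inter> P2 = {}" "P1 \<inter> P3 = {}" "P2 \<inter> P3 = {}"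
      unfolding unbalanced_theta_def theta_def by (elim exE conjE) (rule that; assumption)
    have ne: "P1 \<noteq> {}" "P3 \<noteq> {}"
      using is_path_ends(1)[OF Y(2)] is_path_ends(1)[OF Y(4)] by auto
    have "P1 \<union> P2 = C"
      using deg_two_paths_ge[OF Y(2,3,5)] ne Y(1) XC
      by (intro deg_2_subset_cycle[OF biased_graph_graph C]) auto
    then show ?thesis using ne Y XC by blast
  qed
qed

lemma balanced_iff_circuit: "C \<in> balanced \<Omega> \<longleftrightarrow> cycle \<Omega> C \<and> C \<in> circuits (frame_matroid \<Omega>)"
  using circuit_subset_cycle(2) balanced_cycle circuits_frame_matroid by blast

text \<open>If \<open>I\<close> contained no circuit, all its cycles would be unbalanced. An ear of
  \<open>D\<close> starting at \<open>a\<close> then completes a theta, and a lollipop completes a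
  tight handcuff if its handle is empty and a loose one otherwise; each of these is a
  circuit.\<close>

lemma circuit_of_touching_cycle:
  assumes I: "I \<subseteq> edges \<Omega>" "\<And>v. v \<in> vset \<Omega> I \<Longrightarrow> 2 \<le> deg \<Omega> I v"
    and D: "cycle \<Omega> D" "D \<subseteq> I" and a: "a \<in> vset \<Omega> D" "a \<in> vset \<Omega> (I - D)"
  shows "\<exists>X\<in>circuits (frame_matroid \<Omega>). X \<subseteq> I"
proof (rule ccontr)
  note gr = biased_graph_graph
  assume no: "\<not> ?thesis"
  then have nX: "X \<notin> circuits (frame_matroid \<Omega>)" if "X \<subseteq> I" for X using that no by blast
  have unb: "unbalanced_cycle \<Omega> C" if "cycle \<Omega> C" "C \<subseteq> I" for C
    using nX[OF that(2)] that(1) by (simp add: unbalanced_cycle_def balanced_iff_circuit)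
  have S: "I - D \<subseteq> edges \<Omega>" using I by blast
  have d: "2 \<le> deg \<Omega> (I - D) v" if "v \<in> vset \<Omega> (I - D) - vset \<Omega> D" for v
  proof -
    have "deg \<Omega> (I - D) v = deg \<Omega> I v"
      using that by (intro deg_cong_star) (auto simp: vset_def)
    moreover have "v \<in> vset \<Omega> I" using that vset_mono[of "I - D" I \<Omega>] by blast
    ultimately show ?thesis using I(2) by simp
  qed
  show False
  proof (rule disjE[OF ear_or_lollipop[OF gr S a]])
    show "2 \<le> deg \<Omega> (I - D) v" if "v \<in> vset \<Omega> (I - D) - vset \<Omega> D" for v by (rule d[OF that])
  next
    assume "\<exists>z Q. z \<in> vset \<Omega> D \<and> z \<noteq> a \<and> gpath \<Omega> a z Q \<and> Q \<subseteq> I - D \<and> vset \<Omega> Q \<inter> vset \<Omega> D = {a, z}"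
    then obtain z Q where Q: "z \<in> vset \<Omega> D" "a \<noteq> z" "gpath \<Omega> a z Q" "Q \<subseteq> I - D"
      "vset \<Omega> Q \<inter> vset \<Omega> D = {a, z}" by blast
    obtain P1 P2 where P: "D = P1 \<union> P2" "P1 \<inter> P2 = {}" "gpath \<Omega> a z P1" "gpath \<Omega> a z P2"
      "vset \<Omega> P1 \<inter> vset \<Omega> P2 = {a, z}"
      by (rule cycle_split[OF gr D(1) a(1) Q(1,2)])
    note az = gpath_neq(2,3)[OF P(3) Q(2)] gpath_neq(2,3)[OF P(4) Q(2)] gpath_neq(2,3)[OF Q(3,2)]
    have v: "vset \<Omega> P1 \<inter> vset \<Omega> Q = {a, z}" "vset \<Omega> P2 \<inter> vset \<Omega> Q = {a, z}"
      using Q(5) az unfolding P(1) by auto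
    have "P1 \<inter> Q = {}" "P2 \<inter> Q = {}" using Q(4) P(1) by auto
    then have "theta \<Omega> (P1 \<union> P2 \<union> Q)"
      by (intro theta_of_gpaths[OF P(3,4) Q(3,2) P(2) _ _ P(5) v])
    moreover have TI: "P1 \<union> P2 \<union> Q \<subseteq> I" using P(1) D(2) Q(4) by blast
    then have "\<forall>C. cycle \<Omega> C \<and> C \<subseteq> P1 \<union> P2 \<union> Q \<longrightarrow> unbalanced_cycle \<Omega> C"
      using unb by (meson subset_trans)
    ultimately have "unbalanced_theta \<Omega> (P1 \<union> P2 \<union> Q)" unfolding unbalanced_theta_def by simp
    then show False using nX[OF TI] circuits_frame_matroid by blast
  next
    assume "\<exists>z P D'. gpath \<Omega> a z P \<and> cycle \<Omega> D' \<and> P \<subseteq> I - D \<and> D' \<subseteq> I - D \<and> P \<inter> D' = {} \<and>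
      insert a (vset \<Omega> P) \<inter> vset \<Omega> D = {a} \<and> vset \<Omega> D' \<inter> vset \<Omega> D \<subseteq> {a} \<and>
      vset \<Omega> D' \<inter> insert a (vset \<Omega> P) = {z}"
    then obtain z P D' where P: "gpath \<Omega> a z P" "cycle \<Omega> D'" "P \<subseteq> I - D" "D' \<subseteq> I - D"
      "insert a (vset \<Omega> P) \<inter> vset \<Omega> D = {a}" "vset \<Omega> D' \<inter> vset \<Omega> D \<subseteq> {a}"
      "vset \<Omega> D' \<inter> insert a (vset \<Omega> P) = {z}" by (elim exE conjE) (rule that; assumption)
    have u: "unbalanced_cycle \<Omega> D" "unbalanced_cycle \<Omega> D'" using unb D P(2,4) by auto
    show False
    proof (cases "z = a")
      case True
      then have "vset \<Omega> D \<inter> vset \<Omega> D' = {a}" using P(6,7) a(1) by auto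
      then have "tight_handcuff \<Omega> (D \<union> D')"
        unfolding tight_handcuff_def using u P(4)
        by (intro exI[of _ D] exI[of _ D'] exI[of _ a]) blast
      moreover have "D \<union> D' \<subseteq> I" using D(2) P(4) by blast
      ultimately show False using nX circuits_frame_matroid by blast
    next
      case False
      then have az: "a \<noteq> z" by simp
      have "vset \<Omega> D \<inter> vset \<Omega> D' = {}" using P(6,7) az by auto
      moreover have "vset \<Omega> P \<inter> vset \<Omega> D = {a}" using P(5) gpath_neq(2)[OF P(1) az] by auto
      moreover have "vset \<Omega> P \<inter> vset \<Omega> D' = {z}"
        using P(7) az gpath_neq(3)[OF P(1) az] by auto
      ultimately have "loose_handcuff \<Omega> (D \<union> D' \<union> P)"
        unfolding loose_handcuff_def using u gpath_is_path[OF P(1) az]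
        by (intro exI[of _ D] exI[of _ D'] exI[of _ P] exI[of _ a] exI[of _ z]) simp
      moreover have "D \<union> D' \<union> P \<subseteq> I" using D(2) P(3,4) by blast
      ultimately show False using nX circuits_frame_matroid by blast
    qed
  qed
qed

text \<open>After stripping vertices of degree at most one, every cycle of \<open>I\<close> is a component of \<open>I\<close>, as an
  ear or lollipop attached to it would complete a theta or a handcuff.\<close>

lemma frame_card_le:
  assumes "I \<subseteq> edges \<Omega>" "\<not> (\<exists>X\<in>circuits (frame_matroid \<Omega>). X \<subseteq> I)"
  shows "card I \<le> card (vset \<Omega> I)"
  using assms
proof (induction "card I" arbitrary: I rule: less_induct)
  case less
  note gr = biased_graph_graph
  have fin: "finite I" "finite (vset \<Omega> I)"
    using graph_finite[OF gr] graph_finite_vset[OF gr] less.prems by auto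
  have IH: "card J \<le> card (vset \<Omega> J)" if "J \<subset> I" for J
    using that less.hyps[OF psubset_card_mono[OF fin(1) that]] less.prems by blast
  consider "I = {}" | v where "v \<in> vset \<Omega> I" "deg \<Omega> I v < 2"
    | "I \<noteq> {}" "\<And>v. v \<in> vset \<Omega> I \<Longrightarrow> 2 \<le> deg \<Omega> I v"
    by (metis not_le)
  then show ?case
  proof cases
    case 1
    then show ?thesis by simp
  next
    case 2
    \<comment> \<open>The only edge at a vertex of degree one is removed and takes that vertex with
      it, so the edges drop by one and the vertices by at least one.\<close>
    then obtain e where e: "e \<in> I" "v \<in> ends \<Omega> e" by (auto simp: vset_def)
    have "deg \<Omega> I v = deg \<Omega> (insert e (I - {e})) v" using e by (simp add: insert_absorb)
    then have "deg \<Omega> (I - {e}) v = 0" using fin e 2(2) by (subst (asm) deg_insert) auto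
    then have "v \<notin> vset \<Omega> (I - {e})" using deg_pos[of "I - {e}" v \<Omega>] fin by auto
    then have sub: "vset \<Omega> (I - {e}) \<subseteq> vset \<Omega> I - {v}" using vset_mono[of "I - {e}" I \<Omega>] by auto
    have "card (I - {e}) \<le> card (vset \<Omega> (I - {e}))" using e by (intro IH) auto
    also have "\<dots> \<le> card (vset \<Omega> I - {v})" using sub fin by (intro card_mono) auto
    finally show ?thesis
      using card_Suc_Diff1[OF fin(1) e(1)] card_Suc_Diff1[OF fin(2) 2(1)] by linarith
  next
    case 3
    obtain D where D: "cycle \<Omega> D" "D \<subseteq> I"
      using min_degree_2_cycle[OF gr less.prems(1) 3] by blast
    have "vset \<Omega> D \<inter> vset \<Omega> (I - D) = {}"
    proof (rule ccontr)
      assume "\<not> ?thesis"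
      then obtain b where b: "b \<in> vset \<Omega> D" "b \<in> vset \<Omega> (I - D)" by blast
      have "\<exists>X\<in>circuits (frame_matroid \<Omega>). X \<subseteq> I"
        using less.prems(1) 3(2) D b by (rule circuit_of_touching_cycle)
      then show False using less.prems(2) by blast
    qed
    moreover have I: "I = D \<union> (I - D)" using D by auto
    have v: "vset \<Omega> I = vset \<Omega> D \<union> vset \<Omega> (I - D)" by (subst I) (rule vset_simps)
    ultimately have "card (vset \<Omega> I) = card (vset \<Omega> D) + card (vset \<Omega> (I - D))"
      using fin(2) unfolding v by (intro card_Un_disjoint) auto
    moreover have "card (I - D) \<le> card (vset \<Omega> (I - D))"
      using D by (intro IH) (auto simp: cycle_def)
    moreover have "card D = card (vset \<Omega> D)" by (rule cycle_card[OF gr D(1)])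
    moreover have "card I = card D + card (I - D)"
      using fin(1) D(2) by (simp add: card_Diff_subset card_mono finite_subset)
    ultimately show ?thesis by linarith
  qed
qed

section \<open>Independent sets and ranks of edge sets\<close>

lemma indep_frame:
  "indep (frame_matroid \<Omega>) I \<longleftrightarrow> I \<subseteq> edges \<Omega> \<and> \<not> (\<exists>X\<in>circuits (frame_matroid \<Omega>). X \<subseteq> I)"
  by (simp add: indep_def)

lemma finite_indep_cards:
  "finite {card I | I. I \<subseteq> X \<and> indep (frame_matroid \<Omega>) I}"
proof -
  have "{card I | I. I \<subseteq> X \<and> indep (frame_matroid \<Omega>) I} \<subseteq> card ` Pow (edges \<Omega>)"
    by (auto simp: indep_frame)
  then show ?thesis
    by (rule finite_subset) (simp add: graph_finite[OF biased_graph_graph subset_refl])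
qed

lemma rank_ge: "I \<subseteq> X \<Longrightarrow> indep (frame_matroid \<Omega>) I \<Longrightarrow> card I \<le> matroid_rank (frame_matroid \<Omega>) X"
  unfolding matroid_rank_def by (intro Max_ge finite_indep_cards) blast

lemma rank_witness:
  obtains I where "I \<subseteq> X" "indep (frame_matroid \<Omega>) I" "card I = matroid_rank (frame_matroid \<Omega>) X"
proof -
  \<comment> \<open>Circuits are nonempty, so the \<open>Max\<close> in the rank is taken over a
    nonempty set and is attained.\<close>
  have "indep (frame_matroid \<Omega>) {}" using circuit_nonempty by (auto simp: indep_frame)
  then have "{card I | I. I \<subseteq> X \<and> indep (frame_matroid \<Omega>) I} \<noteq> {}" by blast
  from Max_in[OF finite_indep_cards this] show ?thesis
    using that unfolding matroid_rank_def by force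
qed

lemma rank_le_vset:
  assumes "X \<subseteq> edges \<Omega>"
  shows "matroid_rank (frame_matroid \<Omega>) X \<le> card (vset \<Omega> X)"
proof -
  obtain I where I: "I \<subseteq> X" "indep (frame_matroid \<Omega>) I" "card I = matroid_rank (frame_matroid \<Omega>) X"
    by (rule rank_witness)
  have "card I \<le> card (vset \<Omega> I)" using I(2) by (intro frame_card_le) (auto simp: indep_frame)
  also have "\<dots> \<le> card (vset \<Omega> X)"
    by (intro card_mono vset_mono I(1) graph_finite_vset[OF biased_graph_graph assms])
  finally show ?thesis using I(3) by simp
qed

lemma rank_le_card:
  assumes "finite X"
  shows "matroid_rank (frame_matroid \<Omega>) X \<le> card X"
  using rank_witness[of X] card_mono[OF assms] by metis

lemma indep_unbalanced_cycle:
  assumes "unbalanced_cycle \<Omega> C"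
  shows "indep (frame_matroid \<Omega>) C"
  using assms circuit_subset_cycle(2)[of C] by (auto simp: indep_frame unbalanced_cycle_def cycle_def)

text \<open>A circuit through \<open>e\<close> would have degree one at \<open>b\<close>, where
  \<open>J\<close> has no edge.\<close>

lemma indep_pendant:
  assumes J: "indep (frame_matroid \<Omega>) J" and e: "e \<in> edges \<Omega>" "ends \<Omega> e = {a, b}"
    and b: "b \<noteq> a" "b \<notin> vset \<Omega> J"
  shows "indep (frame_matroid \<Omega>) (insert e J)"
proof -
  have JE: "J \<subseteq> edges \<Omega>" using J by (simp add: indep_frame)
  have "\<not> X \<subseteq> insert e J" if X: "X \<in> circuits (frame_matroid \<Omega>)" for X
  proof
    assume XJ: "X \<subseteq> insert e J"
    then have eX: "e \<in> X" using X J by (auto simp: indep_frame)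
    then have "b \<in> vset \<Omega> X" using e(2) by (auto simp: vset_def)
    then have "2 \<le> deg \<Omega> X b" by (rule circuit_deg[OF X])
    moreover have "deg \<Omega> X b = deg \<Omega> {e} b"
      using b(2) XJ eX by (intro deg_cong_star) (auto simp: vset_def)
    moreover have "deg \<Omega> {e} b = 1" using deg_insert[of "{}" e \<Omega> b] e b by auto
    ultimately show False by simp
  qed
  then show ?thesis using JE e(1) by (auto simp: indep_frame)
qed

text \<open>The bound \<open>rank_le_vset\<close> is attained by growing \<open>C\<close>, which is
  independent and has as many edges as vertices, by pendant edges of \<open>X\<close>: each adds one
  edge and one vertex and preserves independence. A largest such set reaches every vertex, since
  \<open>X\<close> is connected.\<close>

lemma rank_connected_unbalanced:
  assumes X: "X \<subseteq> edges \<Omega>" "conn \<Omega> X" and C: "unbalanced_cycle \<Omega> C" "C \<subseteq> X"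
  shows "matroid_rank (frame_matroid \<Omega>) X = card (vset \<Omega> X)"
proof (rule antisym[OF rank_le_vset[OF X(1)]])
  note gr = biased_graph_graph
  have finX: "finite X" by (rule graph_finite[OF gr X(1)])
  define Q where "Q n \<longleftrightarrow> (\<exists>J. C \<subseteq> J \<and> J \<subseteq> X \<and> indep (frame_matroid \<Omega>) J \<and>
    card J = card (vset \<Omega> J) \<and> card J = n)" for n
  have cC: "cycle \<Omega> C" using C by (simp add: unbalanced_cycle_def)
  have Q0: "Q (card C)" unfolding Q_def using C indep_unbalanced_cycle[OF C(1)] cycle_card[OF gr cC] by blast
  have "n \<le> card X" if "Q n" for n
    using that card_mono[OF finX] unfolding Q_def by blast
  then have "Collect Q \<subseteq> {..card X}" by blast
  then have fin: "finite (Collect Q)" by (rule finite_subset) simp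
  define n where "n = Max (Collect Q)"
  have n: "Q n" "\<And>m. Q m \<Longrightarrow> m \<le> n"
    using Max_in[OF fin] Max_ge[OF fin] Q0 unfolding n_def by auto
  then obtain J where J: "C \<subseteq> J" "J \<subseteq> X" "indep (frame_matroid \<Omega>) J" "card J = card (vset \<Omega> J)" "card J = n"
    unfolding Q_def by blast
  have finJ: "finite J" "finite (vset \<Omega> J)"
    using J(2) finX finite_subset graph_finite_vset[OF gr, of J] X(1) by auto
  have closed: "z \<in> vset \<Omega> J" if e: "e \<in> X" "ends \<Omega> e = {y, z}" "y \<in> vset \<Omega> J" for e y z
  proof (rule ccontr)
    assume z: "z \<notin> vset \<Omega> J"
    have eE: "e \<in> edges \<Omega>" using X e by blast
    have "e \<notin> J" using z e by (auto simp: vset_def)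
    have "vset \<Omega> (insert e J) = insert z (vset \<Omega> J)" using e by auto
    moreover have "indep (frame_matroid \<Omega>) (insert e J)"
      using z e(3) by (intro indep_pendant[OF J(3) eE e(2)]) auto
    ultimately have "Q (Suc n)"
      unfolding Q_def using J e(1) z finJ \<open>e \<notin> J\<close> by (intro exI[of _ "insert e J"]) auto
    then show False using n(2) by fastforce
  qed
  obtain x where x: "x \<in> vset \<Omega> C" using cycle_vset_ne[OF cC] by blast
  then have xJ: "x \<in> vset \<Omega> J" using vset_mono[OF J(1), of \<Omega>] by blast
  then have xX: "x \<in> vset \<Omega> X" using vset_mono[OF J(2), of \<Omega>] by blast
  have "y \<in> vset \<Omega> J" if "y \<in> vset \<Omega> X" for y
  proof -
    have "(x, y) \<in> (adj \<Omega> X)\<^sup>*" using X(2) xX that unfolding conn_adj by blast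
    then show ?thesis
    proof induction
      case base show ?case by (rule xJ)
    next
      case (step y z)
      then obtain e where "e \<in> X" "ends \<Omega> e = {y, z}" unfolding adj_def by blast
      then show ?case using closed step.IH by blast
    qed
  qed
  then have "vset \<Omega> X = vset \<Omega> J" using vset_mono[OF J(2), of \<Omega>] by blast
  then show "card (vset \<Omega> X) \<le> matroid_rank (frame_matroid \<Omega>) X"
    using rank_ge[OF J(2,3)] J(4) by simp
qed

end

section \<open>Balanced cycles through a balancing vertex\<close>

text \<open>Each step joins two distinct vertices. The arbitrary \<open>a\<close> suits the use:
  paths meeting in at most one vertex cannot share an edge.\<close>

lemma gpath_link:
  "gpath G x y P \<Longrightarrow> e \<in> P \<Longrightarrow> \<not> ends G e \<subseteq> {a}"
proof (induction rule: gpath.induct)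
  case (step y P e' z)
  have "y \<noteq> z" using gpath_end[OF step.hyps(1)] step.hyps(4) by auto
  then show ?case using step by auto
qed simp

lemma gpath_split_edge:
  assumes "gpath G x w P" "q \<in> P"
  obtains s t P1 P2 where "P = insert q (P1 \<union> P2)" "ends G q = {s, t}" "gpath G x s P1"
    "gpath G t w P2" "insert x (vset G P1) \<inter> insert t (vset G P2) = {}"
proof -
  from assms have "\<exists>s t P1 P2. P = insert q (P1 \<union> P2) \<and> ends G q = {s, t} \<and> gpath G x s P1 \<and>
    gpath G t w P2 \<and> insert x (vset G P1) \<inter> insert t (vset G P2) = {}"
  proof (induction rule: gpath.induct)
    case refl
    then show ?case by simp
  next
    case (step y P e z)
    show ?case
    proof (cases "q = e")
      case True
      then show ?thesis using step.hyps gpath.refl[of G z]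
        by (intro exI[of _ y] exI[of _ z] exI[of _ P] exI[of _ "{}"]) simp
    next
      case False
      then have "q \<in> P" using step.prems by simp
      from step.IH[OF this] obtain s t P1 P2 where *: "P = insert q (P1 \<union> P2)" "ends G q = {s, t}" "gpath G x s P1"
        "gpath G t y P2" "insert x (vset G P1) \<inter> insert t (vset G P2) = {}"
        by (elim exE conjE) (rule that; assumption)
      have z: "z \<notin> insert x (vset G P1)" "z \<notin> insert t (vset G P2)"
        using step.hyps(4) *(2) unfolding *(1) by auto
      have "gpath G t z (insert e P2)" by (rule gpath.step[OF *(4) step.hyps(2,3) z(2)])
      moreover have "insert x (vset G P1) \<inter> insert t (vset G (insert e P2)) = {}"
        using *(5) z(1) gpath_end[OF *(4)] step.hyps(3) by auto
      moreover have "insert e P = insert q (P1 \<union> insert e P2)" using *(1) by auto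
      ultimately show ?thesis using *(2,3)
        by (intro exI[of _ s] exI[of _ t] exI[of _ P1] exI[of _ "insert e P2"]) simp
    qed
  qed
  then show ?thesis by (elim exE conjE) (rule that; assumption)
qed

lemma gpath_edges_disjoint:
  assumes "gpath G x y Q" "vset G Q \<inter> vset G P \<subseteq> {a}"
  shows "Q \<inter> P = {}"
proof (rule ccontr)
  assume "Q \<inter> P \<noteq> {}"
  then obtain e where e: "e \<in> Q" "e \<in> P" by blast
  then have "ends G e \<subseteq> vset G Q \<inter> vset G P" by (auto simp: vset_def)
  then show False using assms(2) gpath_link[OF assms(1) e(1), of a] by auto
qed

text \<open>At inner vertices of \<open>P\<close> the path \<open>Q\<close> has degree 0 or 2, so it
  is all of \<open>P\<close> or empty, and with distinct ends it is not empty.\<close>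

lemma gpath_subset_gpath:
  assumes "gpath G v w P" "gpath G v w Q" "Q \<subseteq> P"
  shows "Q = P"
proof (cases "v = w")
  case True
  then show ?thesis using assms gpath_trivial by metis
next
  case False
  have "deg G Q x \<noteq> 1" if "x \<in> vset G P - {v, w}" for x
    using gpath_deg[OF assms(2), of x] that by (auto split: if_splits)
  with assms(1,3) have "Q = {} \<or> Q = P" by (rule gpath_all_or_nothing)
  then show ?thesis using gpath_neq(1)[OF assms(2) False] by simp
qed

text \<open>The part of \<open>Q\<close> around an edge outside \<open>P\<close>, up to the nearest vertices of \<open>P\<close> on both
  sides, is an ear \<open>E\<close> of \<open>P\<close>.\<close>

lemma gpath_ear:
  assumes P: "gpath G v w P" and Q: "gpath G v w Q" and n: "\<not> Q \<subseteq> P"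
  obtains a b P1 P2 P3 E where "P = P1 \<union> P2 \<union> P3" "a \<noteq> b" "gpath G v a P1" "gpath G a b P2"
    "gpath G b w P3" "gpath G a b E" "insert v (vset G P1) \<inter> insert a (vset G P2) \<subseteq> {a}"
    "insert a (vset G P2) \<inter> insert b (vset G P3) \<subseteq> {b}"
    "insert v (vset G P1) \<inter> insert b (vset G P3) = {}"
    "vset G E \<inter> insert v (vset G P) \<subseteq> {a, b}" "E \<inter> P = {}" "E \<subseteq> Q"
proof -
  let ?A = "insert v (vset G P)"
  have vw: "v \<in> ?A" "w \<in> ?A" using gpath_end[OF P] by simp_all
  obtain q where q: "q \<in> Q" "q \<notin> P" using n by blast
  obtain s t Q1 Q2 where s: "Q = insert q (Q1 \<union> Q2)" "ends G q = {s, t}" "gpath G v s Q1"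
    "gpath G t w Q2" "insert v (vset G Q1) \<inter> insert t (vset G Q2) = {}"
    by (rule gpath_split_edge[OF Q q(1)])
  obtain a Q1' where a: "a \<in> ?A" "Q1' \<subseteq> Q1" "gpath G a s Q1'" "insert a (vset G Q1') \<inter> ?A = {a}"
    "a \<in> insert v (vset G Q1)"
    \<comment> \<open>Here \<open>a\<close> is the last vertex of \<open>P\<close> that
      \<open>Q\<close> visits before crossing \<open>q\<close>. The same argument for the reversed
      second half of \<open>Q\<close> gives \<open>b\<close>, the first vertex of \<open>P\<close>
      after \<open>q\<close>.\<close>
    by (rule gpath_last_hit[OF s(3) vw(1)])
  obtain b Q2' where b: "b \<in> ?A" "Q2' \<subseteq> Q2" "gpath G b t Q2'" "insert b (vset G Q2') \<inter> ?A = {b}"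
    "b \<in> insert w (vset G Q2)"
    by (rule gpath_last_hit[OF gpath_rev[OF s(4)] vw(2)])
  have V1: "insert a (vset G Q1') \<subseteq> insert v (vset G Q1)"
    using a(5) vset_mono[OF a(2), of G] by blast
  have V2: "insert b (vset G Q2') \<subseteq> insert t (vset G Q2)"
    using b(5) vset_mono[OF b(2), of G] gpath_insert_end[OF s(4)] by blast
  have dis: "insert a (vset G Q1') \<inter> insert b (vset G Q2') = {}" using V1 V2 s(5) by blast
  have st: "s \<in> insert a (vset G Q1')" "t \<in> insert b (vset G Q2')"
    using gpath_end[OF a(3)] gpath_end[OF b(3)] by simp_all
  have "q \<in> edges G" using gpath_edges[OF Q] q by blast
  have ab: "a \<noteq> b" using dis by blast
  let ?E = "Q1' \<union> ({q} \<union> Q2')"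
  have "s \<noteq> t" using st dis by blast
  then have "gpath G s t {q}" using \<open>q \<in> edges G\<close> s(2) by (intro gpath_edge)
  moreover have "insert s (vset G {q}) \<inter> insert t (vset G Q2') \<subseteq> {t}"
    using s(2) st dis gpath_insert_end[OF b(3)] by auto
  ultimately have "gpath G s b ({q} \<union> Q2')"
    by (intro gpath_join[OF gpath_rev[OF b(3)]])
  moreover have "insert a (vset G Q1') \<inter> insert s (vset G ({q} \<union> Q2')) \<subseteq> {s}"
    using s(2) st dis by auto
  ultimately have E: "gpath G a b ?E" by (rule gpath_join[OF _ a(3)])
  have EV: "vset G ?E = insert a (vset G Q1') \<union> insert b (vset G Q2')"
  proof -
    have "vset G ?E = vset G Q1' \<union> {s, t} \<union> vset G Q2'" using s(2) by auto
    moreover have "a \<in> vset G ?E" "b \<in> vset G ?E" using gpath_neq[OF E ab] by simp_all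
    ultimately show ?thesis using st by blast
  qed
  have EA: "vset G ?E \<inter> ?A \<subseteq> {a, b}" unfolding EV Int_Un_distrib2 a(4) b(4) by simp
  have "Q1' \<inter> P = {}" using a(4) by (intro gpath_edges_disjoint[OF a(3), of _ a]) blast
  moreover have "Q2' \<inter> P = {}" using b(4) by (intro gpath_edges_disjoint[OF b(3), of _ b]) blast
  ultimately have EP: "?E \<inter> P = {}" using q(2) by blast
  have EQ: "?E \<subseteq> Q" using a(2) b(2) s(1) by blast
  obtain A1 A2 where A: "P = A1 \<union> A2" "A1 \<inter> A2 = {}" "gpath G v a A1" "gpath G a w A2"
    "insert v (vset G A1) \<inter> insert a (vset G A2) = {a}"
    by (rule gpath_split[OF P a(1)])
  have aA: "a \<in> insert v (vset G A1)" by (rule gpath_end[OF A(3)])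
  \<comment> \<open>\<open>Q\<close> may traverse the ear against the direction of \<open>P\<close>.
    If \<open>b\<close> comes before \<open>a\<close> on \<open>P\<close>, the two names are
    exchanged and the ear is reversed.\<close>
  have "b \<in> insert v (vset G A1) \<or> b \<in> insert a (vset G A2)" using b(1) unfolding A(1) by auto
  then show ?thesis
  proof
    assume "b \<in> insert a (vset G A2)"
    then obtain B1 B2 where B: "A2 = B1 \<union> B2" "B1 \<inter> B2 = {}" "gpath G a b B1" "gpath G b w B2"
      "insert a (vset G B1) \<inter> insert b (vset G B2) = {b}"
      by (rule gpath_split[OF A(4)])
    have aB: "a \<notin> insert b (vset G B2)"
    proof
      assume "a \<in> insert b (vset G B2)"
      then have "a \<in> insert a (vset G B1) \<inter> insert b (vset G B2)" by simp
      then show False unfolding B(5) using ab by simp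
    qed
    have V: "insert a (vset G A2) = insert a (vset G B1) \<union> insert b (vset G B2)"
      unfolding B(1) using gpath_end[OF B(3)] by auto
    have "insert v (vset G A1) \<inter> (insert a (vset G B1) \<union> insert b (vset G B2)) \<subseteq> {a}"
      using A(5) unfolding V by simp
    then have i: "insert v (vset G A1) \<inter> insert a (vset G B1) \<subseteq> {a}"
      "insert v (vset G A1) \<inter> insert b (vset G B2) = {}"
      using aB by blast+
    show ?thesis
      by (rule that[OF _ ab A(3) B(3,4) E i(1) _ i(2) EA EP EQ]) (use A(1) B(1,5) in auto)
  next
    assume "b \<in> insert v (vset G A1)"
    then obtain B1 B2 where B: "A1 = B1 \<union> B2" "B1 \<inter> B2 = {}" "gpath G v b B1" "gpath G b a B2"
      "insert v (vset G B1) \<inter> insert b (vset G B2) = {b}"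
      by (rule gpath_split[OF A(3)])
    have aB: "a \<in> insert b (vset G B2)" by (rule gpath_end[OF B(4)])
    have aB1: "a \<notin> insert v (vset G B1)"
    proof
      assume "a \<in> insert v (vset G B1)"
      then have "a \<in> insert v (vset G B1) \<inter> insert b (vset G B2)" using aB by simp
      then show False unfolding B(5) using ab by simp
    qed
    have V: "insert v (vset G A1) = insert v (vset G B1) \<union> insert b (vset G B2)"
      unfolding B(1) using gpath_end[OF B(3)] by auto
    have "(insert v (vset G B1) \<union> insert b (vset G B2)) \<inter> insert a (vset G A2) \<subseteq> {a}"
      using A(5) unfolding V by simp
    then have i: "insert b (vset G B2) \<inter> insert a (vset G A2) \<subseteq> {a}"
      "insert v (vset G B1) \<inter> insert a (vset G A2) = {}"
      using aB1 by blast+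
    have "vset G ?E \<inter> insert v (vset G P) \<subseteq> {b, a}" using EA by blast
    then show ?thesis
      by (intro that[OF _ ab[symmetric] B(3,4) A(4) gpath_rev[OF E] _ i _ EP EQ]) (use A(1) B(1,5) in auto)
  qed
qed

context
  fixes \<Omega> :: "('v, 'e) bgraph"
  assumes B: "biased_graph \<Omega>"
begin

text \<open>A theta has only three cycles, so if the third were unbalanced, it would contain exactly
  two balanced ones.\<close>

lemma theta_third_balanced:
  assumes P: "gpath \<Omega> x y P1" "gpath \<Omega> x y P2" "gpath \<Omega> x y P3" "x \<noteq> y"
    "P1 \<inter> P2 = {}" "P1 \<inter> P3 = {}" "P2 \<inter> P3 = {}"
    "vset \<Omega> P1 \<inter> vset \<Omega> P2 = {x, y}" "vset \<Omega> P1 \<inter> vset \<Omega> P3 = {x, y}"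
    "vset \<Omega> P2 \<inter> vset \<Omega> P3 = {x, y}"
    and b: "P1 \<union> P2 \<in> balanced \<Omega>" "P1 \<union> P3 \<in> balanced \<Omega>"
  shows "P2 \<union> P3 \<in> balanced \<Omega>"
proof (rule ccontr)
  let ?T = "P1 \<union> P2 \<union> P3"
  assume n: "P2 \<union> P3 \<notin> balanced \<Omega>"
  have "C \<in> {P1 \<union> P2, P1 \<union> P3}" if "C \<in> balanced \<Omega>" "C \<subseteq> ?T" for C
    using theta_cycles[OF P balanced_cycle[OF B that(1)] that(2)] that(1) n by blast
  then have "{C \<in> balanced \<Omega>. C \<subseteq> ?T} = {P1 \<union> P2, P1 \<union> P3}" using b by blast
  moreover have "P1 \<union> P2 \<noteq> P1 \<union> P3"
    using P(5-7) gpath_neq(1)[OF P(2,4)] by blast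
  ultimately have "card {C \<in> balanced \<Omega>. C \<subseteq> ?T} = 2" by simp
  moreover have "theta \<Omega> ?T" by (rule theta_of_gpaths[OF P])
  ultimately show False using B unfolding biased_graph_def by blast
qed

text \<open>What remains after deleting \<open>e\<close> is a path from \<open>v\<close> to
  \<open>u\<close>; its last step is the second link \<open>f\<close> at \<open>u\<close>, and the
  rest avoids \<open>u\<close>.\<close>

lemma cycle_at_link:
  assumes C: "cycle \<Omega> C" and e: "e \<in> C" "ends \<Omega> e = {u, v}" "v \<noteq> u"
  obtains f w P where "f \<in> C" "f \<noteq> e" "ends \<Omega> f = {u, w}" "w \<noteq> u" "gpath \<Omega> v w P"
    "C = insert e (insert f P)" "u \<notin> insert v (vset \<Omega> P)"
proof -
  have "ends \<Omega> e = {v, u}" using e(2) by blast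
  then have "gpath \<Omega> v u (C - {e})"
    using cycle_minus_edge[OF biased_graph_graph[OF B] C e(1)] e(3) by blast
  then show ?thesis
  proof (cases rule: gpath.cases)
    case refl
    then show ?thesis using e(3) by simp
  next
    case (step w P f)
    have "w \<noteq> u" using step(5) gpath_end[OF step(2)] by auto
    moreover have "ends \<Omega> f = {u, w}" using step(4) by blast
    moreover have "f \<in> C" "f \<noteq> e" using step(1) by blast+
    moreover have "C = insert e (insert f P)" using step(1) e(1) by blast
    ultimately show ?thesis using that step(2,5) by blast
  qed
qed

context
  fixes u :: 'v
  assumes bal: "\<And>C. cycle \<Omega> C \<Longrightarrow> u \<notin> vset \<Omega> C \<Longrightarrow> C \<in> balanced \<Omega>"
begin

text \<open>Replacing a segment of \<open>P\<close> by an ear contained in \<open>Q\<close> changes the cycle by the balanced cycle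
  formed by the segment and the ear, so the theta property applies.\<close>

lemma reroute:
  assumes e: "e \<in> edges \<Omega>" "f \<in> edges \<Omega>" "ends \<Omega> e = {u, v}" "ends \<Omega> f = {u, w}" "e \<noteq> f"
    and P: "gpath \<Omega> v w P" "u \<notin> insert v (vset \<Omega> P)"
    and Q: "gpath \<Omega> v w Q" "u \<notin> insert v (vset \<Omega> Q)"
    and b: "insert e (insert f P) \<in> balanced \<Omega>"
  shows "insert e (insert f Q) \<in> balanced \<Omega>"
  using P b
\<comment> \<open>The measure counts the edges of \<open>P\<close> not shared with \<open>Q\<close>:
  an exchange drops such an edge and brings in only edges of \<open>Q\<close>.\<close>
proof (induction "card (P - Q)" arbitrary: P rule: less_induct)
  case less
  note P = less.prems(1,2)
  show ?case
  proof (cases "Q \<subseteq> P")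
    case True
    then have "Q = P" by (rule gpath_subset_gpath[OF P(1) Q(1)])
    then show ?thesis using less.prems(3) by simp
  next
    case False
    obtain a b P1 P2 P3 E where p: "P = P1 \<union> P2 \<union> P3" "a \<noteq> b" "gpath \<Omega> v a P1" "gpath \<Omega> a b P2"
      "gpath \<Omega> b w P3" "gpath \<Omega> a b E" "insert v (vset \<Omega> P1) \<inter> insert a (vset \<Omega> P2) \<subseteq> {a}"
      "insert a (vset \<Omega> P2) \<inter> insert b (vset \<Omega> P3) \<subseteq> {b}"
      "insert v (vset \<Omega> P1) \<inter> insert b (vset \<Omega> P3) = {}"
      "vset \<Omega> E \<inter> insert v (vset \<Omega> P) \<subseteq> {a, b}" "E \<inter> P = {}" "E \<subseteq> Q"
      by (rule gpath_ear[OF P(1) Q(1) False])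
    have u1: "u \<notin> insert v (vset \<Omega> P1)" "u \<notin> vset \<Omega> P2" "u \<notin> vset \<Omega> P3"
      using P(2) unfolding p(1) by auto
    have uE: "u \<notin> vset \<Omega> E" using Q(2) vset_mono[OF p(12), of \<Omega>] by blast
    have wP: "w \<in> insert b (vset \<Omega> P3)" by (rule gpath_end[OF p(5)])
    have aP: "a \<in> insert v (vset \<Omega> P1)" by (rule gpath_end[OF p(3)])
    note abV = gpath_neq(2,3)[OF p(4,2)] gpath_neq(2,3)[OF p(6,2)]
    have uw: "u \<noteq> b" "u \<notin> insert b (vset \<Omega> P3)" "w \<noteq> u" using u1(2,3) abV wP by auto
    have uv: "u \<noteq> v" using P(2) by blast
    have vw: "v \<noteq> w" using p(9) wP by blast
    have eP: "e \<notin> P" "f \<notin> P" using P(2) e(3,4) by (auto simp: vset_def)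
    have eE: "e \<notin> E" "f \<notin> E" using uE e(3,4) by (auto simp: vset_def)
    have eQ: "e \<notin> Q" "f \<notin> Q" using Q(2) e(3,4) by (auto simp: vset_def)
    \<comment> \<open>\<open>?R\<close> is the third path of the theta: from \<open>a\<close> back
      along \<open>P1\<close> to \<open>v\<close>, through \<open>u\<close> by way of
      \<open>e\<close> and \<open>f\<close> to \<open>w\<close>, then back along \<open>P3\<close>
      to \<open>b\<close>.\<close>
    let ?R = "P1 \<union> ({e} \<union> ({f} \<union> P3))"
    have "ends \<Omega> e = {v, u}" using e(3) by blast
    then have ge: "gpath \<Omega> v u {e}" using gpath_edge[OF e(1)] uv by blast
    have gf: "gpath \<Omega> u w {f}" by (rule gpath_edge[OF e(2,4) uw(3)[symmetric]])
    have "insert u (vset \<Omega> {f}) \<inter> insert w (vset \<Omega> P3) \<subseteq> {w}"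
      using e(4) uw gpath_insert_end[OF p(5)] by auto
    then have g1: "gpath \<Omega> u b ({f} \<union> P3)" by (rule gpath_join[OF gpath_rev[OF p(5)] gf])
    have "insert v (vset \<Omega> {e}) \<inter> insert u (vset \<Omega> ({f} \<union> P3)) \<subseteq> {u}"
      using e(3,4) uv vw p(9) by auto
    then have g2: "gpath \<Omega> v b ({e} \<union> ({f} \<union> P3))" by (rule gpath_join[OF g1 ge])
    have "insert a (vset \<Omega> P1) \<inter> insert v (vset \<Omega> ({e} \<union> ({f} \<union> P3))) \<subseteq> {v}"
      using e(3,4) gpath_insert_end[OF p(3)] p(9) wP u1(1) by auto
    then have R: "gpath \<Omega> a b ?R" by (rule gpath_join[OF g2 gpath_rev[OF p(3)]])
    have VR: "vset \<Omega> ?R = insert v (vset \<Omega> P1) \<union> insert b (vset \<Omega> P3) \<union> {u}"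
      using e(3,4) gpath_neq(3)[OF R p(2)] wP by auto
    have "vset \<Omega> ?R \<inter> vset \<Omega> P2 \<subseteq> {a, b}"
      unfolding VR using p(7,8) u1(2) by blast
    moreover have "{a, b} \<subseteq> vset \<Omega> ?R \<inter> vset \<Omega> P2"
      using abV gpath_neq(2,3)[OF R p(2)] by simp
    ultimately have v1: "vset \<Omega> ?R \<inter> vset \<Omega> P2 = {a, b}" by (rule subset_antisym)
    have VP: "vset \<Omega> P1 \<subseteq> vset \<Omega> P" "vset \<Omega> P2 \<subseteq> vset \<Omega> P" "vset \<Omega> P3 \<subseteq> vset \<Omega> P"
      unfolding p(1) by auto
    have "insert v (vset \<Omega> P1) \<union> insert b (vset \<Omega> P3) \<subseteq> insert v (vset \<Omega> P)"
      using VP abV by blast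
    then have "vset \<Omega> ?R \<inter> vset \<Omega> E \<subseteq> {a, b}" unfolding VR using p(10) uE by blast
    moreover have "{a, b} \<subseteq> vset \<Omega> ?R \<inter> vset \<Omega> E"
      using abV gpath_neq(2,3)[OF R p(2)] by simp
    ultimately have v2: "vset \<Omega> ?R \<inter> vset \<Omega> E = {a, b}" by (rule subset_antisym)
    have "vset \<Omega> P2 \<inter> vset \<Omega> E \<subseteq> {a, b}" using p(10) VP by blast
    moreover have "{a, b} \<subseteq> vset \<Omega> P2 \<inter> vset \<Omega> E" using abV by simp
    ultimately have v3: "vset \<Omega> P2 \<inter> vset \<Omega> E = {a, b}" by (rule subset_antisym)
    have P12: "P1 \<inter> P2 = {}" using p(7) by (intro gpath_edges_disjoint[OF p(3), of _ a]) blast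
    have P23: "P2 \<inter> P3 = {}" using p(8) by (intro gpath_edges_disjoint[OF p(4), of _ b]) blast
    have d1: "?R \<inter> P2 = {}" using P12 P23 eP p(1) by blast
    have d2: "?R \<inter> E = {}" using p(11) eE p(1) by blast
    have d3: "P2 \<inter> E = {}" using p(11) p(1) by blast
    have c: "cycle \<Omega> (P2 \<union> E)" by (rule cycle_of_gpaths[OF p(4,6,2) d3 v3])
    \<comment> \<open>Neither the segment nor the ear meets \<open>u\<close>, so \<open>bal\<close>
      applies.\<close>
    have b1: "P2 \<union> E \<in> balanced \<Omega>" using u1(2) uE by (intro bal[OF c]) simp
    have "P2 \<union> ?R = insert e (insert f P)" using p(1) by blast
    then have b2: "P2 \<union> ?R \<in> balanced \<Omega>" using less.prems(3) by simp
    have "?R \<union> E \<in> balanced \<Omega>"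
      using d1 d2 d3 v1 v2 v3
      by (intro theta_third_balanced[OF p(4) R p(6,2) _ _ _ _ _ _ b2 b1]) (simp_all add: Int_commute)
    moreover have "?R \<union> E = insert e (insert f (P1 \<union> (E \<union> P3)))" by blast
    ultimately have b3: "insert e (insert f (P1 \<union> (E \<union> P3))) \<in> balanced \<Omega>" by simp
    have VE: "insert a (vset \<Omega> E) = vset \<Omega> E" using abV by blast
    have "vset \<Omega> E \<inter> insert b (vset \<Omega> P3) \<subseteq> {b}"
      using p(10) VP p(9) aP abV by blast
    then have "gpath \<Omega> a w (E \<union> P3)" by (intro gpath_join[OF p(5,6)]) (simp add: VE)
    moreover have "insert v (vset \<Omega> P1) \<inter> insert a (vset \<Omega> (E \<union> P3)) \<subseteq> {a}"
      using p(10,9) VP unfolding vset_simps by blast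
    ultimately have g3: "gpath \<Omega> v w (P1 \<union> (E \<union> P3))" by (rule gpath_join[OF _ p(3)])
    have u3: "u \<notin> insert v (vset \<Omega> (P1 \<union> (E \<union> P3)))" using u1 uE uv by simp
    \<comment> \<open>The measure drops strictly: \<open>Q\<close> includes the ear, but as a path
      it contains no cycle, so it misses an edge of the replaced segment.\<close>
    have "\<not> P2 \<union> E \<subseteq> Q" using gpath_no_cycle[OF Q(1)] c by blast
    then obtain g where g: "g \<in> P2" "g \<notin> Q" using p(12) by blast
    then have "g \<in> P - Q" "g \<notin> (P1 \<union> (E \<union> P3)) - Q"
      using p(1) P12 P23 d3 by blast+
    moreover have "(P1 \<union> (E \<union> P3)) - Q \<subseteq> P - Q" using p(1,12) by blast
    ultimately have "(P1 \<union> (E \<union> P3)) - Q \<subset> P - Q" by blast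
    then have "card ((P1 \<union> (E \<union> P3)) - Q) < card (P - Q)"
      using gpath_finite[OF P(1)] by (intro psubset_card_mono) simp_all
    then show ?thesis using less.hyps g3 u3 b3 by blast
  qed
qed

text \<open>Both cycles consist of \<open>e\<close>, \<open>f\<close> and a path avoiding
  \<open>u\<close> between the other ends of these links, so \<open>reroute\<close> carries balance
  from \<open>D\<close> to \<open>C\<close>.\<close>

lemma balanced_if_shared_links:
  assumes C: "cycle \<Omega> C" and D: "D \<in> balanced \<Omega>"
    and e: "ends \<Omega> e = {u, v}" "v \<noteq> u" "ends \<Omega> f = {u, w}" "w \<noteq> u" "e \<noteq> f"
    and m: "e \<in> C" "f \<in> C" "e \<in> D" "f \<in> D"
  shows "C \<in> balanced \<Omega>"
proof -
  have path: "\<exists>P. gpath \<Omega> v w P \<and> X = insert e (insert f P) \<and> u \<notin> insert v (vset \<Omega> P)"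
    if X: "cycle \<Omega> X" "e \<in> X" "f \<in> X" for X
  proof -
    obtain f' w' P where P: "f' \<in> X" "f' \<noteq> e" "ends \<Omega> f' = {u, w'}" "w' \<noteq> u" "gpath \<Omega> v w' P"
      "X = insert e (insert f' P)" "u \<notin> insert v (vset \<Omega> P)"
      by (rule cycle_at_link[OF X(1,2) e(1,2)])
    have "f \<notin> P" using P(7) e(3) by (auto simp: vset_def)
    then have "f = f'" using X(3) P(6) e(5) by blast
    then have "w = w'" using P(3) e(3) by (auto simp: doubleton_eq_iff)
    then show ?thesis using P \<open>f = f'\<close> by blast
  qed
  obtain P where P: "gpath \<Omega> v w P" "C = insert e (insert f P)" "u \<notin> insert v (vset \<Omega> P)"
    using path[OF C m(1,2)] by blast
  obtain Q where Q: "gpath \<Omega> v w Q" "D = insert e (insert f Q)" "u \<notin> insert v (vset \<Omega> Q)"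
    using path[OF balanced_cycle[OF B D] m(3,4)] by blast
  have "e \<in> edges \<Omega>" "f \<in> edges \<Omega>" using C m unfolding cycle_def by blast+
  then show ?thesis
    unfolding P(2) using D unfolding Q(2)
    by (intro reroute[OF _ _ e(1,3,5) Q(1,3) P(1,3)])
qed

text \<open>The three links at \<open>u\<close> continue to a common vertex \<open>j\<close> outside \<open>u\<close>, which gives a theta with
  branch vertices \<open>u\<close> and \<open>j\<close>.\<close>

lemma balanced_links_trans:
  assumes C1: "C1 \<in> balanced \<Omega>" "e \<in> C1" "f \<in> C1" and C2: "C2 \<in> balanced \<Omega>" "f \<in> C2" "g \<in> C2"
    and e: "ends \<Omega> e = {u, xe}" "xe \<noteq> u" "ends \<Omega> f = {u, xf}" "xf \<noteq> u" "ends \<Omega> g = {u, xg}" "xg \<noteq> u"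
    and d: "e \<noteq> f" "f \<noteq> g" "e \<noteq> g"
  shows "\<exists>C\<in>balanced \<Omega>. e \<in> C \<and> g \<in> C"
proof -
  have path: "\<exists>P. gpath \<Omega> xf x P \<and> X = insert f (insert h P) \<and> u \<notin> insert xf (vset \<Omega> P)"
    if X: "cycle \<Omega> X" "f \<in> X" "h \<in> X" and h: "ends \<Omega> h = {u, x}" "h \<noteq> f" for X h x
  proof -
    obtain f' w' P where P: "f' \<in> X" "f' \<noteq> f" "ends \<Omega> f' = {u, w'}" "w' \<noteq> u" "gpath \<Omega> xf w' P"
      "X = insert f (insert f' P)" "u \<notin> insert xf (vset \<Omega> P)"
      by (rule cycle_at_link[OF X(1,2) e(3,4)])
    have "h \<notin> P" using P(7) h(1) by (auto simp: vset_def)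
    then have "h = f'" using X(3) P(6) h(2) by blast
    then have "x = w'" using P(3,4) h(1) by (auto simp: doubleton_eq_iff)
    then show ?thesis using P \<open>h = f'\<close> by blast
  qed
  obtain P where P: "gpath \<Omega> xf xe P" "C1 = insert f (insert e P)" "u \<notin> insert xf (vset \<Omega> P)"
    using path[OF balanced_cycle[OF B C1(1)] C1(3,2) e(1) d(1)] by blast
  obtain Q where Q: "gpath \<Omega> xf xg Q" "C2 = insert f (insert g Q)" "u \<notin> insert xf (vset \<Omega> Q)"
    using path[OF balanced_cycle[OF B C2(1)] C2(2,3) e(5)] d(2) by blast
  have E: "e \<in> edges \<Omega>" "f \<in> edges \<Omega>" "g \<in> edges \<Omega>"
    using balanced_cycle[OF B C1(1)] balanced_cycle[OF B C2(1)] C1(2,3) C2(3) unfolding cycle_def by blast+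
  \<comment> \<open>\<open>j\<close> is where \<open>Q\<close>, followed towards \<open>xg\<close>,
    meets \<open>P\<close> for the last time; the rest \<open>Q'\<close> meets \<open>P\<close> only
    there and so can serve in the third arm of the theta.\<close>
  obtain j Q' where j: "j \<in> insert xf (vset \<Omega> P)" "Q' \<subseteq> Q" "gpath \<Omega> j xg Q'"
    "insert j (vset \<Omega> Q') \<inter> insert xf (vset \<Omega> P) = {j}" "j \<in> insert xf (vset \<Omega> Q)"
    by (rule gpath_last_hit[OF Q(1) insertI1])
  obtain P1 P2 where p: "P = P1 \<union> P2" "P1 \<inter> P2 = {}" "gpath \<Omega> xf j P1" "gpath \<Omega> j xe P2"
    "insert xf (vset \<Omega> P1) \<inter> insert j (vset \<Omega> P2) = {j}"
    by (rule gpath_split[OF P(1) j(1)])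
  have uj: "u \<noteq> j" using j(1) P(3) by blast
  have up: "u \<notin> insert xf (vset \<Omega> P1)" "u \<notin> insert j (vset \<Omega> P2)"
    using P(3) uj unfolding p(1) by auto
  have uQ: "u \<notin> insert j (vset \<Omega> Q')" using Q(3) uj vset_mono[OF j(2), of \<Omega>] by blast
  have arm: "gpath \<Omega> u j ({h} \<union> R) \<and> vset \<Omega> ({h} \<union> R) = insert u (insert x (vset \<Omega> R))"
    if h: "h \<in> edges \<Omega>" "ends \<Omega> h = {u, x}" and R: "gpath \<Omega> x j R" "u \<notin> insert x (vset \<Omega> R)" for h x R
    using gpath_Cons[OF h R] h(2) by simp
  have ends_eq: "insert xe (vset \<Omega> P2) = insert j (vset \<Omega> P2)" "insert xg (vset \<Omega> Q') = insert j (vset \<Omega> Q')"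
    using gpath_insert_end[OF p(4)] gpath_insert_end[OF j(3)] by simp_all
  note R1 = arm[OF E(2) e(3) p(3) up(1)]
  have R2: "gpath \<Omega> u j ({e} \<union> P2) \<and> vset \<Omega> ({e} \<union> P2) = insert u (insert j (vset \<Omega> P2))"
    using arm[OF E(1) e(1) gpath_rev[OF p(4)]] up(2) unfolding ends_eq by blast
  have R3: "gpath \<Omega> u j ({g} \<union> Q') \<and> vset \<Omega> ({g} \<union> Q') = insert u (insert j (vset \<Omega> Q'))"
    using arm[OF E(3) e(5) gpath_rev[OF j(3)]] uQ unfolding ends_eq by blast
  have VP: "insert xf (vset \<Omega> P) = insert xf (vset \<Omega> P1) \<union> insert j (vset \<Omega> P2)"
    unfolding p(1) using gpath_end[OF p(3)] by auto
  have jP1: "j \<in> insert xf (vset \<Omega> P1)" by (rule gpath_end[OF p(3)])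
  have i12: "vset \<Omega> ({f} \<union> P1) \<inter> vset \<Omega> ({e} \<union> P2) = {u, j}"
    using R1 R2 p(5) by auto
  have i13': "insert xf (vset \<Omega> P1) \<inter> insert j (vset \<Omega> Q') = {j}"
    using j(4) VP jP1 by blast
  then have i13: "vset \<Omega> ({f} \<union> P1) \<inter> vset \<Omega> ({g} \<union> Q') = {u, j}"
    using R1 R3 by auto
  have "insert j (vset \<Omega> P2) \<inter> insert j (vset \<Omega> Q') = {j}"
    using j(4) VP by blast
  then have i23: "vset \<Omega> ({e} \<union> P2) \<inter> vset \<Omega> ({g} \<union> Q') = {u, j}"
    using R2 R3 by auto
  have nP: "e \<notin> P" "f \<notin> P" "g \<notin> P" using P(3) e(1,3,5) by (auto simp: vset_def)
  have nQ: "e \<notin> Q'" "f \<notin> Q'" "g \<notin> Q'" using uQ e(1,3,5) by (auto simp: vset_def)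
  have PQ: "Q' \<inter> P = {}" using j(4) by (intro gpath_edges_disjoint[OF j(3), of _ j]) blast
  have d12: "({f} \<union> P1) \<inter> ({e} \<union> P2) = {}" using d nP p(1,2) by blast
  have d13: "({f} \<union> P1) \<inter> ({g} \<union> Q') = {}" using d nP nQ PQ p(1) by blast
  have d23: "({e} \<union> P2) \<inter> ({g} \<union> Q') = {}" using d nP nQ PQ p(1) by blast
  have "({f} \<union> P1) \<union> ({e} \<union> P2) = C1" using P(2) p(1) by blast
  then have b1: "({f} \<union> P1) \<union> ({e} \<union> P2) \<in> balanced \<Omega>" using C1(1) by simp
  have "cycle \<Omega> (({f} \<union> P1) \<union> ({g} \<union> Q'))"
    using R1 R3 by (intro cycle_of_gpaths[OF _ _ uj d13 i13]) blast+
  \<comment> \<open>This cycle may differ from \<open>C2\<close>, but it uses the same links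
    \<open>f\<close> and \<open>g\<close> at \<open>u\<close>.\<close>
  then have b2: "({f} \<union> P1) \<union> ({g} \<union> Q') \<in> balanced \<Omega>"
    using C2 by (intro balanced_if_shared_links[OF _ C2(1) e(3,4,5,6) d(2)]) simp_all
  have "({e} \<union> P2) \<union> ({g} \<union> Q') \<in> balanced \<Omega>"
    using R1 R2 R3 by (intro theta_third_balanced[OF _ _ _ uj d12 d13 d23 i12 i13 i23 b1 b2]) blast+
  then show ?thesis by (rule bexI[rotated]) simp
qed

end

end

section \<open>Hyperplanes and connectivity\<close>

lemma vset_rename:
  assumes "\<And>e. e \<in> X \<Longrightarrow> ends G' e = f ` ends G e"
  shows "vset G' X = f ` vset G X"
  using assms by (auto simp: vset_def)

lemma conn_rename:
  assumes f: "\<And>e. e \<in> X \<Longrightarrow> ends G' e = f ` ends G e" and c: "conn G X"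
  shows "conn G' X"
proof -
  have "(f x, f y) \<in> (adj G' X)\<^sup>*" if "(x, y) \<in> (adj G X)\<^sup>*" for x y
    using that
  proof induction
    case (step y z)
    then obtain e where "e \<in> X" "ends G e = {y, z}" by (auto simp: adj_def)
    then have "(f y, f z) \<in> adj G' X" using f[of e] unfolding adj_def by auto
    then show ?case using step.IH by (rule rtrancl_into_rtrancl[rotated])
  qed simp
  moreover have "vset G' X = f ` vset G X" using f by (rule vset_rename)
  ultimately show ?thesis using c unfolding conn_adj by auto
qed

lemma deg_rename:
  assumes f: "\<And>e. e \<in> X \<Longrightarrow> ends G' e = f ` ends G e" and i: "inj_on f (vset G X)" and v: "v \<in> vset G X"
  shows "deg G' X (f v) = deg G X v"
proof -
  have s: "ends G e \<subseteq> vset G X" if "e \<in> X" for e using that by (auto simp: vset_def)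
  have "f v \<in> ends G' e \<longleftrightarrow> v \<in> ends G e" if "e \<in> X" for e
    using inj_on_image_mem_iff[OF i v s[OF that]] f[OF that] by simp
  then have "{e \<in> X. f v \<in> ends G' e} = {e \<in> X. v \<in> ends G e}" by blast
  moreover have "ends G' e = {f v} \<longleftrightarrow> ends G e = {v}" if "e \<in> X" for e
    using inj_on_image_eq_iff[OF i s[OF that], of "{v}"] f[OF that] v by simp
  then have "{e \<in> X. ends G' e = {f v}} = {e \<in> X. ends G e = {v}}" by blast
  ultimately show ?thesis by (simp add: deg_def)
qed

lemma cycle_rename:
  assumes f: "\<And>e. e \<in> X \<Longrightarrow> ends G' e = f ` ends G e" and i: "inj_on f (vset G X)"
    and X: "X \<subseteq> edges G'" "cycle G X"
  shows "cycle G' X"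
  unfolding cycle_def
proof (intro conjI ballI)
  show "X \<subseteq> edges G'" by fact
  show "X \<noteq> {}" using X by (simp add: cycle_def)
  show "conn G' X" using X(2) by (intro conn_rename[OF f]) (simp_all add: cycle_def)
  fix w assume "w \<in> vset G' X"
  moreover have "vset G' X = f ` vset G X" using f by (rule vset_rename)
  ultimately obtain v where v: "v \<in> vset G X" "w = f v" by blast
  have "deg G' X (f v) = deg G X v" using f i v(1) by (rule deg_rename)
  then show "deg G' X w = 2" using v X(2) by (simp add: cycle_def)
qed

text \<open>Only the edges of \<open>X\<close> must be renamed by \<open>f\<close>, with
  \<open>f\<close> injective on their ends. This locality matters later, when edges outside
  \<open>X\<close> may lose an end.\<close>

lemma cycle_rename_iff:
  assumes f: "\<And>e. e \<in> X \<Longrightarrow> ends G' e = f ` ends G e" and i: "inj_on f (vset G X)"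
    and X: "X \<subseteq> edges G'" "X \<subseteq> edges G"
  shows "cycle G' X \<longleftrightarrow> cycle G X"
proof
  assume c: "cycle G' X"
  let ?g = "inv_into (vset G X) f"
  show "cycle G X"
  proof (rule cycle_rename[OF _ _ X(2) c])
    have "vset G' X = f ` vset G X" using f by (rule vset_rename)
    then show "inj_on ?g (vset G' X)" by (simp add: inj_on_inv_into)
    show "ends G e = ?g ` ends G' e" if "e \<in> X" for e
    proof -
      have "ends G e \<subseteq> vset G X" using that by (auto simp: vset_def)
      then have "?g ` (f ` ends G e) = ends G e" using i by (rule inv_into_image_cancel[rotated])
      then show ?thesis using f[OF that] by simp
    qed
  qed
qed (rule cycle_rename[OF f i X(1)])

lemma gpath_rename:
  assumes "gpath G x y P" "\<And>e. e \<in> P \<Longrightarrow> ends G' e = f ` ends G e" "inj_on f (insert x (vset G P))"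
    "P \<subseteq> edges G'"
  shows "gpath G' (f x) (f y) P"
  using assms
proof (induction rule: gpath.induct)
  case refl
  show ?case by (rule gpath.refl)
next
  case (step y P e z)
  have sub: "insert x (vset G P) \<subseteq> insert x (vset G (insert e P))" by auto
  have IH: "gpath G' (f x) (f y) P"
    using step.prems by (intro step.IH inj_on_subset[OF step.prems(2) sub]) auto
  have "z \<in> insert x (vset G (insert e P))" using step.hyps(3) by simp
  then have "f z \<notin> f ` insert x (vset G P)"
    using step.hyps(4) inj_on_image_mem_iff[OF step.prems(2) _ sub] by blast
  moreover have "vset G' P = f ` vset G P" using step.prems(1) by (intro vset_rename) simp
  ultimately have "f z \<notin> insert (f x) (vset G' P)" by simp
  moreover have "ends G' e = {f y, f z}" using step.prems(1)[of e] step.hyps(3) by simp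
  ultimately show ?case using step.prems(3) by (intro gpath.step[OF IH]) simp_all
qed

section \<open>From properties of the matroid to properties of the graph\<close>

context
  fixes \<Omega> :: "('v, 'e) bgraph"
  assumes B: "biased_graph \<Omega>"
begin

text \<open>Handcuffs and unbalanced thetas contain unbalanced cycles, so the circuits inside
  \<open>H\<close> are just its cycles. Vertices are mapped injectively to \<open>nat\<close>
  because \<open>graphic\<close> asks for such a graph.\<close>

lemma graphic_of_balanced:
  assumes H: "H \<subseteq> edges \<Omega>" and bal: "\<And>C. cycle \<Omega> C \<Longrightarrow> C \<subseteq> H \<Longrightarrow> C \<in> balanced \<Omega>"
  shows "graphic (restriction (frame_matroid \<Omega>) H)"
proof -
  note gr = biased_graph_graph[OF B]
  have fin: "finite (verts \<Omega>)" "finite (edges \<Omega>)" using gr by (simp_all add: graph_def)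
  obtain g :: "'v \<Rightarrow> nat" where g: "inj_on g (verts \<Omega>)"
    using finite_imp_inj_to_nat_seg[OF fin(1)] by blast
  let ?N = "\<lparr>verts = g ` verts \<Omega>, edges = H, ends = \<lambda>e. g ` ends \<Omega> e\<rparr>"
  have ends: "ends \<Omega> e \<subseteq> verts \<Omega>" "card (ends \<Omega> e) = 1 \<or> card (ends \<Omega> e) = 2" if "e \<in> edges \<Omega>" for e
    using gr that by (simp_all add: graph_def)
  have "card (g ` ends \<Omega> e) = card (ends \<Omega> e)" if "e \<in> H" for e
    using that H ends by (intro card_image inj_on_subset[OF g]) blast
  then have "\<forall>e\<in>H. g ` ends \<Omega> e \<subseteq> g ` verts \<Omega> \<and> (card (g ` ends \<Omega> e) = 1 \<or> card (g ` ends \<Omega> e) = 2)"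
    using ends H by (metis image_mono subsetD)
  then have grN: "graph ?N" using fin H finite_subset[of H "edges \<Omega>"] by (simp add: graph_def)
  have cyc: "cycle ?N C \<longleftrightarrow> cycle \<Omega> C" if "C \<subseteq> H" for C
  proof (rule cycle_rename_iff)
    have "vset \<Omega> C \<subseteq> verts \<Omega>" using that H ends(1) unfolding vset_def by blast
    then show "inj_on g (vset \<Omega> C)" by (rule inj_on_subset[OF g])
  qed (use that H in auto)
  have "cycle ?N C \<longleftrightarrow> C \<in> circuits (frame_matroid \<Omega>) \<and> C \<subseteq> H" for C
  proof
    assume c: "cycle ?N C"
    then have "C \<subseteq> H" by (simp add: cycle_def)
    then have "C \<in> balanced \<Omega>" using c cyc bal by blast
    then show "C \<in> circuits (frame_matroid \<Omega>) \<and> C \<subseteq> H"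
      using \<open>C \<subseteq> H\<close> by (simp add: circuits_frame_matroid)
  next
    assume C: "C \<in> circuits (frame_matroid \<Omega>) \<and> C \<subseteq> H"
    then have CH: "C \<subseteq> H" and Cc: "C \<in> circuits (frame_matroid \<Omega>)" by simp_all
    \<comment> \<open>\<open>unbalanced_theta\<close> speaks about all cycles of a theta without
      exhibiting one; minimum degree two provides one.\<close>
    obtain D where D: "cycle \<Omega> D" "D \<subseteq> C"
      using min_degree_2_cycle[OF gr circuit_edges[OF B Cc] circuit_nonempty[OF B Cc] circuit_deg[OF B Cc]]
      by blast
    have "C \<in> balanced \<Omega>"
      using Cc unfolding circuits_frame_matroid
    proof (elim disjE)
      assume "tight_handcuff \<Omega> C"
      then obtain C1 where "unbalanced_cycle \<Omega> C1" "C1 \<subseteq> C" unfolding tight_handcuff_def by auto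
      then show ?thesis using bal CH by (auto simp: unbalanced_cycle_def)
    next
      assume "loose_handcuff \<Omega> C"
      then obtain C1 where "unbalanced_cycle \<Omega> C1" "C1 \<subseteq> C" unfolding loose_handcuff_def by auto
      then show ?thesis using bal CH by (auto simp: unbalanced_cycle_def)
    next
      assume "unbalanced_theta \<Omega> C"
      then have "D \<notin> balanced \<Omega>" using D unfolding unbalanced_theta_def unbalanced_cycle_def by blast
      then show ?thesis using bal D CH by blast
    qed
    then have "cycle \<Omega> C" by (rule balanced_cycle[OF B])
    then show "cycle ?N C" using cyc[OF CH] by simp
  qed
  then have "{C. cycle ?N C} = {C \<in> circuits (frame_matroid \<Omega>). C \<subseteq> H}" by blast
  then have "cycle_matroid ?N = restriction (frame_matroid \<Omega>) H"
    using H by (simp add: cycle_matroid_def restriction_def Int_absorb1)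
  then show ?thesis unfolding graphic_def using grN by blast
qed

lemma restriction_edges: "restriction (frame_matroid \<Omega>) (edges \<Omega>) = frame_matroid \<Omega>"
proof -
  have "{C \<in> circuits (frame_matroid \<Omega>). C \<subseteq> edges \<Omega>} = circuits (frame_matroid \<Omega>)"
    using circuit_edges[OF B] by blast
  then show ?thesis by (simp add: restriction_def)
qed

lemma unbalanced_cycle_of_nongraphic:
  assumes "H \<subseteq> edges \<Omega>" "\<not> graphic (restriction (frame_matroid \<Omega>) H)"
  obtains C where "unbalanced_cycle \<Omega> C" "C \<subseteq> H"
proof -
  have "\<not> (\<forall>C. cycle \<Omega> C \<and> C \<subseteq> H \<longrightarrow> C \<in> balanced \<Omega>)"
    using graphic_of_balanced[OF assms(1)] assms(2) by blast
  then show ?thesis using that unfolding unbalanced_cycle_def by blast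
qed

text \<open>Any two distinct edges of \<open>H\<close> lie in a common circuit inside
  \<open>H\<close>, and circuits are connected subgraphs.\<close>

lemma conn_of_matroid_connected:
  assumes "H \<subseteq> edges \<Omega>" and c: "matroid_connected (restriction (frame_matroid \<Omega>) H)"
  shows "conn \<Omega> H"
  unfolding conn_adj
proof (intro ballI)
  fix x y assume "x \<in> vset \<Omega> H" "y \<in> vset \<Omega> H"
  then obtain e f where e: "e \<in> H" "x \<in> ends \<Omega> e" and f: "f \<in> H" "y \<in> ends \<Omega> f"
    by (auto simp: vset_def)
  show "(x, y) \<in> (adj \<Omega> H)\<^sup>*"
  proof (cases "e = f")
    case True
    obtain z where "ends \<Omega> e = {x, z}"
      using graph_ends_at[OF biased_graph_graph[OF B], of e x] e assms(1) by blast
    then have "y = x \<or> (x, y) \<in> adj \<Omega> H" using e f True by (auto simp: adj_def)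
    then show ?thesis by auto
  next
    case False
    have "e \<in> ground (restriction (frame_matroid \<Omega>) H)" "f \<in> ground (restriction (frame_matroid \<Omega>) H)"
      using e f assms(1) by (auto simp: restriction_def)
    then obtain C where "C \<in> circuits (restriction (frame_matroid \<Omega>) H)" "e \<in> C" "f \<in> C"
      using c False unfolding matroid_connected_def by blast
    then have C: "C \<in> circuits (frame_matroid \<Omega>)" "C \<subseteq> H" "e \<in> C" "f \<in> C"
      by (simp_all add: restriction_def)
    have "x \<in> vset \<Omega> C" "y \<in> vset \<Omega> C" using C e f by (auto simp: vset_def)
    then have "(x, y) \<in> (adj \<Omega> C)\<^sup>*" using circuit_conn[OF B C(1)] unfolding conn_adj by blast
    then show ?thesis using adj_mono[OF C(2), of \<Omega>] by blast
  qed
qed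

text \<open>Circuits are connected, so each lies wholly inside or wholly outside a component.
  Independent sets of the two sides therefore unite to an independent set, and the ranks add up: a
  1-separation.\<close>

lemma conn_of_n_connected:
  assumes n: "n_connected 3 (frame_matroid \<Omega>)"
  shows "conn \<Omega> (edges \<Omega>)"
proof (rule ccontr)
  let ?E = "edges \<Omega>" and ?F = "frame_matroid \<Omega>"
  note gr = biased_graph_graph[OF B]
  assume "\<not> conn \<Omega> ?E"
  then obtain x y where xy: "x \<in> vset \<Omega> ?E" "y \<in> vset \<Omega> ?E" "(x, y) \<notin> (adj \<Omega> ?E)\<^sup>*"
    unfolding conn_adj by blast
  define A where "A = {a. (x, a) \<in> (adj \<Omega> ?E)\<^sup>*}"
  define X where "X = {e \<in> ?E. ends \<Omega> e \<inter> A \<noteq> {}}"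
  have AI: "b \<in> A" if "a \<in> A" "(a, b) \<in> (adj \<Omega> ?E)\<^sup>*" for a b
    using that unfolding A_def by (auto intro: rtrancl_trans)
  have XE: "X \<subseteq> ?E" by (auto simp: X_def)
  obtain e where e: "e \<in> ?E" "x \<in> ends \<Omega> e" using xy(1) by (auto simp: vset_def)
  have "x \<in> A" by (simp add: A_def)
  then have "e \<in> X" using e by (auto simp: X_def)
  obtain f where f: "f \<in> ?E" "y \<in> ends \<Omega> f" using xy(2) by (auto simp: vset_def)
  have "f \<notin> X"
  proof
    assume "f \<in> X"
    then obtain a where a: "a \<in> ends \<Omega> f" "a \<in> A" by (auto simp: X_def)
    obtain z where z: "ends \<Omega> f = {a, z}" by (rule graph_ends_at[OF gr f(1) a(1)])
    then have "y = a \<or> (a, y) \<in> adj \<Omega> ?E" using f by (auto simp: adj_def)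
    then have "y \<in> A" using AI[OF a(2), of y] a(2) by auto
    then show False using xy(3) by (simp add: A_def)
  qed
  have split: "Y \<subseteq> X \<or> Y \<subseteq> ?E - X" if Y: "Y \<in> circuits ?F" for Y
  proof (rule ccontr)
    assume n: "\<not> ?thesis"
    have YE: "Y \<subseteq> ?E" by (rule circuit_edges[OF B Y])
    then obtain g h where gh: "g \<in> Y" "g \<in> X" "h \<in> Y" "h \<notin> X" using n by blast
    obtain a where a: "a \<in> ends \<Omega> g" "a \<in> A" using gh(2) by (auto simp: X_def)
    obtain b where b: "b \<in> ends \<Omega> h" using graph_ends_nonempty[OF gr, of h] gh(3) YE by blast
    have bA: "b \<notin> A" using b gh(3,4) YE by (auto simp: X_def)
    have "a \<in> vset \<Omega> Y" "b \<in> vset \<Omega> Y" using a b gh by (auto simp: vset_def)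
    then have "(a, b) \<in> (adj \<Omega> Y)\<^sup>*" using circuit_conn[OF B Y] unfolding conn_adj by blast
    then have "(a, b) \<in> (adj \<Omega> ?E)\<^sup>*" using adj_mono[OF YE, of \<Omega>] by blast
    then show False using AI[OF a(2)] bA by blast
  qed
  obtain I1 where I1: "I1 \<subseteq> X" "indep ?F I1" "card I1 = matroid_rank ?F X" by (rule rank_witness[OF B])
  obtain I2 where I2: "I2 \<subseteq> ?E - X" "indep ?F I2" "card I2 = matroid_rank ?F (?E - X)"
    by (rule rank_witness[OF B])
  have fin: "finite ?E" by (rule graph_finite[OF gr subset_refl])
  have "indep ?F (I1 \<union> I2)"
    unfolding indep_frame[OF B]
  proof (intro conjI notI)
    show "I1 \<union> I2 \<subseteq> ?E" using I1(1) I2(1) XE by blast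
    assume "\<exists>Y\<in>circuits ?F. Y \<subseteq> I1 \<union> I2"
    then obtain Y where Y: "Y \<in> circuits ?F" "Y \<subseteq> I1 \<union> I2" by blast
    then have "Y \<subseteq> I1 \<or> Y \<subseteq> I2" using split[OF Y(1)] I1(1) I2(1) by blast
    then show False using Y(1) I1(2) I2(2) by (auto simp: indep_frame[OF B])
  qed
  then have "card (I1 \<union> I2) \<le> matroid_rank ?F ?E" using I1(1) I2(1) XE by (intro rank_ge[OF B]) blast
  moreover have "card (I1 \<union> I2) = card I1 + card I2"
    using I1(1) I2(1) XE fin by (intro card_Un_disjoint) (auto intro: finite_subset)
  moreover have "card X > 0" "card (?E - X) > 0"
    using \<open>e \<in> X\<close> \<open>f \<notin> X\<close> f(1) fin XE by (auto simp: card_gt_0_iff intro: finite_subset)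
  ultimately have "k_separation ?F 1 X" using I1(3) I2(3) XE by (simp add: k_separation_def)
  then show False using n unfolding n_connected_def by force
qed

text \<open>Both \<open>H\<close> and the whole edge set are connected and contain \<open>C\<close>,
  so their ranks count vertices and \<open>H\<close> misses exactly one vertex \<open>x\<close>. An
  edge not at \<open>x\<close> has its ends among the vertices of \<open>H\<close> and would not
  raise the rank; flatness puts it into \<open>H\<close>.\<close>

lemma hyperplane_complement_star:
  assumes E: "conn \<Omega> (edges \<Omega>)" and H: "hyperplane (frame_matroid \<Omega>) H" "conn \<Omega> H"
    and C: "unbalanced_cycle \<Omega> C" "C \<subseteq> H"
  obtains x where "x \<in> vset \<Omega> (edges \<Omega>)" "H = edges \<Omega> - star \<Omega> x"
    "vset \<Omega> H = vset \<Omega> (edges \<Omega>) - {x}"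
proof -
  let ?E = "edges \<Omega>" and ?F = "frame_matroid \<Omega>"
  note gr = biased_graph_graph[OF B]
  have HE: "H \<subseteq> ?E" and flat: "\<And>e. e \<in> ?E - H \<Longrightarrow> matroid_rank ?F H < matroid_rank ?F (insert e H)"
    and r: "matroid_rank ?F H + 1 = matroid_rank ?F ?E"
    using H(1) by (auto simp: hyperplane_def flat_def)
  have rH: "matroid_rank ?F H = card (vset \<Omega> H)"
    by (rule rank_connected_unbalanced[OF B HE H(2) C])
  have rE: "matroid_rank ?F ?E = card (vset \<Omega> ?E)"
    using C HE by (intro rank_connected_unbalanced[OF B subset_refl E C(1)]) blast
  have V: "vset \<Omega> H \<subseteq> vset \<Omega> ?E" by (rule vset_mono[OF HE])
  have fin: "finite (vset \<Omega> H)" using graph_finite_vset[OF gr HE] .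
  then have "card (vset \<Omega> ?E - vset \<Omega> H) = 1"
    using card_Diff_subset[OF fin V] r rH rE by simp
  then obtain x where x: "vset \<Omega> ?E - vset \<Omega> H = {x}" by (auto simp: card_1_singleton_iff)
  have xE: "x \<in> vset \<Omega> ?E" "x \<notin> vset \<Omega> H" using x by auto
  have VH: "vset \<Omega> H = vset \<Omega> ?E - {x}" using x V by auto
  have "e \<in> H" if e: "e \<in> ?E" "x \<notin> ends \<Omega> e" for e
  proof (rule ccontr)
    assume "e \<notin> H"
    then have "matroid_rank ?F H < matroid_rank ?F (insert e H)" using flat e by blast
    moreover have "ends \<Omega> e \<subseteq> vset \<Omega> H" unfolding VH using e by (auto simp: vset_def)
    then have "vset \<Omega> (insert e H) = vset \<Omega> H" by auto
    ultimately show False using rank_le_vset[OF B, of "insert e H"] HE e rH by simp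
  qed
  moreover have "x \<notin> ends \<Omega> e" if "e \<in> H" for e using that xE(2) by (auto simp: vset_def)
  ultimately have "H = ?E - star \<Omega> x" using HE by (auto simp: star_def)
  then show ?thesis using that xE(1) VH by blast
qed

text \<open>If \<open>A\<close> is a component of \<open>\<Omega> - u\<close>, the edges meeting \<open>A\<close> have rank at most \<open>card A + 1\<close>, and their
  complement has rank at most \<open>card V - card A\<close>: a 2-separation.\<close>

lemma conn_minus_vertex:
  assumes n: "n_connected 3 (frame_matroid \<Omega>)"
    and r: "matroid_rank (frame_matroid \<Omega>) (edges \<Omega>) = card (vset \<Omega> (edges \<Omega>))"
    and v: "v \<in> vset \<Omega> (edges \<Omega>)" "v \<noteq> u" "w \<in> vset \<Omega> (edges \<Omega>)" "w \<noteq> u" "u \<in> vset \<Omega> (edges \<Omega>)"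
  shows "(v, w) \<in> (adj \<Omega> (edges \<Omega> - star \<Omega> u))\<^sup>*"
proof (rule ccontr)
  let ?E = "edges \<Omega>" and ?F = "frame_matroid \<Omega>" and ?V = "vset \<Omega> (edges \<Omega>)"
  let ?r = "(adj \<Omega> (edges \<Omega> - star \<Omega> u))\<^sup>*"
  note gr = biased_graph_graph[OF B]
  assume vw: "(v, w) \<notin> ?r"
  define A where "A = {a. (v, a) \<in> ?r}"
  define X where "X = {e \<in> ?E. ends \<Omega> e \<inter> A \<noteq> {}}"
  have finV: "finite ?V" by (rule graph_finite_vset[OF gr subset_refl])
  have finE: "finite ?E" by (rule graph_finite[OF gr subset_refl])
  have "a \<noteq> u \<and> a \<in> ?V" if "(v, a) \<in> ?r" for a
    using that
  proof induction
    case base show ?case using v by simp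
  next
    case (step y z)
    then obtain e where "e \<in> ?E - star \<Omega> u" "ends \<Omega> e = {y, z}" by (auto simp: adj_def)
    then show ?case by (auto simp: star_def vset_def)
  qed
  then have A: "A \<subseteq> ?V - {u}" by (auto simp: A_def)
  have wA: "w \<notin> A" using vw by (simp add: A_def)
  have vA: "v \<in> A" by (simp add: A_def)
  have next_A: "b \<in> A \<or> b = u" if t: "e \<in> ?E" "a \<in> ends \<Omega> e" "a \<in> A" "b \<in> ends \<Omega> e" for e a b
  proof (rule ccontr)
    assume nb: "\<not> ?thesis"
    obtain z where z: "ends \<Omega> e = {a, z}" by (rule graph_ends_at[OF gr t(1,2)])
    have "a \<noteq> u" using t(3) A by blast
    have "b = z" using z nb t by auto
    then have "e \<in> ?E - star \<Omega> u" using t(1) z nb \<open>a \<noteq> u\<close> by (auto simp: star_def)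
    then have "(a, b) \<in> adj \<Omega> (?E - star \<Omega> u)" using z \<open>b = z\<close> by (auto simp: adj_def)
    then have "b \<in> A" using t(3) unfolding A_def by (auto intro: rtrancl_into_rtrancl)
    then show False using nb by blast
  qed
  have XE: "X \<subseteq> ?E" by (auto simp: X_def)
  have VX: "vset \<Omega> X \<subseteq> insert u A" using next_A by (fastforce simp: X_def vset_def)
  have VY: "vset \<Omega> (?E - X) \<subseteq> ?V - A" by (auto simp: X_def vset_def)
  have finA: "finite A" using A finV finite_subset by blast
  have uA: "u \<notin> A" using A by blast
  have "card (insert u A) = card A + 1" using finA uA by simp
  then have cX: "card (vset \<Omega> X) \<le> card A + 1" using card_mono[OF _ VX] finA by simp
  have "card (vset \<Omega> (?E - X)) \<le> card (?V - A)" using VY finV by (intro card_mono) auto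
  also have "\<dots> = card ?V - card A" using A finA by (intro card_Diff_subset) auto
  finally have cY: "card (vset \<Omega> (?E - X)) \<le> card ?V - card A" .
  \<comment> \<open>Both \<open>u\<close> and \<open>w\<close> lie outside \<open>A\<close>. The
    resulting bound is what settles the case of a one-edge complement of \<open>X\<close>.\<close>
  have "card (insert u (insert w A)) = card A + 2" using finA uA wA v by simp
  moreover have "insert u (insert w A) \<subseteq> ?V" using A v by blast
  ultimately have AV: "card A + 2 \<le> card ?V" using card_mono[OF finV] by metis
  have A1: "1 \<le> card A" using vA finA by (simp add: Suc_le_eq card_gt_0_iff) blast
  have rX: "matroid_rank ?F X \<le> card A + 1" using rank_le_vset[OF B XE] cX by simp
  have rY: "matroid_rank ?F (?E - X) \<le> card ?V - card A"
    using rank_le_vset[OF B, of "?E - X"] cY by auto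
  obtain e where "e \<in> ?E" "v \<in> ends \<Omega> e" using v(1) by (auto simp: vset_def)
  then have "e \<in> X" using vA by (auto simp: X_def)
  then have X1: "1 \<le> card X" using finE XE by (simp add: Suc_le_eq card_gt_0_iff) (auto intro: finite_subset)
  obtain f where f: "f \<in> ?E" "w \<in> ends \<Omega> f" using v(3) by (auto simp: vset_def)
  then have "f \<notin> X" using next_A[OF f(1) _ _ f(2)] wA v(4) by (auto simp: X_def)
  then have Y1: "1 \<le> card (?E - X)" using finE f by (simp add: Suc_le_eq card_gt_0_iff) auto
  have lX: "matroid_rank ?F X \<le> card X" using XE finE by (intro rank_le_card[OF B]) (auto intro: finite_subset)
  have lY: "matroid_rank ?F (?E - X) \<le> card (?E - X)" using finE by (intro rank_le_card[OF B]) auto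
  have no: "\<not> k_separation ?F 1 X" "\<not> k_separation ?F 2 X"
    using n unfolding n_connected_def by force+
  show False
  proof (cases "2 \<le> card X \<and> 2 \<le> card (?E - X)")
    case True
    then have "k_separation ?F 2 X" using rX rY AV XE r by (simp add: k_separation_def)
    then show False using no by simp
  next
    case False
    \<comment> \<open>A 2-separation needs two elements on each side. A single edge has rank at most
      one, which sharpens the bound enough for a 1-separation.\<close>
    then have "card X = 1 \<or> card (?E - X) = 1" using X1 Y1 by linarith
    then have "matroid_rank ?F X + matroid_rank ?F (?E - X) < card ?V + 1"
      using rX rY lX lY AV A1 by linarith
    then have "k_separation ?F 1 X" using X1 Y1 XE r by (simp add: k_separation_def)
    then show False using no by simp
  qed
qed

end

section \<open>Roll-ups\<close>

text \<open>Deleting \<open>u\<close> removes exactly the edges at \<open>u\<close> and keeps all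
  other incidences, so the cycles of the smaller graph are the cycles missing
  \<open>u\<close>.\<close>

lemma balancing_iff:
  "balancing \<Omega> u \<longleftrightarrow> u \<in> verts \<Omega> \<and> (\<forall>C. cycle \<Omega> C \<and> u \<notin> vset \<Omega> C \<longrightarrow> C \<in> balanced \<Omega>)"
proof -
  have "cycle (delete_vertex \<Omega> u) C \<longleftrightarrow> cycle \<Omega> C \<and> u \<notin> vset \<Omega> C" for C
  proof -
    have "C \<subseteq> edges \<Omega> - star \<Omega> u \<longleftrightarrow> C \<subseteq> edges \<Omega> \<and> u \<notin> vset \<Omega> C"
      by (auto simp: star_def vset_def)
    then show ?thesis
      by (auto simp: cycle_def delete_vertex_def conn_def deg_def vset_def)
  qed
  then show ?thesis by (simp add: balancing_def)
qed

lemma links_at_iff: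
  assumes "graph \<Omega>"
  shows "e \<in> links_at \<Omega> u \<longleftrightarrow> e \<in> edges \<Omega> \<and> (\<exists>v. ends \<Omega> e = {u, v} \<and> v \<noteq> u)"
proof
  assume "e \<in> links_at \<Omega> u"
  then have e: "e \<in> edges \<Omega>" "u \<in> ends \<Omega> e" "card (ends \<Omega> e) = 2"
    by (simp_all add: links_at_def star_def is_link_def)
  obtain v where v: "ends \<Omega> e = {u, v}" by (rule graph_ends_at[OF assms e(1,2)])
  then show "e \<in> edges \<Omega> \<and> (\<exists>v. ends \<Omega> e = {u, v} \<and> v \<noteq> u)"
    using e by (intro conjI exI[of _ v]) auto
next
  assume "e \<in> edges \<Omega> \<and> (\<exists>v. ends \<Omega> e = {u, v} \<and> v \<noteq> u)"
  then show "e \<in> links_at \<Omega> u" by (auto simp: links_at_def star_def is_link_def)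
qed

context
  fixes \<Omega> :: "('v, 'e) bgraph" and u :: 'v
  assumes B: "biased_graph \<Omega>" and bal: "balancing \<Omega> u"
begin

lemma balanced_avoiding: "cycle \<Omega> C \<Longrightarrow> u \<notin> vset \<Omega> C \<Longrightarrow> C \<in> balanced \<Omega>"
  using bal by (simp add: balancing_iff)

text \<open>A loop at any other vertex is a cycle avoiding \<open>u\<close>, hence balanced.\<close>

lemma unbalanced_loop_ends: "e \<in> unbalanced_loops \<Omega> \<Longrightarrow> e \<in> edges \<Omega> \<and> ends \<Omega> e = {u} \<and> {e} \<notin> balanced \<Omega>"
proof -
  assume "e \<in> unbalanced_loops \<Omega>"
  then have e: "e \<in> edges \<Omega>" "card (ends \<Omega> e) = 1" "{e} \<notin> balanced \<Omega>"
    by (simp_all add: unbalanced_loops_def is_loop_def)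
  obtain a where a: "ends \<Omega> e = {a}" using e(2) by (auto simp: card_1_singleton_iff)
  have "cycle \<Omega> {e}" by (rule loop_cycle[OF biased_graph_graph[OF B] e(1) a])
  then have "u \<in> vset \<Omega> {e}" using balanced_avoiding e(3) by blast
  then show ?thesis using e a by simp
qed

lemma balanced_disjoint_unbalanced_loops: "C \<in> balanced \<Omega> \<Longrightarrow> C \<inter> unbalanced_loops \<Omega> = {}"
proof (rule ccontr)
  assume C: "C \<in> balanced \<Omega>" and "C \<inter> unbalanced_loops \<Omega> \<noteq> {}"
  then obtain e where e: "e \<in> C" "e \<in> unbalanced_loops \<Omega>" by blast
  note l = unbalanced_loop_ends[OF e(2)]
  have "C = {e}"
    using cycle_with_loop[OF biased_graph_graph[OF B] balanced_cycle[OF B C] e(1)] l by blast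
  then show False using C l by simp
qed

text \<open>A balanced cycle containing a loop is that loop, so no unbalanced loop lies in one.
  Deleting these loops changes neither the links at \<open>u\<close> nor the balanced
  cycles.\<close>

lemma roll_classes_self:
  "roll_classes \<Omega> u = insert (unbalanced_loops \<Omega>) (links_at \<Omega> u // unbalancing_rel \<Omega> u)"
proof -
  let ?D = "delete_edges \<Omega> (unbalanced_loops \<Omega>)"
  have nl: "e \<notin> unbalanced_loops \<Omega>" if "e \<in> links_at \<Omega> u" for e
    using that by (auto simp: links_at_def is_link_def unbalanced_loops_def is_loop_def)
  have "links_at ?D u = links_at \<Omega> u - unbalanced_loops \<Omega>"
    by (auto simp: links_at_def delete_edges_def star_def is_link_def)
  then have l: "links_at ?D u = links_at \<Omega> u" using nl by blast
  have "balanced ?D = balanced \<Omega>"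
    using balanced_disjoint_unbalanced_loops by (auto simp: delete_edges_def)
  with l have "unbalancing_rel ?D u = unbalancing_rel \<Omega> u" by (simp add: unbalancing_rel_def)
  with l show ?thesis by (simp add: roll_classes_def unbalancing_classes_def)
qed

lemma balancing_delete_loops: "balancing (delete_edges \<Omega> (unbalanced_loops \<Omega>)) u"
proof -
  let ?D = "delete_edges \<Omega> (unbalanced_loops \<Omega>)"
  have c: "cycle \<Omega> C" "vset \<Omega> C = vset ?D C" if "cycle ?D C" for C
    using that by (auto simp: cycle_def delete_edges_def conn_def deg_def vset_def)
  have "C \<in> balanced ?D" if C: "cycle ?D C" "u \<notin> vset ?D C" for C
  proof -
    have "C \<in> balanced \<Omega>" using balanced_avoiding[OF c(1)[OF C(1)]] c(2)[OF C(1)] C(2) by simp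
    then show ?thesis using balanced_disjoint_unbalanced_loops by (simp add: delete_edges_def)
  qed
  moreover have "u \<in> verts ?D" using bal by (simp add: balancing_def delete_edges_def)
  ultimately show ?thesis unfolding balancing_iff by blast
qed

lemma cycle_links_at:
  assumes C: "cycle \<Omega> C" and e: "e \<in> C" "e \<in> links_at \<Omega> u"
  obtains f where "f \<in> C" "f \<noteq> e" "f \<in> links_at \<Omega> u" "{h \<in> C. u \<in> ends \<Omega> h} = {e, f}"
proof -
  note gr = biased_graph_graph[OF B]
  obtain v where v: "ends \<Omega> e = {u, v}" "v \<noteq> u" using e(2) by (auto simp: links_at_iff[OF gr])
  obtain f w P where f: "f \<in> C" "f \<noteq> e" "ends \<Omega> f = {u, w}" "w \<noteq> u" "gpath \<Omega> v w P"
    "C = insert e (insert f P)" "u \<notin> insert v (vset \<Omega> P)"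
    by (rule cycle_at_link[OF B C e(1) v])
  have "f \<in> edges \<Omega>" using C f(1) by (auto simp: cycle_def)
  then have "f \<in> links_at \<Omega> u" using f(3,4) by (auto simp: links_at_iff[OF gr])
  moreover have "u \<notin> ends \<Omega> h" if "h \<in> P" for h using f(7) that by (auto simp: vset_def)
  then have "{h \<in> C. u \<in> ends \<Omega> h} = {e, f}" using v(1) f(3) unfolding f(6) by auto
  ultimately show ?thesis using that f(1,2) by blast
qed

text \<open>With symmetry, and reflexivity on links, this makes the unbalancing classes a partition.
  Coincidences among the three links are split off because the theta argument needs them
  distinct.\<close>

lemma unbalancing_rel_trans:
  assumes "(e, f) \<in> unbalancing_rel \<Omega> u" "(f, g) \<in> unbalancing_rel \<Omega> u"
  shows "(e, g) \<in> unbalancing_rel \<Omega> u"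
proof (cases "e = f \<or> f = g \<or> e = g")
  case True
  then show ?thesis using assms by (auto simp: unbalancing_rel_def)
next
  case False
  then have d: "e \<noteq> f" "f \<noteq> g" "e \<noteq> g" by simp_all
  have l: "e \<in> links_at \<Omega> u" "f \<in> links_at \<Omega> u" "g \<in> links_at \<Omega> u"
    using assms by (simp_all add: unbalancing_rel_def)
  obtain C1 where C1: "C1 \<in> balanced \<Omega>" "e \<in> C1" "f \<in> C1"
    using assms(1) d(1) by (auto simp: unbalancing_rel_def)
  obtain C2 where C2: "C2 \<in> balanced \<Omega>" "f \<in> C2" "g \<in> C2"
    using assms(2) d(2) by (auto simp: unbalancing_rel_def)
  obtain xe xf xg where x: "ends \<Omega> e = {u, xe}" "xe \<noteq> u" "ends \<Omega> f = {u, xf}" "xf \<noteq> u"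
    "ends \<Omega> g = {u, xg}" "xg \<noteq> u"
    using l unfolding links_at_iff[OF biased_graph_graph[OF B]] by (elim exE conjE) (rule that; assumption)
  have "\<exists>C\<in>balanced \<Omega>. e \<in> C \<and> g \<in> C"
    by (rule balanced_links_trans[OF B _ C1 C2 x d]) (rule balanced_avoiding)
  then show ?thesis using l by (simp add: unbalancing_rel_def)
qed

lemma unbalancing_rel_sym: "(e, f) \<in> unbalancing_rel \<Omega> u \<Longrightarrow> (f, e) \<in> unbalancing_rel \<Omega> u"
  by (auto simp: unbalancing_rel_def)

text \<open>A cycle through \<open>u\<close> that is not a loop has exactly two edges
  \<open>e\<close> and \<open>f\<close> at \<open>u\<close>, both links. Even intersections with all
  classes mean that these are related, and a balanced cycle through both passes its balance to every
  other cycle through both.\<close>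

lemma balanced_iff_even:
  "C \<in> balanced \<Omega> \<longleftrightarrow> cycle \<Omega> C \<and> (\<forall>S\<in>roll_classes \<Omega> u. even (card (C \<inter> S)))"
proof
  assume C: "C \<in> balanced \<Omega>"
  have cyc: "cycle \<Omega> C" by (rule balanced_cycle[OF B C])
  have "even (card (C \<inter> S))" if SQ: "S \<in> links_at \<Omega> u // unbalancing_rel \<Omega> u" for S
  proof (cases "\<exists>e\<in>C. e \<in> links_at \<Omega> u")
    case False
    obtain g where "S = unbalancing_rel \<Omega> u `` {g}" using SQ unfolding quotient_def by blast
    then have "S \<subseteq> links_at \<Omega> u" by (auto simp: unbalancing_rel_def)
    then have "C \<inter> S = {}" using False by blast
    then show ?thesis by simp
  next
    case True
    then obtain e where e: "e \<in> C" "e \<in> links_at \<Omega> u" by blast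
    obtain f where f: "f \<in> C" "f \<noteq> e" "f \<in> links_at \<Omega> u" "{h \<in> C. u \<in> ends \<Omega> h} = {e, f}"
      by (rule cycle_links_at[OF cyc e])
    obtain g where S: "S = unbalancing_rel \<Omega> u `` {g}" using SQ unfolding quotient_def by blast
    have ef: "(e, f) \<in> unbalancing_rel \<Omega> u" using C e f by (auto simp: unbalancing_rel_def)
    have "e \<in> S \<longleftrightarrow> f \<in> S"
      unfolding S Image_singleton_iff
      using unbalancing_rel_trans ef unbalancing_rel_sym[OF ef] by blast
    moreover have "C \<inter> S \<subseteq> {h \<in> C. u \<in> ends \<Omega> h}"
      unfolding S by (auto simp: unbalancing_rel_def links_at_def star_def)
    then have "C \<inter> S \<subseteq> {e, f}" unfolding f(4) .
    ultimately have "C \<inter> S = {} \<or> C \<inter> S = {e, f}" using e f by blast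
    then show ?thesis using f(2) by auto
  qed
  then show "cycle \<Omega> C \<and> (\<forall>S\<in>roll_classes \<Omega> u. even (card (C \<inter> S)))"
    unfolding roll_classes_self using cyc balanced_disjoint_unbalanced_loops[OF C] by simp
next
  note gr = biased_graph_graph[OF B]
  assume a: "cycle \<Omega> C \<and> (\<forall>S\<in>roll_classes \<Omega> u. even (card (C \<inter> S)))"
  then have cyc: "cycle \<Omega> C" and U: "even (card (C \<inter> unbalanced_loops \<Omega>))"
    and S: "\<And>S. S \<in> links_at \<Omega> u // unbalancing_rel \<Omega> u \<Longrightarrow> even (card (C \<inter> S))"
    unfolding roll_classes_self by simp_all
  have CE: "C \<subseteq> edges \<Omega>" using cyc by (simp add: cycle_def)
  \<comment> \<open>A cycle avoiding \<open>u\<close> is balanced outright, one through links at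
    \<open>u\<close> is decided by their classes, and a loop at \<open>u\<close> by its parity with
    respect to the set of unbalanced loops.\<close>
  consider "u \<notin> vset \<Omega> C" | e where "e \<in> C" "e \<in> links_at \<Omega> u" | e where "e \<in> C" "ends \<Omega> e = {u}"
  proof (cases "u \<in> vset \<Omega> C")
    case True
    then obtain e where e: "e \<in> C" "u \<in> ends \<Omega> e" by (auto simp: vset_def)
    obtain v where v: "ends \<Omega> e = {u, v}" using graph_ends_at[OF gr, of e u] e CE by blast
    show ?thesis
    proof (cases "v = u")
      case True
      then show ?thesis using that(3) e v by simp
    next
      case False
      then show ?thesis using that(2) e v CE by (auto simp: links_at_iff[OF gr])
    qed
  qed (rule that(1))
  then show "C \<in> balanced \<Omega>"
  proof cases
    case 1
    then show ?thesis by (rule balanced_avoiding[OF cyc])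
  next
    case (2 e)
    obtain f where f: "f \<in> C" "f \<noteq> e" "f \<in> links_at \<Omega> u" "{h \<in> C. u \<in> ends \<Omega> h} = {e, f}"
      by (rule cycle_links_at[OF cyc 2])
    \<comment> \<open>The class of \<open>e\<close> contains \<open>e\<close> and no edge of
      \<open>C\<close> other than \<open>e\<close> and \<open>f\<close>, so parity brings in
      \<open>f\<close>.\<close>
    let ?S = "unbalancing_rel \<Omega> u `` {e}"
    have "even (card (C \<inter> ?S))" by (rule S[OF quotientI[OF 2(2)]])
    moreover have "C \<inter> ?S \<subseteq> {h \<in> C. u \<in> ends \<Omega> h}"
      by (auto simp: unbalancing_rel_def links_at_def star_def)
    then have "C \<inter> ?S \<subseteq> {e, f}" unfolding f(4) .
    moreover have "e \<in> C \<inter> ?S" using 2 by (auto simp: unbalancing_rel_def)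
    ultimately have "f \<in> ?S"
    proof -
      assume ev: "even (card (C \<inter> ?S))" and i: "C \<inter> ?S \<subseteq> {e, f}" "e \<in> C \<inter> ?S"
      show ?thesis
      proof (rule ccontr)
        assume "f \<notin> ?S"
        then have "C \<inter> ?S = {e}" using i by blast
        then show False using ev by simp
      qed
    qed
    then obtain D where D: "D \<in> balanced \<Omega>" "e \<in> D" "f \<in> D"
      using f(2) by (auto simp: unbalancing_rel_def)
    obtain v w where v: "ends \<Omega> e = {u, v}" "v \<noteq> u" "ends \<Omega> f = {u, w}" "w \<noteq> u"
      using 2(2) f(3) unfolding links_at_iff[OF gr] by (elim exE conjE) (rule that; assumption)
    show ?thesis
      by (rule balanced_if_shared_links[OF B _ cyc D(1) v f(2)[symmetric] 2(1) f(1) D(2,3)])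
        (rule balanced_avoiding)
  next
    case (3 e)
    have Ce: "C = {e}" by (rule cycle_with_loop[OF gr cyc 3])
    show ?thesis
    proof (rule ccontr)
      assume "C \<notin> balanced \<Omega>"
      then have "e \<in> unbalanced_loops \<Omega>"
        using 3 CE Ce by (auto simp: unbalanced_loops_def is_loop_def)
      then show False using U Ce by simp
    qed
  qed
qed

text \<open>The unbalanced loops already sit at \<open>u\<close>, so inserting \<open>u\<close> into
  their ends does nothing, and the parity rule returns the given balanced cycles.\<close>

lemma unroll_self: "unroll \<Omega> u = \<Omega>"
proof -
  have "(\<lambda>e. if e \<in> unbalanced_loops \<Omega> then insert u (ends \<Omega> e) else ends \<Omega> e) = ends \<Omega>"
    by (rule ext) (simp add: unbalanced_loop_ends)
  then have "unroll \<Omega> u = \<Omega>\<lparr>balanced := {C. cycle \<Omega> C \<and> (\<forall>S\<in>roll_classes \<Omega> u. even (card (C \<inter> S)))}\<rparr>"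
    by (simp add: unroll_def Let_def)
  also have "{C. cycle \<Omega> C \<and> (\<forall>S\<in>roll_classes \<Omega> u. even (card (C \<inter> S)))} = balanced \<Omega>"
    using balanced_iff_even by blast
  finally show ?thesis by simp
qed

lemma is_roll_up_ofI:
  assumes "vertex_renaming \<Omega> \<Omega>' \<or>
    (\<exists>e\<in>links_at \<Omega> u. vertex_renaming (roll \<Omega> u (unbalancing_rel \<Omega> u `` {e})) \<Omega>')"
  shows "is_roll_up_of \<Omega>' \<Omega>"
proof -
  have fam: "roll_family \<Omega> u = insert \<Omega> (roll \<Omega> u ` roll_classes \<Omega> u)"
    by (simp add: roll_family_def unroll_self)
  have "\<exists>\<Psi>\<in>roll_family \<Omega> u. vertex_renaming \<Psi> \<Omega>'"
    using assms
  proof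
    assume "\<exists>e\<in>links_at \<Omega> u. vertex_renaming (roll \<Omega> u (unbalancing_rel \<Omega> u `` {e})) \<Omega>'"
    then obtain e where e: "e \<in> links_at \<Omega> u"
      "vertex_renaming (roll \<Omega> u (unbalancing_rel \<Omega> u `` {e})) \<Omega>'" by blast
    have "unbalancing_rel \<Omega> u `` {e} \<in> roll_classes \<Omega> u"
      unfolding roll_classes_self using quotientI[OF e(1)] by blast
    then show ?thesis unfolding fam using e(2) by blast
  qed (use fam in blast)
  moreover have "\<Omega> \<in> roll_family \<Omega> u" unfolding fam by blast
  ultimately show ?thesis
    unfolding is_roll_up_of_def using B balancing_delete_loops by blast
qed

end

section \<open>Two biased graphs with the same frame matroid\<close>

lemma unbalanced_cycle_exists:
  assumes B: "biased_graph \<Omega>" and n: "\<not> graphic (frame_matroid \<Omega>)"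
  obtains C where "unbalanced_cycle \<Omega> C" "C \<subseteq> edges \<Omega>"
  by (rule unbalanced_cycle_of_nongraphic[OF B subset_refl]) (use n restriction_edges[OF B] in auto)

text \<open>The conditions in \<open>committed\<close> concern only the matroid and an edge set, so
  they can be read in \<open>\<Omega>'\<close>. The last conclusion is for use with
  \<open>\<Omega>' = \<Omega>\<close>, where it shows that different committed vertices have
  different stars.\<close>

lemma committed_star:
  assumes B: "biased_graph \<Omega>" and B': "biased_graph \<Omega>'" and F: "frame_matroid \<Omega>' = frame_matroid \<Omega>"
    and n: "n_connected 3 (frame_matroid \<Omega>)" and c: "committed \<Omega> v"
  obtains x where "x \<in> vset \<Omega>' (edges \<Omega>)" "star \<Omega>' x = star \<Omega> v"
    "vset \<Omega>' (edges \<Omega> - star \<Omega> v) = vset \<Omega>' (edges \<Omega>) - {x}"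
proof -
  have EE: "edges \<Omega>' = edges \<Omega>"
    using arg_cong[OF F, of ground] by simp
  let ?H = "edges \<Omega> - star \<Omega> v"
  have H: "hyperplane (frame_matroid \<Omega>') ?H"
    "matroid_connected (restriction (frame_matroid \<Omega>') ?H)"
    "\<not> graphic (restriction (frame_matroid \<Omega>') ?H)"
    using c unfolding committed_def F by simp_all
  have HE: "?H \<subseteq> edges \<Omega>'" unfolding EE by blast
  obtain C where C: "unbalanced_cycle \<Omega>' C" "C \<subseteq> ?H"
    by (rule unbalanced_cycle_of_nongraphic[OF B' HE H(3)])
  have "conn \<Omega>' (edges \<Omega>')" using n unfolding F[symmetric] by (rule conn_of_n_connected[OF B'])
  then obtain x where x: "x \<in> vset \<Omega>' (edges \<Omega>')" "?H = edges \<Omega>' - star \<Omega>' x"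
    "vset \<Omega>' ?H = vset \<Omega>' (edges \<Omega>') - {x}"
    by (rule hyperplane_complement_star[OF B' _ H(1) conn_of_matroid_connected[OF B' HE H(2)] C])
  have "star \<Omega>' x = star \<Omega> v"
  proof -
    have "star \<Omega>' x \<subseteq> edges \<Omega>" "star \<Omega> v \<subseteq> edges \<Omega>" using EE by (auto simp: star_def)
    then show ?thesis using x(2) unfolding EE by blast
  qed
  then show ?thesis using that[of x] x(1,3) unfolding EE by simp
qed

context
  fixes \<Omega> :: "('v, 'e) bgraph" and u :: 'v and \<Omega>' :: "('w, 'e) bgraph"
  assumes B: "biased_graph \<Omega>" and bal: "balancing \<Omega> u"
    and n3: "n_connected 3 (frame_matroid \<Omega>)" and ng: "\<not> graphic (frame_matroid \<Omega>)"
    and com: "\<And>v. v \<in> verts \<Omega> - {u} \<Longrightarrow> committed \<Omega> v"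
    and B': "biased_graph \<Omega>'" and F: "frame_matroid \<Omega>' = frame_matroid \<Omega>"
begin

lemma edges_eq: "edges \<Omega>' = edges \<Omega>"
  using arg_cong[OF F, of ground] by simp

lemma rank_eq_card:
  "matroid_rank (frame_matroid \<Omega>) (edges \<Omega>) = card (vset \<Omega> (edges \<Omega>))"
  "matroid_rank (frame_matroid \<Omega>) (edges \<Omega>) = card (vset \<Omega>' (edges \<Omega>))"
proof -
  obtain C where C: "unbalanced_cycle \<Omega> C" "C \<subseteq> edges \<Omega>"
    by (rule unbalanced_cycle_exists[OF B ng])
  show "matroid_rank (frame_matroid \<Omega>) (edges \<Omega>) = card (vset \<Omega> (edges \<Omega>))"
    by (rule rank_connected_unbalanced[OF B subset_refl conn_of_n_connected[OF B n3] C])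
  have ng': "\<not> graphic (frame_matroid \<Omega>')" and n3': "n_connected 3 (frame_matroid \<Omega>')"
    using ng n3 F by simp_all
  obtain C' where C': "unbalanced_cycle \<Omega>' C'" "C' \<subseteq> edges \<Omega>'"
    by (rule unbalanced_cycle_exists[OF B' ng'])
  have "matroid_rank (frame_matroid \<Omega>') (edges \<Omega>') = card (vset \<Omega>' (edges \<Omega>'))"
    by (rule rank_connected_unbalanced[OF B' subset_refl conn_of_n_connected[OF B' n3'] C'])
  then show "matroid_rank (frame_matroid \<Omega>) (edges \<Omega>) = card (vset \<Omega>' (edges \<Omega>))"
    unfolding F edges_eq .
qed

text \<open>\<open>committed_star\<close> is applied to \<open>\<Omega>\<close> itself. The vertex
  \<open>x\<close> it yields has a nonempty star equal to that of \<open>v\<close>, so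
  \<open>v\<close> is not isolated; as deleting its star uncovers \<open>v\<close>, it must be
  \<open>x\<close>.\<close>

lemma vset_committed:
  assumes v: "v \<in> verts \<Omega> - {u}"
  shows "v \<in> vset \<Omega> (edges \<Omega>)" "vset \<Omega> (edges \<Omega> - star \<Omega> v) = vset \<Omega> (edges \<Omega>) - {v}"
proof -
  obtain x where x: "x \<in> vset \<Omega> (edges \<Omega>)" "star \<Omega> x = star \<Omega> v"
    "vset \<Omega> (edges \<Omega> - star \<Omega> v) = vset \<Omega> (edges \<Omega>) - {x}"
    by (rule committed_star[OF B B HOL.refl n3 com[OF v]])
  have "star \<Omega> v \<noteq> {}" using x(1) unfolding x(2)[symmetric] by (auto simp: vset_def star_def)
  then show vE: "v \<in> vset \<Omega> (edges \<Omega>)" by (auto simp: star_def vset_def)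
  have "v \<notin> vset \<Omega> (edges \<Omega> - star \<Omega> v)" by (auto simp: star_def vset_def)
  then have "v = x" unfolding x(3) using vE by blast
  then show "vset \<Omega> (edges \<Omega> - star \<Omega> v) = vset \<Omega> (edges \<Omega>) - {v}" using x(3) by simp
qed

text \<open>A balancing vertex lies on every unbalanced cycle, and there is one, so \<open>u\<close>
  is not isolated; the other vertices are committed.\<close>

lemma verts_eq_vset: "verts \<Omega> = vset \<Omega> (edges \<Omega>)"
proof
  show "vset \<Omega> (edges \<Omega>) \<subseteq> verts \<Omega>"
    using biased_graph_graph[OF B] unfolding graph_def vset_def by blast
  obtain C where C: "unbalanced_cycle \<Omega> C" "C \<subseteq> edges \<Omega>"
    by (rule unbalanced_cycle_exists[OF B ng])
  then have "u \<in> vset \<Omega> C"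
    using balanced_avoiding[OF B bal, of C] by (auto simp: unbalanced_cycle_def)
  then have "u \<in> vset \<Omega> (edges \<Omega>)" using vset_mono[OF C(2), of \<Omega>] by blast
  then show "verts \<Omega> \<subseteq> vset \<Omega> (edges \<Omega>)" using vset_committed(1) by blast
qed

lemma vertex_bijection:
  obtains f where "bij_betw f (verts \<Omega>) (vset \<Omega>' (edges \<Omega>))"
    "\<And>v. v \<in> verts \<Omega> - {u} \<Longrightarrow> star \<Omega>' (f v) = star \<Omega> v"
proof -
  have "\<exists>x. x \<in> vset \<Omega>' (edges \<Omega>) \<and> star \<Omega>' x = star \<Omega> v" if v: "v \<in> verts \<Omega> - {u}" for v
    by (rule committed_star[OF B B' F n3 com[OF v]]) blast
  then obtain h where h: "\<And>v. v \<in> verts \<Omega> - {u} \<Longrightarrow>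
    h v \<in> vset \<Omega>' (edges \<Omega>) \<and> star \<Omega>' (h v) = star \<Omega> v" by metis
  let ?V' = "vset \<Omega>' (edges \<Omega>)"
  have fin: "finite (verts \<Omega>)" "finite ?V'"
    using biased_graph_graph[OF B] graph_finite_vset[OF biased_graph_graph[OF B'], of "edges \<Omega>"]
    by (simp_all add: graph_def edges_eq)
  have u: "u \<in> verts \<Omega>" using bal by (simp add: balancing_def)
  have inj: "inj_on h (verts \<Omega> - {u})"
  proof (rule inj_onI)
    \<comment> \<open>Equal stars leave the same vertices covered, but removing the star of
      \<open>v\<close> uncovers exactly \<open>v\<close>, and likewise for \<open>w\<close>.\<close>
    fix v w assume vw: "v \<in> verts \<Omega> - {u}" "w \<in> verts \<Omega> - {u}" "h v = h w"
    then have "star \<Omega> v = star \<Omega> w" using h by metis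
    then have "vset \<Omega> (edges \<Omega>) - {v} = vset \<Omega> (edges \<Omega>) - {w}"
      using vset_committed(2)[OF vw(1)] vset_committed(2)[OF vw(2)] by simp
    then show "v = w" using vset_committed(1)[OF vw(1)] by blast
  qed
  have "card (h ` (verts \<Omega> - {u})) = card (verts \<Omega>) - 1"
    using card_image[OF inj] u by simp
  moreover have "card (verts \<Omega>) = card ?V'" using rank_eq_card verts_eq_vset by simp
  moreover have "card (verts \<Omega>) > 0" using u fin by (auto simp: card_gt_0_iff)
  moreover have sub: "h ` (verts \<Omega> - {u}) \<subseteq> ?V'" using h by blast
  ultimately have "card (?V' - h ` (verts \<Omega> - {u})) = 1"
    using fin by (simp add: card_Diff_subset)
  then obtain u' where u': "?V' - h ` (verts \<Omega> - {u}) = {u'}" by (auto simp: card_1_singleton_iff)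
  define f where "f = h(u := u')"
  have fh: "f v = h v" if "v \<in> verts \<Omega> - {u}" for v using that by (simp add: f_def)
  have img: "f ` (verts \<Omega> - {u}) = h ` (verts \<Omega> - {u})" using fh by (intro image_cong) simp_all
  have fu: "f u = u'" by (simp add: f_def)
  have Vu: "verts \<Omega> = insert u (verts \<Omega> - {u})" using u by blast
  have "f ` verts \<Omega> = insert u' (h ` (verts \<Omega> - {u}))"
    by (subst Vu) (simp only: image_insert fu img)
  then have "f ` verts \<Omega> = ?V'" using Diff_partition[OF sub] unfolding u' by simp
  moreover have "inj_on f (verts \<Omega>)"
    using \<open>f ` verts \<Omega> = ?V'\<close> \<open>card (verts \<Omega>) = card ?V'\<close> fin(1) by (intro eq_card_imp_inj_on) simp_all
  ultimately have "bij_betw f (verts \<Omega>) ?V'" by (simp add: bij_betw_def)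
  then show ?thesis using that[of f] fh h by simp
qed

lemma roll_up_of_same_frame_matroid:
  assumes V': "verts \<Omega>' = vset \<Omega>' (edges \<Omega>')"
  shows "is_roll_up_of \<Omega>' \<Omega>"
proof -
  let ?F = "frame_matroid \<Omega>" and ?E = "edges \<Omega>"
  note gr = biased_graph_graph[OF B] and gr' = biased_graph_graph[OF B']
  obtain f where f: "bij_betw f (verts \<Omega>) (vset \<Omega>' ?E)"
    and star: "\<And>v. v \<in> verts \<Omega> - {u} \<Longrightarrow> star \<Omega>' (f v) = star \<Omega> v"
    by (rule vertex_bijection) blast
  have u: "u \<in> verts \<Omega>" using bal by (simp add: balancing_def)
  have inj: "inj_on f (verts \<Omega>)" and fV: "f ` verts \<Omega> = vset \<Omega>' ?E"
    using f by (simp_all add: bij_betw_def)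
  have endsV: "ends \<Omega> e \<subseteq> verts \<Omega>" if "e \<in> ?E" for e
    unfolding verts_eq_vset using that by (auto simp: vset_def)
  have endsV': "ends \<Omega>' e \<subseteq> f ` verts \<Omega>" if "e \<in> ?E" for e
    unfolding fV using that by (auto simp: vset_def)
  have mem: "f v \<in> ends \<Omega>' e \<longleftrightarrow> v \<in> ends \<Omega> e" if "e \<in> ?E" "v \<in> verts \<Omega>" "v \<noteq> u" for e v
  proof -
    have "e \<in> star \<Omega>' (f v) \<longleftrightarrow> e \<in> star \<Omega> v" using star that by simp
    then show ?thesis using that(1) by (simp add: star_def edges_eq)
  qed
  \<comment> \<open>Equal stars fix all incidences except those with \<open>f u\<close>.\<close>
  have minus: "ends \<Omega>' e - {f u} = f ` (ends \<Omega> e - {u})" if e: "e \<in> ?E" for e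
  proof
    show "ends \<Omega>' e - {f u} \<subseteq> f ` (ends \<Omega> e - {u})"
    proof
      fix x assume x: "x \<in> ends \<Omega>' e - {f u}"
      then obtain v where v: "v \<in> verts \<Omega>" "x = f v" using endsV'[OF e] by blast
      then have "v \<noteq> u" using x by blast
      then show "x \<in> f ` (ends \<Omega> e - {u})" using mem[OF e v(1)] v x by blast
    qed
    show "f ` (ends \<Omega> e - {u}) \<subseteq> ends \<Omega>' e - {f u}"
    proof
      fix x assume "x \<in> f ` (ends \<Omega> e - {u})"
      then obtain v where v: "v \<in> ends \<Omega> e" "v \<noteq> u" "x = f v" by blast
      then have "v \<in> verts \<Omega>" using endsV[OF e] by blast
      then show "x \<in> ends \<Omega>' e - {f u}"
        using mem[OF e _ v(2)] v inj_onD[OF inj, of v u] u by auto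
    qed
  qed
  define R where "R = {e \<in> links_at \<Omega> u. f u \<notin> ends \<Omega>' e}"
  have RE: "R \<subseteq> ?E" by (auto simp: R_def links_at_def star_def)
  have ends_R: "ends \<Omega>' e = f ` (ends \<Omega> e - {u})" if "e \<in> R" for e
    using minus[of e] that RE by (auto simp: R_def)
  have circ: "C \<in> balanced \<Omega>' \<longleftrightarrow> cycle \<Omega>' C \<and> C \<in> circuits ?F" for C
    using balanced_iff_circuit[OF B', of C] unfolding F .
  \<comment> \<open>Only the membership of \<open>f u\<close> is open. A loop at \<open>u\<close>
    must keep its one end, and a link at \<open>u\<close> outside \<open>R\<close> keeps it by
    definition. An edge missing \<open>u\<close> that gained \<open>f u\<close> would have a single
    other end, so it would be a loop of \<open>\<Omega>\<close> avoiding \<open>u\<close>, hence a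
    circuit; in \<open>\<Omega>'\<close> it would be a link, with degree one at
    \<open>x\<close>.\<close>
  have ends_nR: "ends \<Omega>' e = f ` ends \<Omega> e" if e: "e \<in> ?E" "e \<notin> R" for e
  proof -
    have "f u \<in> ends \<Omega>' e \<longleftrightarrow> u \<in> ends \<Omega> e"
    proof (cases "u \<in> ends \<Omega> e")
      case True
      obtain v where v: "ends \<Omega> e = {u, v}" by (rule graph_ends_at[OF gr e(1) True])
      show ?thesis
      proof (cases "v = u")
        case True
        then have "ends \<Omega>' e - {f u} = {}" using minus[OF e(1)] v by simp
        moreover have "ends \<Omega>' e \<noteq> {}" using graph_ends_nonempty[OF gr'] e(1) edges_eq by blast
        ultimately show ?thesis using v by blast
      next
        case False
        then have "e \<in> links_at \<Omega> u" using e(1) v by (auto simp: links_at_iff[OF gr])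
        then show ?thesis using e(2) v by (simp add: R_def)
      qed
    next
      case False
      have "f u \<notin> ends \<Omega>' e"
      proof
        assume fu: "f u \<in> ends \<Omega>' e"
        then obtain x where x: "ends \<Omega>' e = {f u, x}"
          using graph_ends_at[OF gr', of e "f u"] e(1) edges_eq by blast
        have fe: "f ` ends \<Omega> e = {x} - {f u}" using minus[OF e(1)] x False by auto
        have "ends \<Omega> e \<noteq> {}" by (rule graph_ends_nonempty[OF gr e(1)])
        then have fe: "f ` ends \<Omega> e = {x}" "x \<noteq> f u" using fe by auto
        obtain v where v: "v \<in> ends \<Omega> e" using \<open>ends \<Omega> e \<noteq> {}\<close> by blast
        then have fv: "f v = x" using fe by blast
        have "w = v" if "w \<in> ends \<Omega> e" for w
        proof -
          have "f w = f v" using fe(1) that fv by blast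
          then show ?thesis using inj_onD[OF inj] that v endsV[OF e(1)] by blast
        qed
        then have ev: "ends \<Omega> e = {v}" using v by blast
        have "cycle \<Omega> {e}" by (rule loop_cycle[OF gr e(1) ev])
        moreover have "u \<notin> vset \<Omega> {e}" using False by simp
        ultimately have "{e} \<in> balanced \<Omega>" by (rule balanced_avoiding[OF B bal])
        then have c: "{e} \<in> circuits (frame_matroid \<Omega>')"
          unfolding F by (simp add: circuits_frame_matroid)
        have "2 \<le> deg \<Omega>' {e} x" by (rule circuit_deg[OF B' c]) (simp add: x)
        moreover have "deg \<Omega>' {e} x = 1"
          using deg_insert[of "{}" e \<Omega>' x] x fe(2) by auto
        ultimately show False by simp
      qed
      then show ?thesis using False by simp
    qed
    then show ?thesis using minus[OF e(1)] by auto
  qed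
  have ends_avoid: "ends \<Omega>' e = f ` ends \<Omega> e" if "e \<in> X" "X \<subseteq> ?E" "X \<inter> R = {}" for e X
    using ends_nR that by blast
  have inj_vset: "inj_on f (vset \<Omega> X)" if "X \<subseteq> ?E" for X
    using vset_mono[OF that, of \<Omega>] unfolding verts_eq_vset[symmetric] by (rule inj_on_subset[OF inj])
  have cyc: "cycle \<Omega>' C \<longleftrightarrow> cycle \<Omega> C" if C: "C \<subseteq> ?E" "C \<inter> R = {}" for C
    by (rule cycle_rename_iff[OF ends_avoid[OF _ C] inj_vset[OF C(1)]]) (use C edges_eq in auto)
  have link_not_circuit: "{e} \<notin> circuits ?F" if e: "e \<in> links_at \<Omega> u" for e
  proof
    assume c: "{e} \<in> circuits ?F"
    obtain v where v: "ends \<Omega> e = {u, v}" "v \<noteq> u" using e by (auto simp: links_at_iff[OF gr])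
    have "2 \<le> deg \<Omega> {e} u" by (rule circuit_deg[OF B c]) (simp add: v)
    moreover have "deg \<Omega> {e} u = 1" using deg_insert[of "{}" e \<Omega> u] v by auto
    ultimately show False by simp
  qed
  have R_loop: "\<exists>v. v \<noteq> u \<and> ends \<Omega> e = {u, v} \<and> ends \<Omega>' e = {f v}" if e: "e \<in> R" for e
  proof -
    obtain v where v: "ends \<Omega> e = {u, v}" "v \<noteq> u"
      using e by (auto simp: R_def links_at_iff[OF gr])
    then have "ends \<Omega> e - {u} = {v}" by auto
    then show ?thesis using ends_R[OF e] v by auto
  qed
  have R_links: "e \<in> links_at \<Omega> u" if "e \<in> R" for e using that by (simp add: R_def)
  \<comment> \<open>The circuits are common to both graphs, and a single link is never one, so the
    loop it becomes is unbalanced.\<close>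
  have R_unb: "unbalanced_cycle \<Omega>' {e}" if e: "e \<in> R" for e
  proof -
    obtain v where "ends \<Omega>' e = {f v}" using R_loop[OF e] by blast
    moreover have "e \<in> edges \<Omega>'" using e RE edges_eq by blast
    ultimately have "cycle \<Omega>' {e}" by (rule loop_cycle[OF gr', rotated])
    then show ?thesis using link_not_circuit[OF R_links[OF e]] by (simp add: unbalanced_cycle_def circ)
  qed
  have bal': "balanced \<Omega>' = {C \<in> balanced \<Omega>. C \<inter> R = {}}"
  proof (intro set_eqI iffI)
    fix C assume C: "C \<in> balanced \<Omega>'"
    then have c: "cycle \<Omega>' C" "C \<in> circuits ?F" using circ by simp_all
    have CE: "C \<subseteq> ?E" using c(1) by (simp add: cycle_def edges_eq)
    \<comment> \<open>A cycle of \<open>\<Omega>'\<close> meeting \<open>R\<close> is a single loop,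
      and that loop is not a circuit.\<close>
    have CR: "C \<inter> R = {}"
    proof (rule ccontr)
      assume "C \<inter> R \<noteq> {}"
      then obtain e where e: "e \<in> C" "e \<in> R" by blast
      obtain v where "ends \<Omega>' e = {f v}" using R_loop[OF e(2)] by blast
      then have "C = {e}" by (rule cycle_with_loop[OF gr' c(1) e(1)])
      then show False using link_not_circuit[OF R_links[OF e(2)]] c(2) by simp
    qed
    then have "cycle \<Omega> C" using cyc[OF CE] c(1) by simp
    then show "C \<in> {C \<in> balanced \<Omega>. C \<inter> R = {}}"
      using CR c(2) by (simp add: balanced_iff_circuit[OF B])
  next
    fix C assume "C \<in> {C \<in> balanced \<Omega>. C \<inter> R = {}}"
    then have C: "cycle \<Omega> C" "C \<in> circuits ?F" "C \<inter> R = {}"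
      by (simp_all add: balanced_iff_circuit[OF B])
    then have "C \<subseteq> ?E" by (simp add: cycle_def)
    then show "C \<in> balanced \<Omega>'" using cyc C by (simp add: circ)
  qed
  have V'': "verts \<Omega>' = vset \<Omega>' ?E" using V' edges_eq by simp
  show ?thesis
  proof (cases "R = {}")
    case True
    have "vertex_renaming \<Omega> \<Omega>'"
      unfolding vertex_renaming_def
      using f ends_nR True bal' edges_eq V'' by (intro conjI exI[of _ f]) auto
    then show ?thesis by (intro is_roll_up_ofI[OF B bal]) simp
  next
    case False
    then obtain e0 where e0: "e0 \<in> R" by blast
    have rel_R: "g \<in> R" if eg: "e \<in> R" "(e, g) \<in> unbalancing_rel \<Omega> u" for e g
    proof (rule ccontr)
      assume gR: "g \<notin> R"
      then have ne: "e \<noteq> g" using eg by blast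
      have gl: "g \<in> links_at \<Omega> u" using eg(2) by (simp add: unbalancing_rel_def)
      obtain C where C: "C \<in> balanced \<Omega>" "e \<in> C" "g \<in> C"
        using eg(2) ne by (auto simp: unbalancing_rel_def)
      have Cc: "C \<in> circuits (frame_matroid \<Omega>')" unfolding F using C(1) by (simp add: circuits_frame_matroid)
      have cyC: "cycle \<Omega> C" by (rule balanced_cycle[OF B C(1)])
      then have CE: "C \<subseteq> ?E" by (simp add: cycle_def)
      obtain g' where g': "g' \<in> C" "g' \<noteq> e" "{h \<in> C. u \<in> ends \<Omega> h} = {e, g'}"
        by (rule cycle_links_at[OF B bal cyC C(2) R_links[OF eg(1)]]) blast
      have gE: "g \<in> ?E" "u \<in> ends \<Omega> g" using gl by (auto simp: links_at_iff[OF gr])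
      then have "g \<in> {h \<in> C. u \<in> ends \<Omega> h}" using C(3) by simp
      then have gg: "g = g'" unfolding g'(3) using ne by blast
      have fu_iff: "f u \<in> ends \<Omega>' h \<longleftrightarrow> u \<in> ends \<Omega> h" if "h \<in> ?E" "h \<notin> R" for h
        unfolding ends_nR[OF that] using inj_on_image_mem_iff[OF inj u endsV[OF that(1)]] .
      have gu: "f u \<in> ends \<Omega>' g" using fu_iff[OF gE(1) gR] gE(2) by simp
      have "h = g" if h: "h \<in> C" "f u \<in> ends \<Omega>' h" for h
      proof -
        have hE: "h \<in> ?E" "h \<notin> R" using h CE by (auto simp: R_def)
        then have "h \<in> {h \<in> C. u \<in> ends \<Omega> h}" using fu_iff h by simp
        then show ?thesis unfolding g'(3) using hE eg(1) gg by blast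
      qed
      then have "{h \<in> C. f u \<in> ends \<Omega>' h} = {h \<in> {g}. f u \<in> ends \<Omega>' h}" using C(3) by blast
      then have "deg \<Omega>' C (f u) = deg \<Omega>' {g} (f u)" by (rule deg_cong_star)
      moreover obtain w where w: "ends \<Omega> g = {u, w}" "w \<noteq> u"
        using gl by (auto simp: links_at_iff[OF gr])
      then have "w \<in> verts \<Omega>" using endsV[OF gE(1)] by blast
      then have "f w \<noteq> f u" using inj_onD[OF inj, of w u] u w(2) by blast
      then have "deg \<Omega>' {g} (f u) = 1"
        using deg_insert[of "{}" g \<Omega>' "f u"] ends_nR[OF gE(1) gR] w by auto
      moreover have "2 \<le> deg \<Omega>' C (f u)"
        by (rule circuit_deg[OF B' Cc]) (use gu C(3) in \<open>auto simp: vset_def\<close>)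
      ultimately show False by simp
    qed
    have R_rel: "(e, g) \<in> unbalancing_rel \<Omega> u" if e: "e \<in> R" and g: "g \<in> R" for e g
    proof (cases "e = g")
      case True
      then show ?thesis using R_links[OF e] by (simp add: unbalancing_rel_def)
    next
      case False
      obtain v where v: "v \<noteq> u" "ends \<Omega> e = {u, v}" "ends \<Omega>' e = {f v}" using R_loop[OF e] by blast
      obtain w where w: "w \<noteq> u" "ends \<Omega> g = {u, w}" "ends \<Omega>' g = {f w}" using R_loop[OF g] by blast
      have E: "e \<in> ?E" "g \<in> ?E" using e g RE by auto
      have vw: "v \<in> verts \<Omega>" "w \<in> verts \<Omega>" using endsV[OF E(1)] endsV[OF E(2)] v w by auto
      have "(v, w) \<in> (adj \<Omega> (?E - star \<Omega> u))\<^sup>*"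
        using vw u v(1) w(1) by (intro conn_minus_vertex[OF B n3 rank_eq_card(1)]) (simp_all add: verts_eq_vset[symmetric])
      then obtain P where P: "P \<subseteq> ?E - star \<Omega> u" "gpath \<Omega> v w P"
        by (rule gpath_of_adj[OF gr]) blast
      have PE: "P \<subseteq> ?E" using P(1) by blast
      have uP: "u \<notin> insert v (vset \<Omega> P)" using P(1) v(1) by (auto simp: star_def vset_def)
      \<comment> \<open>All of \<open>R\<close> is incident with \<open>u\<close> while
        \<open>P\<close> avoids it, so \<open>f\<close> carries \<open>P\<close> to a path of
        \<open>\<Omega>'\<close>.\<close>
      have PR: "P \<inter> R = {}" using P(1) R_links by (auto simp: links_at_def)
      have nP: "e \<notin> P" "g \<notin> P" using PR e g by auto
      have uw: "u \<noteq> w" using w(1) by simp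
      have g1: "gpath \<Omega> u w (insert e P)" by (rule gpath_Cons[OF E(1) v(2) P(2) uP])
      have g2: "gpath \<Omega> u w {g}" by (rule gpath_edge[OF E(2) w(2) uw])
      have "vset \<Omega> (insert e P) \<inter> vset \<Omega> {g} = {u, w}"
        using gpath_neq(2,3)[OF g1 uw] w(2) by auto
      moreover have "insert e P \<inter> {g} = {}" using nP False by auto
      ultimately have cyc: "cycle \<Omega> (insert e P \<union> {g})" by (intro cycle_of_gpaths[OF g1 g2 uw])
      have unb: "unbalanced_cycle \<Omega>' {e}" "unbalanced_cycle \<Omega>' {g}" using R_unb e g by auto
      have "insert e P \<union> {g} \<in> circuits (frame_matroid \<Omega>')"
      \<comment> \<open>Parallel links need no path: they become two loops at one vertex, a tight
        handcuff. Otherwise the path between their ends gives a loose one.\<close>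
      proof (cases "v = w")
        case True
        then have "P = {}" using P(2) gpath_trivial[of \<Omega> v P] by simp
        moreover have "tight_handcuff \<Omega>' ({e} \<union> {g})"
          unfolding tight_handcuff_def using unb False v(3) w(3) True
          by (intro exI[of _ "{e}"] exI[of _ "{g}"] exI[of _ "f v"]) simp
        ultimately show ?thesis by (simp add: circuits_frame_matroid)
      next
        case False
        have fvw: "f v \<noteq> f w" using inj_onD[OF inj, of v w] vw False by blast
        have "insert v (vset \<Omega> P) \<subseteq> verts \<Omega>"
          using vset_mono[OF PE, of \<Omega>] vw unfolding verts_eq_vset by blast
        then have "gpath \<Omega>' (f v) (f w) P"
          by (intro gpath_rename[OF P(2) ends_avoid[OF _ PE PR]] inj_on_subset[OF inj])
            (use PE edges_eq in auto)
        then have p: "is_path \<Omega>' (f v) (f w) P" by (rule gpath_is_path[OF _ fvw])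
        have "loose_handcuff \<Omega>' ({e} \<union> {g} \<union> P)"
          unfolding loose_handcuff_def using unb p v(3) w(3) fvw is_path_ends[OF p]
          by (intro exI[of _ "{e}"] exI[of _ "{g}"] exI[of _ P] exI[of _ "f v"] exI[of _ "f w"]) simp
        moreover have "insert e P \<union> {g} = {e} \<union> {g} \<union> P" by blast
        ultimately show ?thesis by (simp add: circuits_frame_matroid)
      qed
      then have "insert e P \<union> {g} \<in> balanced \<Omega>"
        unfolding F using cyc by (simp add: balanced_iff_circuit[OF B])
      then have "\<exists>C\<in>balanced \<Omega>. e \<in> C \<and> g \<in> C" by (rule bexI[rotated]) simp
      then show ?thesis using R_links[OF e] R_links[OF g] by (simp add: unbalancing_rel_def)
    qed
    let ?S = "unbalancing_rel \<Omega> u `` {e0}"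
    have S: "?S = R" using rel_R[OF e0] R_rel[OF e0] by blast
    have L: "{e \<in> R. is_link \<Omega> e} = R" using R_links by (auto simp: links_at_def)
    have roll: "roll \<Omega> u ?S = \<Omega>\<lparr>ends := \<lambda>e. if e \<in> R then ends \<Omega> e - {u} else ends \<Omega> e,
       balanced := {C \<in> balanced \<Omega>. C \<inter> R = {}}\<rparr>"
      unfolding roll_def S L Let_def ..
    have "vertex_renaming (roll \<Omega> u ?S) \<Omega>'"
      unfolding vertex_renaming_def roll
      using f ends_R ends_nR bal' edges_eq V'' by (intro conjI exI[of _ f]) auto
    then show ?thesis using R_links[OF e0] by (intro is_roll_up_ofI[OF B bal]) blast
  qed
qed

end

text \<open>Cycles, thetas and circuits read only \<open>edges\<close>, \<open>ends\<close> and
  \<open>balanced\<close>; the vertex set enters \<open>biased_graph\<close> through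
  \<open>graph\<close> alone.\<close>

lemma without_isolated:
  assumes "biased_graph \<Omega>"
  shows "biased_graph (without_isolated \<Omega>)" "frame_matroid (without_isolated \<Omega>) = frame_matroid \<Omega>"
    "verts (without_isolated \<Omega>) = vset (without_isolated \<Omega>) (edges (without_isolated \<Omega>))"
proof -
  let ?W = "without_isolated \<Omega>"
  have s: "edges ?W = edges \<Omega>" "ends ?W = ends \<Omega>" "balanced ?W = balanced \<Omega>" "verts ?W = vset \<Omega> (edges \<Omega>)"
    by (simp_all add: without_isolated_def)
  have v: "vset ?W = vset \<Omega>" by (simp add: vset_def s fun_eq_iff)
  have d: "deg ?W = deg \<Omega>" by (simp add: deg_def s fun_eq_iff)
  have c: "conn ?W = conn \<Omega>" by (simp add: conn_def s v fun_eq_iff)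
  have cy: "cycle ?W = cycle \<Omega>" by (simp add: cycle_def s v d c fun_eq_iff)
  have p: "is_path ?W = is_path \<Omega>" by (simp add: is_path_def s v d c fun_eq_iff)
  have t: "theta ?W = theta \<Omega>" by (simp add: theta_def v p fun_eq_iff)
  have u: "unbalanced_cycle ?W = unbalanced_cycle \<Omega>" by (simp add: unbalanced_cycle_def s cy fun_eq_iff)
  have h: "tight_handcuff ?W = tight_handcuff \<Omega>" "loose_handcuff ?W = loose_handcuff \<Omega>"
    "unbalanced_theta ?W = unbalanced_theta \<Omega>"
    by (simp_all add: tight_handcuff_def loose_handcuff_def unbalanced_theta_def v u p t cy fun_eq_iff)
  have "graph ?W"
    using biased_graph_graph[OF assms] graph_finite_vset[OF biased_graph_graph[OF assms] subset_refl]
    unfolding graph_def s by (auto simp: vset_def)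
  then show "biased_graph ?W" using assms by (simp add: biased_graph_def s cy t)
  show "frame_matroid ?W = frame_matroid \<Omega>" by (simp add: frame_matroid_def s h)
  show "verts ?W = vset ?W (edges ?W)" by (simp add: s v)
qed

theorem theorem4p1:
  fixes \<Omega> :: "('v, 'e) bgraph" and u :: 'v
  assumes "biased_graph \<Omega>"
    and "balancing \<Omega> u"
    and "n_connected 3 (frame_matroid \<Omega>)"
    and "\<not> graphic (frame_matroid \<Omega>)"
    and "\<forall>v \<in> verts \<Omega> - {u}. committed \<Omega> v"
  shows "\<forall>\<Omega>' :: ('w, 'e) bgraph.
           biased_graph \<Omega>' \<and> frame_matroid \<Omega>' = frame_matroid \<Omega> \<longrightarrow>
           is_roll_up_of (without_isolated \<Omega>') \<Omega>"
proof (intro allI impI)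
  fix \<Omega>' :: "('w, 'e) bgraph"
  assume "biased_graph \<Omega>' \<and> frame_matroid \<Omega>' = frame_matroid \<Omega>"
  then have "biased_graph \<Omega>'" and F: "frame_matroid \<Omega>' = frame_matroid \<Omega>" by simp_all
  \<comment> \<open>After removing isolated vertices, the bijection onto the covered vertices is one
    onto all vertices, as \<open>vertex_renaming\<close> demands.\<close>
  note W = without_isolated[OF this(1)]
  show "is_roll_up_of (without_isolated \<Omega>') \<Omega>"
    by (rule roll_up_of_same_frame_matroid[OF assms(1-4) _ W(1) _ W(3)])
      (use assms(5) W(2) F in auto)
qed

end
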